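(* Let $n\ge 3$ be an integer. In the hyperbolic plane $\mathbf{H}^2$, the regular $n$-gon $Q_n$ has strictly less perimeter than any other $n$-gon $Q$ of the same area (that is, any $n$-gon $Q$ of the same area not congruent to $Q_n$).
   Context: $\mathbf{H}^2$ is the hyperbolic plane of curvature $-1$. An $n$-gon in $\mathbf{H}^2$ is a (simple, geodesic, not necessarily convex) polygon with $n$ vertices; vertices with interior angle of measure $\pi$ are allowed. Its area is the area of the enclosed region. *)

theory Defs
  imports "HOL-Analysis.Analysis"
begin

text \<open>The hyperbolic plane of curvature -1 in the Beltrami--Klein (projective) model: the open unit
  disc, in which the geodesics are the Euclidean chords.\<close>

definition hplane :: "complex set" where
  "hplane = ball 0 1"

definition hdist :: "complex \<Rightarrow> complex \<Rightarrow> real" where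
  "hdist p q = arcosh ((1 - p \<bullet> q) / sqrt ((1 - (norm p)\<^sup>2) * (1 - (norm q)\<^sup>2)))"

text \<open>The Riemannian metric at \<open>p\<close>, evaluated on tangent vectors \<open>u\<close>, \<open>w\<close>.\<close>

definition hmetric :: "complex \<Rightarrow> complex \<Rightarrow> complex \<Rightarrow> real" where
  "hmetric p u w = (u \<bullet> w) / (1 - (norm p)\<^sup>2) + (p \<bullet> u) * (p \<bullet> w) / (1 - (norm p)\<^sup>2)\<^sup>2"

text \<open>The area density is the square root of the Gram determinant \<open>(1 - (norm p)\<^sup>2) powr (-3)\<close> of
  \<open>hmetric p\<close>.\<close>

definition harea :: "complex set \<Rightarrow> real" where
  "harea A = (LINT p:A|lborel. (1 - (norm p)\<^sup>2) powr (- 3 / 2))"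

text \<open>The angle in \<open>[0, \<pi>]\<close> at \<open>p\<close> between the geodesic rays from \<open>p\<close> through \<open>q\<close> and through \<open>r\<close>.
  As geodesics are chords, \<open>q - p\<close> and \<open>r - p\<close> are tangent vectors to these rays. The model is not
  conformal, so angles are measured with \<open>hmetric\<close>.\<close>

definition hangle :: "complex \<Rightarrow> complex \<Rightarrow> complex \<Rightarrow> real" where
  "hangle q p r =
     arccos (hmetric p (q - p) (r - p) /
       sqrt (hmetric p (q - p) (q - p) * hmetric p (r - p) (r - p)))"

definition hisometry :: "(complex \<Rightarrow> complex) \<Rightarrow> bool" where
  "hisometry f \<longleftrightarrow> bij_betw f hplane hplane \<and>
     (\<forall>p\<in>hplane. \<forall>q\<in>hplane. hdist (f p) (f q) = hdist p q)"

text \<open>A polygon is given by the cyclic list of its vertices.\<close>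

definition vertex :: "complex list \<Rightarrow> nat \<Rightarrow> complex" where
  "vertex P i = P ! (i mod length P)"

definition side :: "complex list \<Rightarrow> nat \<Rightarrow> complex set" where
  "side P i = closed_segment (vertex P i) (vertex P (Suc i))"

definition boundary :: "complex list \<Rightarrow> complex set" where
  "boundary P = (\<Union>i<length P. side P i)"

text \<open>Consecutive sides meet only in their common vertex, other pairs of sides are disjoint. Three
  consecutive vertices may be collinear, which gives a vertex with interior angle \<open>\<pi>\<close>.\<close>

definition ngon :: "nat \<Rightarrow> complex list \<Rightarrow> bool" where
  "ngon n P \<longleftrightarrow> n \<ge> 3 \<and> length P = n \<and> set P \<subseteq> hplane \<and> distinct P \<and>
     (\<forall>i<n. side P i \<inter> side P (Suc i) = {vertex P (Suc i)}) \<and>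
     (\<forall>i<n. \<forall>j<n. i \<noteq> j \<and> j \<noteq> Suc i mod n \<and> i \<noteq> Suc j mod n \<longrightarrow> side P i \<inter> side P j = {})"

definition enclosed_region :: "complex list \<Rightarrow> complex set" where
  "enclosed_region P = inside (boundary P)"

definition perimeter :: "complex list \<Rightarrow> real" where
  "perimeter P = (\<Sum>i<length P. hdist (vertex P i) (vertex P (Suc i)))"

definition polygon_area :: "complex list \<Rightarrow> real" where
  "polygon_area P = harea (enclosed_region P)"

text \<open>Hyperbolic and Euclidean convexity agree in this model. For a convex polygon the interior angle
  at a vertex is the angle in \<open>[0, \<pi>]\<close> between the two sides meeting there.\<close>

definition regular_ngon :: "nat \<Rightarrow> complex list \<Rightarrow> bool" where
  "regular_ngon n P \<longleftrightarrow> ngon n P \<and> convex (enclosed_region P) \<and>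
     (\<forall>i<n. \<forall>j<n. hdist (vertex P i) (vertex P (Suc i)) = hdist (vertex P j) (vertex P (Suc j))) \<and>
     (\<forall>i<n. \<forall>j<n. hangle (vertex P i) (vertex P (Suc i)) (vertex P (Suc (Suc i))) =
                   hangle (vertex P j) (vertex P (Suc j)) (vertex P (Suc (Suc j))))"

definition congruent_polygons :: "complex list \<Rightarrow> complex list \<Rightarrow> bool" where
  "congruent_polygons P Q \<longleftrightarrow>
     (\<exists>f. hisometry f \<and> f ` boundary P = boundary Q \<and> f ` set P = set Q)"

end

theory Submission
  imports Defs "HOL-Complex_Analysis.Complex_Analysis"
begin

text \<open>Fix a point \<open>0\<close> and cut a polygon into the signed triangles spanned by \<open>0\<close> and its sides: counted with
  winding numbers, their areas add up to plus or minus the area of the polygon. This signed area makes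
  sense for every closed \<open>n\<close>-tuple of points, simple or not, and on the tuples of perimeter at most \<open>L\<close> it
  attains a maximum by compactness. At a maximum without repeated neighbours the Lagrange multiplier
  equation at a vertex forces the two adjacent sides to have equal length, and the same length and turning
  angle occur at all vertices. The tuple is therefore an orbit of a rotation by \<open>2 \<pi> k / n\<close>. For given
  perimeter the area is largest when \<open>k = 1\<close>, so only the regular polygon attains the maximum.\<close>

subsection \<open>The disc model and its automorphisms\<close>

text \<open>Simple polygons are not closed under limits, so an extremal polygon cannot be extracted
  directly. Closed tuples with signed area become compact once one vertex is moved to 0, at the
  price that a maximizer may have repeated neighbours, where the distance is not differentiable.
  Moreover, compactness yields only some maximizer and says nothing about the given
  \<open>Q\<close>. The structure result is therefore used twice. Applied to a maximizer without
  zero sides, with \<open>L\<close> the perimeter of the regular polygon, it bounds the maximal area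
  by that of the regular polygon. A polygon \<open>Q\<close> of the same area and no larger
  perimeter then attains the maximum itself; being simple, it has no zero sides, and the multiplier
  equation for \<open>Q\<close> makes it a rotation orbit with the same angle and side length. These
  two data determine the circumradius, hence the congruence class. Signed area depends on the
  orientation, which a vertex list leaves open; complex conjugation switches between the two
  orientations.\<close>

text \<open>All computations take place in the conformal (Poincare) disc, where the direct isometries are the
  maps \<open>daut \<alpha> \<beta>\<close> with \<open>norm \<beta> < norm \<alpha>\<close>; the maps \<open>klein\<close> and \<open>kinv\<close> below pass to the projective
  model and back.\<close>

definition daut :: "complex \<Rightarrow> complex \<Rightarrow> complex \<Rightarrow> complex" where
  "daut \<alpha> \<beta> z = (\<alpha> * z + \<beta>) / (cnj \<beta> * z + cnj \<alpha>)"

text \<open>The translation that takes \<open>c\<close> to 0. The norm of \<open>mob c z\<close> is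
  the hyperbolic tangent of half the distance from \<open>c\<close> to \<open>z\<close>, and its
  argument is the direction at \<open>c\<close> of the geodesic towards \<open>z\<close>.\<close>

definition mob :: "complex \<Rightarrow> complex \<Rightarrow> complex" where
  "mob c z = (z - c) / (1 - cnj c * z)"

definition coshd :: "complex \<Rightarrow> complex \<Rightarrow> real" where
  "coshd z w = 1 + 2 * (norm (z - w))\<^sup>2 / ((1 - (norm z)\<^sup>2) * (1 - (norm w)\<^sup>2))"

definition pdist :: "complex \<Rightarrow> complex \<Rightarrow> real" where
  "pdist z w = arcosh (coshd z w)"

text \<open>The signed area of the triangle with vertices \<open>0\<close>, \<open>z\<close>, \<open>w\<close>.\<close>

definition tri_area :: "complex \<Rightarrow> complex \<Rightarrow> real" where
  "tri_area z w = - 2 * Arg (1 - cnj z * w)"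

lemma one_minus_norm_pos: "norm z < 1 \<Longrightarrow> 0 < 1 - (norm (z::complex))\<^sup>2"
  by (simp add: abs_square_less_1)

lemma Re_one_minus_pos:
  assumes "norm a \<le> 1" "norm b < 1" shows "0 < Re (1 - a * b)"
proof -
  have "Re (a * b) \<le> norm (a * b)" by (rule complex_Re_le_cmod)
  also have "\<dots> \<le> 1 * norm b" unfolding norm_mult by (intro mult_right_mono) (use assms in auto)
  finally show ?thesis using assms by simp
qed

lemma Re_one_minus_cnj_pos: "norm z < 1 \<Longrightarrow> norm w < 1 \<Longrightarrow> 0 < Re (1 - cnj z * w)"
  by (rule Re_one_minus_pos) auto

lemma one_minus_cnj_nz: "norm z < 1 \<Longrightarrow> norm w < 1 \<Longrightarrow> 1 - cnj z * w \<noteq> 0"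
  using Re_one_minus_cnj_pos[of z w] by fastforce

text \<open>Through this identity \<open>norm (mob z w)\<close>, \<open>coshd z w\<close> and the
  conformal factors at \<open>z\<close> and \<open>w\<close> determine one another.\<close>

lemma norm_one_minus_cnj:
  "(norm (1 - cnj z * w))\<^sup>2 = (norm (z - w))\<^sup>2 + (1 - (norm z)\<^sup>2) * (1 - (norm w)\<^sup>2)"
  unfolding cmod_power2 by (simp add: algebra_simps power2_eq_square)

lemma mob_daut: "mob c = daut 1 (- c)"
  by (simp add: mob_def daut_def fun_eq_iff)

lemma norm_mob_sq:
  assumes "norm z < 1" "norm w < 1"
  shows "1 - (norm (mob z w))\<^sup>2 = (1 - (norm z)\<^sup>2) * (1 - (norm w)\<^sup>2) / (norm (1 - cnj z * w))\<^sup>2"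
proof -
  have "norm (1 - cnj z * w) \<noteq> 0" using one_minus_cnj_nz[OF assms] by simp
  then show ?thesis
    using norm_one_minus_cnj[of z w] unfolding mob_def norm_divide power_divide
    by (simp add: field_simps norm_minus_commute)
qed

lemma norm_mob: assumes "norm z < 1" "norm w < 1" shows "norm (mob z w) < 1"
proof -
  have "0 < 1 - (norm (mob z w))\<^sup>2"
    unfolding norm_mob_sq[OF assms] using assms one_minus_cnj_nz[OF assms]
    by (intro divide_pos_pos mult_pos_pos one_minus_norm_pos) auto
  then show ?thesis by (simp add: abs_square_less_1)
qed

lemma coshd_mob:
  assumes "norm z < 1" "norm w < 1"
  shows "coshd z w = (1 + (norm (mob z w))\<^sup>2) / (1 - (norm (mob z w))\<^sup>2)"
proof -
  define A where "A = (1 - (norm z)\<^sup>2) * (1 - (norm w)\<^sup>2)"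
  define N where "N = (norm (1 - cnj z * w))\<^sup>2"
  have A: "A > 0" unfolding A_def using assms by (intro mult_pos_pos one_minus_norm_pos)
  have N: "N > 0" unfolding N_def using one_minus_cnj_nz[OF assms] by simp
  have m: "(norm (mob z w))\<^sup>2 = 1 - A / N"
    using norm_mob_sq[OF assms] unfolding A_def N_def by simp
  have d: "(norm (z - w))\<^sup>2 = N - A" unfolding A_def N_def norm_one_minus_cnj by simp
  show ?thesis unfolding coshd_def d m A_def[symmetric] using A N by (simp add: field_simps)
qed

lemma coshd_ge_1: assumes "norm z < 1" "norm w < 1" shows "1 \<le> coshd z w"
  unfolding coshd_def using assms one_minus_norm_pos by (simp add: less_imp_le)

lemma mob_eq_0_iff: "norm z < 1 \<Longrightarrow> norm w < 1 \<Longrightarrow> mob z w = 0 \<longleftrightarrow> z = w"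
  using one_minus_cnj_nz[of z w] by (auto simp: mob_def)

lemma coshd_commute: "coshd z w = coshd w z"
  by (simp add: coshd_def norm_minus_commute mult.commute)

lemma coshd_eq_iff_norm_mob:
  assumes "norm z < 1" "norm w < 1" "norm x < 1" "norm y < 1"
  shows "coshd z w = coshd x y \<longleftrightarrow> norm (mob z w) = norm (mob x y)"
proof
  assume *: "coshd z w = coshd x y"
  have "1 - (norm (mob z w))\<^sup>2 > 0" "1 - (norm (mob x y))\<^sup>2 > 0"
    using assms norm_mob one_minus_norm_pos by auto
  then have "(norm (mob z w))\<^sup>2 = (norm (mob x y))\<^sup>2"
    using * unfolding coshd_mob[OF assms(1,2)] coshd_mob[OF assms(3,4)] by (simp add: field_simps)
  then show "norm (mob z w) = norm (mob x y)" by (simp add: power2_eq_iff_nonneg)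
qed (simp add: coshd_mob assms)

lemma pdist_eq_iff_coshd:
  assumes "norm z < 1" "norm w < 1" "norm x < 1" "norm y < 1"
  shows "pdist z w = pdist x y \<longleftrightarrow> coshd z w = coshd x y"
  unfolding pdist_def using assms coshd_ge_1 by (metis cosh_arcosh_real)

lemma norm_mob_commute: "norm z < 1 \<Longrightarrow> norm w < 1 \<Longrightarrow> norm (mob z w) = norm (mob w z)"
  using coshd_eq_iff_norm_mob coshd_commute by blast

lemma pdist_nonneg: assumes "norm z < 1" "norm w < 1" shows "0 \<le> pdist z w"
  unfolding pdist_def using coshd_ge_1[OF assms] by simp

lemma pdist_self: "pdist z z = 0"
  by (simp add: pdist_def coshd_def)

section \<open>Invariance under automorphisms\<close>

lemma daut_denom_nz:
  assumes "norm \<beta> < norm \<alpha>" "norm z < 1" shows "cnj \<beta> * z + cnj \<alpha> \<noteq> 0"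
proof
  assume "cnj \<beta> * z + cnj \<alpha> = 0"
  then have "norm (cnj \<beta> * z) = norm (cnj \<alpha>)" by (metis add_eq_0_iff norm_minus_cancel)
  moreover have "norm \<beta> * norm z \<le> norm \<beta> * 1" using assms by (intro mult_left_mono) auto
  ultimately show False using assms by (simp add: norm_mult)
qed

text \<open>In homogeneous coordinates \<open>1 - cnj x * y\<close> is a Hermitian form of signature
  (1,1), which the matrix of the automorphism multiplies by its determinant; the denominators come
  from returning to affine coordinates.\<close>

lemma daut_one_minus:
  assumes "norm \<beta> < norm \<alpha>" "norm x < 1" "norm y < 1"
  shows "1 - cnj (daut \<alpha> \<beta> x) * daut \<alpha> \<beta> y =
    of_real ((norm \<alpha>)\<^sup>2 - (norm \<beta>)\<^sup>2) * (1 - cnj x * y) / (cnj (cnj \<beta> * x + cnj \<alpha>) * (cnj \<beta> * y + cnj \<alpha>))"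
proof -
  have n: "cnj (cnj \<beta> * x + cnj \<alpha>) \<noteq> 0" "cnj \<beta> * y + cnj \<alpha> \<noteq> 0"
    using daut_denom_nz[OF assms(1,2)] daut_denom_nz[OF assms(1,3)] unfolding complex_cnj_zero_iff
      by auto
  have "1 - cnj (daut \<alpha> \<beta> x) * daut \<alpha> \<beta> y =
    (cnj (cnj \<beta> * x + cnj \<alpha>) * (cnj \<beta> * y + cnj \<alpha>) - cnj (\<alpha> * x + \<beta>) * (\<alpha> * y + \<beta>))
      / (cnj (cnj \<beta> * x + cnj \<alpha>) * (cnj \<beta> * y + cnj \<alpha>))"
    unfolding daut_def complex_cnj_divide using n
      by (simp only: diff_divide_distrib times_divide_times_eq) simp
  also have "cnj (cnj \<beta> * x + cnj \<alpha>) * (cnj \<beta> * y + cnj \<alpha>) - cnj (\<alpha> * x + \<beta>) * (\<alpha> * y + \<beta>)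
     = (\<alpha> * cnj \<alpha> - \<beta> * cnj \<beta>) * (1 - cnj x * y)"
    by (simp add: algebra_simps)
  also have "\<alpha> * cnj \<alpha> - \<beta> * cnj \<beta> = of_real ((norm \<alpha>)\<^sup>2 - (norm \<beta>)\<^sup>2)"
    by (simp only: complex_norm_square of_real_diff)
  finally show ?thesis .
qed

lemma daut_diff:
  assumes "norm \<beta> < norm \<alpha>" "norm x < 1" "norm y < 1"
  shows "daut \<alpha> \<beta> y - daut \<alpha> \<beta> x =
    of_real ((norm \<alpha>)\<^sup>2 - (norm \<beta>)\<^sup>2) * (y - x) / ((cnj \<beta> * x + cnj \<alpha>) * (cnj \<beta> * y + cnj \<alpha>))"
proof -
  have n: "cnj \<beta> * x + cnj \<alpha> \<noteq> 0" "cnj \<beta> * y + cnj \<alpha> \<noteq> 0"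
    using daut_denom_nz[OF assms(1,2)] daut_denom_nz[OF assms(1,3)] by auto
  have "daut \<alpha> \<beta> y - daut \<alpha> \<beta> x = ((\<alpha> * y + \<beta>) * (cnj \<beta> * x + cnj \<alpha>) - (\<alpha> * x + \<beta>) * (cnj \<beta> * y + cnj \<alpha>))
      / ((cnj \<beta> * x + cnj \<alpha>) * (cnj \<beta> * y + cnj \<alpha>))"
    unfolding daut_def using diff_frac_eq[OF n(2) n(1)] by (simp add: mult.commute)
  also have "(\<alpha> * y + \<beta>) * (cnj \<beta> * x + cnj \<alpha>) - (\<alpha> * x + \<beta>) * (cnj \<beta> * y + cnj \<alpha>)
     = (\<alpha> * cnj \<alpha> - \<beta> * cnj \<beta>) * (y - x)"
    by (simp add: algebra_simps)
  also have "\<alpha> * cnj \<alpha> - \<beta> * cnj \<beta> = of_real ((norm \<alpha>)\<^sup>2 - (norm \<beta>)\<^sup>2)"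
    by (simp only: complex_norm_square of_real_diff)
  finally show ?thesis .
qed

lemma daut_norm_eq:
  assumes "norm \<beta> < norm \<alpha>" "norm x < 1"
  shows "1 - (norm (daut \<alpha> \<beta> x))\<^sup>2
    = ((norm \<alpha>)\<^sup>2 - (norm \<beta>)\<^sup>2) * (1 - (norm x)\<^sup>2) / (norm (cnj \<beta> * x + cnj \<alpha>))\<^sup>2"
proof -
  have "complex_of_real (1 - (norm (daut \<alpha> \<beta> x))\<^sup>2) = 1 - cnj (daut \<alpha> \<beta> x) * daut \<alpha> \<beta> x"
    by (simp only: of_real_diff of_real_1 complex_norm_square mult.commute)
  also have "\<dots> = of_real ((norm \<alpha>)\<^sup>2 - (norm \<beta>)\<^sup>2) * (1 - x * cnj x) / ((cnj \<beta> * x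
    + cnj \<alpha>) * cnj (cnj \<beta> * x + cnj \<alpha>))"
    unfolding daut_one_minus[OF assms assms(2)] by (simp only: mult.commute)
  also have "\<dots> = complex_of_real (((norm \<alpha>)\<^sup>2 - (norm \<beta>)\<^sup>2) * (1 - (norm x)\<^sup>2) / (norm (cnj \<beta> * x
    + cnj \<alpha>))\<^sup>2)"
    by (simp only: of_real_diff of_real_1 of_real_mult of_real_divide complex_norm_square)
  finally show ?thesis by (simp only: of_real_eq_iff)
qed

lemma norm_daut:
  assumes "norm \<beta> < norm \<alpha>" "norm x < 1" shows "norm (daut \<alpha> \<beta> x) < 1"
proof -
  have "0 < 1 - (norm (daut \<alpha> \<beta> x))\<^sup>2"
    unfolding daut_norm_eq[OF assms] using assms daut_denom_nz[OF assms]
    by (intro divide_pos_pos mult_pos_pos one_minus_norm_pos) (auto intro!: power_strict_mono)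
  then show ?thesis by (simp add: abs_square_less_1)
qed

text \<open>The direction of the derivative of \<open>daut \<alpha> \<beta>\<close> at
  \<open>x\<close>: the unit number by which the automorphism turns all directions at
  \<open>x\<close>.\<close>

definition daut_factor :: "complex \<Rightarrow> complex \<Rightarrow> complex \<Rightarrow> complex" where
  "daut_factor \<alpha> \<beta> x = cnj (cnj \<beta> * x + cnj \<alpha>) / (cnj \<beta> * x + cnj \<alpha>)"

lemma norm_daut_factor: assumes "norm \<beta> < norm \<alpha>" "norm x < 1" shows "norm (daut_factor \<alpha> \<beta> x) = 1"
  using daut_denom_nz[OF assms] unfolding daut_factor_def norm_divide complex_mod_cnj by simp

lemma mob_daut_daut:
  assumes "norm \<beta> < norm \<alpha>" "norm x < 1" "norm y < 1"
  shows "mob (daut \<alpha> \<beta> x) (daut \<alpha> \<beta> y) = daut_factor \<alpha> \<beta> x * mob x y"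
proof -
  have D: "complex_of_real ((norm \<alpha>)\<^sup>2 - (norm \<beta>)\<^sup>2) \<noteq> 0"
    using assms(1) by (auto simp: power2_eq_iff_nonneg simp flip: of_real_diff of_real_power)
  have n: "cnj \<beta> * x + cnj \<alpha> \<noteq> 0" "cnj \<beta> * y + cnj \<alpha> \<noteq> 0" "cnj (cnj \<beta> * x + cnj \<alpha>) \<noteq> 0"
    using daut_denom_nz[OF assms(1,2)] daut_denom_nz[OF assms(1,3)] unfolding complex_cnj_zero_iff
      by auto
  note m = one_minus_cnj_nz[OF assms(2,3)]
  define X Y X' D where "X = cnj \<beta> * x + cnj \<alpha>" "Y = cnj \<beta> * y + cnj \<alpha>"
     "X' = cnj X" "D = complex_of_real ((norm \<alpha>)\<^sup>2 - (norm \<beta>)\<^sup>2)"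
  show ?thesis
    unfolding mob_def[of "daut \<alpha> \<beta> x"] daut_one_minus[OF assms] daut_diff[OF assms] mob_def[of x] daut_factor_def
    using D n m unfolding X_Y_X'_D_def[symmetric] X_Y_X'_D_def(1-2)[symmetric]
    by (simp add: field_simps)
qed

lemma norm_mob_daut:
  assumes "norm \<beta> < norm \<alpha>" "norm x < 1" "norm y < 1"
  shows "norm (mob (daut \<alpha> \<beta> x) (daut \<alpha> \<beta> y)) = norm (mob x y)"
  by (simp add: mob_daut_daut[OF assms] norm_mult norm_daut_factor[OF assms(1,2)])

lemma pdist_daut:
  assumes "norm \<beta> < norm \<alpha>" "norm x < 1" "norm y < 1"
  shows "pdist (daut \<alpha> \<beta> x) (daut \<alpha> \<beta> y) = pdist x y"
  using assms by (simp add: pdist_def coshd_mob norm_daut norm_mob_daut)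

section \<open>Arguments and the transformation of the signed area\<close>

lemma Arg_mult_pos:
  assumes "Re a > 0" "Re b > 0" shows "Arg (a * b) = Arg a + Arg b"
  using assms Arg_Re_pos[of a] Arg_Re_pos[of b] by (subst Arg_times) (auto simp: abs_less_iff)

text \<open>The two sides agree modulo \<open>2 * pi\<close>. All four arguments lie strictly within
  \<open>pi / 2\<close> of 0, the one on the left by the hypothesis on the product, so the
  difference is smaller than a full turn.\<close>

lemma Arg_mult3:
  assumes "Re a > 0" "Re b > 0" "Re c > 0" "Re (a * b * c) > 0"
  shows "Arg (a * b * c) = Arg a + Arg b + Arg c"
proof -
  have nz: "a \<noteq> 0" "b \<noteq> 0" "c \<noteq> 0" using assms by auto
  have *: "rcis 1 (Arg (a * b * c)) = rcis 1 (Arg a + Arg b + Arg c)"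
    using nz by (simp add: rcis_def cis_Arg sgn_mult flip: cis_mult)
  then obtain k :: int where k: "Arg (a * b * c) = Arg a + Arg b + Arg c + 2 * pi * k"
    unfolding rcis_def using sin_cos_eq_iff[of "Arg (a * b * c)" "Arg a + Arg b + Arg c"]
      by (auto simp: complex_eq_iff)
  have "\<bar>Arg a\<bar> < pi/2" "\<bar>Arg b\<bar> < pi/2" "\<bar>Arg c\<bar> < pi/2" "\<bar>Arg (a * b * c)\<bar> < pi/2"
    using assms Arg_Re_pos by blast+
  then have "2 * pi * k < 2 * pi" "- (2 * pi) < 2 * pi * k" using k by linarith+
  then have "2 * pi * k < 2 * pi * 1" "2 * pi * (-1) < 2 * pi * k" by simp_all
  then have "real_of_int k < 1" "-1 < real_of_int k" using pi_gt_zero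
    by (simp_all only: mult_less_cancel_left_pos mult_pos_pos zero_less_numeral)
  then have "k = 0" by linarith
  then show ?thesis using k by simp
qed

lemma Arg_cnj_pos: "Re z > 0 \<Longrightarrow> Arg (cnj z) = - Arg z"
  by (auto simp: Arg_cnj complex_is_Real_iff Arg_eq_0)

text \<open>The correction is a coboundary, so the sum of \<open>tri_area\<close> over a closed polygon is invariant.\<close>

lemma tri_area_daut:
  assumes "norm \<beta> < norm \<alpha>" "norm x < 1" "norm y < 1"
  defines "\<phi> \<equiv> \<lambda>x. - 2 * Arg (1 + cnj (\<beta> / \<alpha>) * x)"
  shows "tri_area (daut \<alpha> \<beta> x) (daut \<alpha> \<beta> y) = tri_area x y + \<phi> x - \<phi> y"
proof -
  have a: "\<alpha> \<noteq> 0" using assms by auto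
  \<comment> \<open>Dividing the denominators by \<open>cnj \<alpha>\<close> brings them into the
    right half plane, where arguments add.\<close>
  define e where "e = - cnj (\<beta> / \<alpha>)"
  define r where "r = ((norm \<alpha>)\<^sup>2 - (norm \<beta>)\<^sup>2) / (norm \<alpha>)\<^sup>2"
  have r: "r > 0" unfolding r_def using assms(1) a by (auto intro!: divide_pos_pos power_strict_mono)
  have e: "norm e \<le> 1" unfolding e_def using assms by (simp add: norm_divide divide_simps)
  have pos: "Re (1 - e * x) > 0" "Re (1 - e * y) > 0" using e assms Re_one_minus_pos by auto
  have X: "cnj \<beta> * x + cnj \<alpha> = cnj \<alpha> * (1 - e * x)" "cnj \<beta> * y + cnj \<alpha> = cnj \<alpha> * (1 - e * y)"
    using a unfolding e_def by (auto simp: field_simps)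
  have E: "1 - cnj (daut \<alpha> \<beta> x) * daut \<alpha> \<beta> y
    = of_real r * (1 - cnj x * y) / (cnj (1 - e * x) * (1 - e * y))"
    unfolding daut_one_minus[OF assms(1-3)] X r_def of_real_divide complex_norm_square of_real_diff
    using a by (simp add: field_simps)
  have "1 - e * x \<noteq> 0" "1 - e * y \<noteq> 0" "cnj (1 - e * x) \<noteq> 0" using pos unfolding complex_cnj_zero_iff
    by (metis less_irrefl zero_complex.simps(1))+
  then have "of_real r * (1 - cnj x * y)
    = (1 - cnj (daut \<alpha> \<beta> x) * daut \<alpha> \<beta> y) * cnj (1 - e * x) * (1 - e * y)"
    unfolding E by simp
  moreover have "Re (of_real r * (1 - cnj x * y)) > 0"
    using r Re_one_minus_cnj_pos[OF assms(2,3)] unfolding times_complex.simps by simp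
  moreover have "Re (1 - cnj (daut \<alpha> \<beta> x) * daut \<alpha> \<beta> y) > 0"
    using Re_one_minus_cnj_pos norm_daut assms by blast
  moreover have "Re (cnj (1 - e * x)) > 0" using pos by (metis complex_cnj(1) cnj.simps(1))
  ultimately have "Arg (of_real r * (1 - cnj x * y))
    = Arg (1 - cnj (daut \<alpha> \<beta> x) * daut \<alpha> \<beta> y) + Arg (cnj (1 - e * x)) + Arg (1 - e * y)"
    using pos Arg_mult3 by presburger
  moreover have "Arg (of_real r * (1 - cnj x * y)) = Arg (1 - cnj x * y)"
    using r by (simp add: Arg_times_of_real)
  ultimately show ?thesis unfolding tri_area_def \<phi>_def using Arg_cnj_pos[OF pos(1)] unfolding e_def
    by simp
qed

lemma daut_compose:
  assumes "norm \<delta> < norm \<gamma>" "norm x < 1"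
  shows "daut \<alpha> \<beta> (daut \<gamma> \<delta> x) = daut (\<alpha> * \<gamma> + \<beta> * cnj \<delta>) (\<alpha> * \<delta> + \<beta> * cnj \<gamma>) x"
proof -
  have n: "cnj \<delta> * x + cnj \<gamma> \<noteq> 0" using daut_denom_nz[OF assms] .
  define t where "t = cnj \<delta> * x + cnj \<gamma>"
  have d: "daut \<gamma> \<delta> x * t = \<gamma> * x + \<delta>" unfolding daut_def t_def using n by simp
  have "daut \<alpha> \<beta> (daut \<gamma> \<delta> x) = ((\<alpha> * daut \<gamma> \<delta> x + \<beta>) * t) / ((cnj \<beta> * daut \<gamma> \<delta> x + cnj \<alpha>) * t)"
    unfolding daut_def[of \<alpha>] t_def using n by simp
  also have "\<dots> = (\<alpha> * (\<gamma> * x + \<delta>) + \<beta> * t) / (cnj \<beta> * (\<gamma> * x + \<delta>) + cnj \<alpha> * t)"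
    unfolding d[symmetric] by (simp only: distrib_right mult.assoc)
  also have "\<dots> = daut (\<alpha> * \<gamma> + \<beta> * cnj \<delta>) (\<alpha> * \<delta> + \<beta> * cnj \<gamma>) x"
    unfolding daut_def t_def by (simp add: algebra_simps)
  finally show ?thesis .
qed

text \<open>The determinant \<open>(norm \<alpha>)\<^sup>2 - (norm \<beta>)\<^sup>2\<close> is
  multiplicative under composition.\<close>

lemma daut_compose_norm:
  assumes "norm \<beta> < norm \<alpha>" "norm \<delta> < norm \<gamma>"
  shows "norm (\<alpha> * \<delta> + \<beta> * cnj \<gamma>) < norm (\<alpha> * \<gamma> + \<beta> * cnj \<delta>)"
proof -
  have "(norm (\<alpha> * \<gamma> + \<beta> * cnj \<delta>))\<^sup>2 - (norm (\<alpha> * \<delta> + \<beta> * cnj \<gamma>))\<^sup>2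
     = ((norm \<alpha>)\<^sup>2 - (norm \<beta>)\<^sup>2) * ((norm \<gamma>)\<^sup>2 - (norm \<delta>)\<^sup>2)"
    unfolding cmod_power2 by (simp add: algebra_simps power2_eq_square)
  moreover have "\<dots> > 0" using assms by (intro mult_pos_pos) (auto intro!: power_strict_mono)
  ultimately have "(norm (\<alpha> * \<delta> + \<beta> * cnj \<gamma>))\<^sup>2 < (norm (\<alpha> * \<gamma> + \<beta> * cnj \<delta>))\<^sup>2" by linarith
  then show ?thesis by (rule power_less_imp_less_base) simp
qed

lemma daut_inverse:
  assumes "norm \<beta> < norm \<alpha>" "norm x < 1"
  shows "daut (cnj \<alpha>) (- \<beta>) (daut \<alpha> \<beta> x) = x"
proof -
  have "(cnj \<alpha> * \<alpha> - \<beta> * cnj \<beta>) = of_real ((norm \<alpha>)\<^sup>2 - (norm \<beta>)\<^sup>2)"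
    by (simp only: complex_norm_square of_real_diff mult.commute)
  moreover have "\<dots> \<noteq> 0" using assms
    by (auto simp: power2_eq_iff_nonneg simp flip: of_real_power of_real_diff)
  ultimately have nz: "cnj \<alpha> * \<alpha> - \<beta> * cnj \<beta> \<noteq> 0" by simp
  show ?thesis unfolding daut_compose[OF assms]
    using nz by (simp add: daut_def divide_simps) (simp add: algebra_simps)
qed

subsection \<open>Winding numbers of polygons\<close>

text \<open>The path has \<open>Suc m\<close> segments, as a path needs at least one; the closed
  polygon on \<open>n\<close> vertices is \<open>polypath v 0 (n - 1)\<close>.\<close>

fun polypath :: "(nat \<Rightarrow> complex) \<Rightarrow> nat \<Rightarrow> nat \<Rightarrow> real \<Rightarrow> complex" where
  "polypath v i 0 = linepath (v i) (v (Suc i))"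
| "polypath v i (Suc m) = linepath (v i) (v (Suc i)) +++ polypath v (Suc i) m"

lemma pathstart_polypath [simp]: "pathstart (polypath v i m) = v i"
  by (cases m) auto

lemma pathfinish_polypath [simp]: "pathfinish (polypath v i m) = v (Suc (i + m))"
  by (induction v i m rule: polypath.induct) auto

lemma path_polypath [simp]: "path (polypath v i m)"
  by (induction v i m rule: polypath.induct) auto

lemma path_image_polypath:
  "path_image (polypath v i m) = (\<Union>k\<in>{i..i + m}. closed_segment (v k) (v (Suc k)))"
proof (induction v i m rule: polypath.induct)
  case (2 v i m)
  have "{i..i + Suc m} = insert i {Suc i..Suc i + m}" by auto
  with 2 show ?case by (simp add: path_image_join)
qed simp

lemma winding_number_polypath:
  assumes "z \<notin> path_image (polypath v i m)"
  shows "winding_number (polypath v i m) z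
    = (\<Sum>k\<in>{i..i + m}. winding_number (linepath (v k) (v (Suc k))) z)"
  using assms
proof (induction v i m rule: polypath.induct)
  case (2 v i m)
  have e: "{i..i + Suc m} = insert i {Suc i..Suc i + m}" by auto
  have z: "z \<notin> closed_segment (v i) (v (Suc i))" "z \<notin> path_image (polypath v (Suc i) m)"
    using 2(2) by (simp_all add: path_image_join)
  show ?case unfolding e using z 2(1) by (simp add: winding_number_join)
qed simp

lemma arc_polypath:
  assumes "\<And>k. i \<le> k \<Longrightarrow> k \<le> i + m \<Longrightarrow> v k \<noteq> v (Suc k)"
    and "\<And>k. i \<le> k \<Longrightarrow> k < i + m \<Longrightarrow>
      closed_segment (v k) (v (Suc k)) \<inter> closed_segment (v (Suc k)) (v (Suc (Suc k))) = {v (Suc k)}"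
    and "\<And>k l. i \<le> k \<Longrightarrow> Suc k < l \<Longrightarrow> l \<le> i + m \<Longrightarrow>
      closed_segment (v k) (v (Suc k)) \<inter> closed_segment (v l) (v (Suc l)) = {}"
  shows "arc (polypath v i m)"
  using assms
proof (induction v i m rule: polypath.induct)
  case (1 v i) then show ?case by (simp add: arc_linepath)
next
  case (2 v i m)
  have "arc (polypath v (Suc i) m)"
  proof (rule 2(1))
    show "v k \<noteq> v (Suc k)" if "Suc i \<le> k" "k \<le> Suc i + m" for k
      using 2(2)[of k] that by simp
    show "closed_segment (v k) (v (Suc k)) \<inter> closed_segment (v (Suc k)) (v (Suc (Suc k))) = {v (Suc k)}"
      if "Suc i \<le> k" "k < Suc i + m" for k
      using 2(3)[of k] that by simp
    show "closed_segment (v k) (v (Suc k)) \<inter> closed_segment (v l) (v (Suc l)) = {}"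
      if "Suc i \<le> k" "Suc k < l" "l \<le> Suc i + m" for k l
      using 2(4)[of k l] that by simp
  qed
  moreover have "closed_segment (v i) (v (Suc i)) \<inter> closed_segment (v k) (v (Suc k)) \<subseteq> {v (Suc i)}"
    if "k \<in> {Suc i..Suc i + m}" for k
  proof (cases "k = Suc i")
    case True then show ?thesis using 2(3)[of i] by simp
  next
    case False then show ?thesis using 2(4)[of i k] that by simp
  qed
  then have "closed_segment (v i) (v (Suc i)) \<inter> path_image (polypath v (Suc i) m) \<subseteq> {v (Suc i)}"
    unfolding path_image_polypath by blast
  ultimately show ?case using 2(2)[of i] by (auto intro!: arc_join arc_linepath)
qed

lemma vertex_add_length: "vertex P (i + length P) = vertex P i"
  by (simp add: vertex_def)

lemma boundary_eq_path_image:
  assumes "length P = Suc (Suc m)"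
  shows "boundary P = path_image (polypath (vertex P) 0 (Suc m))"
proof -
  have "{..<Suc (Suc m)} = {0..0 + Suc m}" by auto
  then show ?thesis unfolding path_image_polypath boundary_def side_def assms by presburger
qed

lemma ngon_vertex_distinct:
  assumes "ngon n P" "i < n" "j < n" "i \<noteq> j" shows "vertex P i \<noteq> vertex P j"
  using assms by (auto simp: ngon_def vertex_def nth_eq_iff_index_eq)

lemma ngon_vertex_Suc_neq:
  assumes "ngon n P" shows "vertex P i \<noteq> vertex P (Suc i)"
proof -
  have n: "n \<ge> 3" "length P = n" using assms by (auto simp: ngon_def)
  have "vertex P i = vertex P (i mod n)" "vertex P (Suc i) = vertex P (Suc i mod n)" using n
    by (auto simp: vertex_def)
  moreover have "i mod n \<noteq> Suc i mod n" using n mod_Suc[of i n] by (auto split: if_splits)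
  ultimately show ?thesis using ngon_vertex_distinct[OF assms, of "i mod n" "Suc i mod n"] n by simp
qed

text \<open>A closed path is not an arc, so one side is split off: the other sides form an arc that
  meets the first side only at its two ends.\<close>

lemma simple_path_polygon:
  assumes "ngon n P" "n = Suc (Suc m)"
  shows "simple_path (polypath (vertex P) 0 (Suc m))"
proof -
  define v where "v = vertex P"
  have len: "length P = n" "n \<ge> 3" using assms by (auto simp: ngon_def)
  then obtain m' where m': "m = Suc m'" using assms(2) by (cases m) auto
  have adj: "closed_segment (v k) (v (Suc k)) \<inter> closed_segment (v (Suc k)) (v (Suc (Suc k)))
    = {v (Suc k)}" if "k < n" for k
    using assms that unfolding ngon_def side_def v_def by auto
  have vn: "v n = v 0" "v (Suc n) = v 1" unfolding v_def vertex_def using len by (auto simp: mod_Suc)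
  have dis: "closed_segment (v k) (v (Suc k)) \<inter> closed_segment (v l) (v (Suc l)) = {}"
    if "k < n" "l < n" "k \<noteq> l" "l \<noteq> Suc k mod n" "k \<noteq> Suc l mod n" for k l
    using assms that unfolding ngon_def side_def v_def by blast
  have ne: "v k \<noteq> v (Suc k)" for k unfolding v_def by (rule ngon_vertex_Suc_neq[OF assms(1)])
  have arc2: "arc (polypath v 1 m)"
  proof (rule arc_polypath)
    show "v k \<noteq> v (Suc k)" for k by (rule ne)
    show "closed_segment (v k) (v (Suc k)) \<inter> closed_segment (v (Suc k)) (v (Suc (Suc k))) = {v (Suc k)}"
      if "k < 1 + m" for k
      using adj[of k] that assms(2) by simp
    show "closed_segment (v k) (v (Suc k)) \<inter> closed_segment (v l) (v (Suc l)) = {}"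
      if "1 \<le> k" "Suc k < l" "l \<le> 1 + m" for k l
    proof (rule dis)
      show "k < n" "l < n" "k \<noteq> l" using that assms(2) by auto
      show "l \<noteq> Suc k mod n" "k \<noteq> Suc l mod n" using that assms(2) by (auto simp: mod_Suc)
    qed
  qed
  have "closed_segment (v 0) (v 1) \<inter> closed_segment (v k) (v (Suc k)) \<subseteq> {v 0, v 1}" if "k \<in> {1..1 + m}"
    for k
  proof -
    consider "k = 1" | "k = Suc m" | "k \<noteq> 1" "k \<noteq> Suc m" by blast
    then show ?thesis
    proof cases
      case 1 then show ?thesis using adj[of 0] assms(2) by auto
    next
      case 2
      then have "closed_segment (v k) (v (Suc k)) \<inter> closed_segment (v 0) (v 1) = {v 0}"
        using adj[of k] assms(2) vn by simp
      then show ?thesis by auto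
    next
      case 3 then show ?thesis using dis[of 0 k] assms(2) that len by auto
    qed
  qed
  then have "closed_segment (v 0) (v 1) \<inter> path_image (polypath v 1 m) \<subseteq> {v 0, v 1}"
    unfolding path_image_polypath by blast
  then have "simple_path (linepath (v 0) (v 1) +++ polypath v 1 m)"
    using arc2 ne[of 0] vn assms(2) by (intro simple_path_join_loop) (simp_all add: arc_linepath)
  then show ?thesis unfolding v_def by simp
qed

lemma winding_number_line_triangle:
  assumes "z \<notin> closed_segment 0 p" "z \<notin> closed_segment p q" "z \<notin> closed_segment 0 q"
  shows "winding_number (linepath p q) z
    = winding_number (linepath 0 p +++ linepath p q +++ linepath q 0) z
     - winding_number (linepath 0 p) z + winding_number (linepath 0 q) z"
proof -
  have "winding_number (linepath q 0) z = - winding_number (linepath 0 q) z"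
    using assms winding_number_reversepath[of "linepath 0 q" z] by simp
  then show ?thesis using assms
    by (simp add: winding_number_join path_image_join closed_segment_commute[of q 0])
qed

lemma mem_triangle_0:
  "z \<in> convex hull {0, p, q} \<longleftrightarrow> (\<exists>s t. 0 \<le> s \<and> 0 \<le> t \<and> s + t \<le> 1 \<and> z = s *\<^sub>R p + t *\<^sub>R (q::complex))"
  unfolding convex_hull_3_alt by auto

text \<open>A point of the hull off the three sides is interior, so the triangle is not degenerate
  and its orientation gives the winding number; off the hull, convexity makes the winding number
  0.\<close>

lemma winding_number_triangle_eq:
  assumes "z \<notin> closed_segment 0 p" "z \<notin> closed_segment p q" "z \<notin> closed_segment 0 q"
  shows "winding_number (linepath 0 p +++ linepath p q +++ linepath q 0) z
     = of_real (sgn (Im (cnj p * q)) * indicator (convex hull {0, p, q}) z)"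
proof (cases "z \<in> convex hull {0, p, q}")
  case True
  then obtain s t where st: "0 \<le> s" "0 \<le> t" "s + t \<le> 1" "z = s *\<^sub>R p + t *\<^sub>R q"
    unfolding mem_triangle_0 by blast
  have int: "z \<in> interior (convex hull {0, p, q})"
    using True assms interior_of_triangle[of 0 p q] by (simp add: closed_segment_commute[of q 0])
  have p: "p \<noteq> 0"
  proof
    assume "p = 0"
    then have "z \<in> closed_segment 0 q" using True by (simp add: segment_convex_hull)
    then show False using assms by simp
  qed
  have t: "t > 0"
  proof (rule ccontr)
    assume "\<not> t > 0"
    then have "z = (1 - s) *\<^sub>R 0 + s *\<^sub>R p" "s \<le> 1" using st by auto
    then have "z \<in> closed_segment 0 p" unfolding in_segment using st(1) by blast
    then show False using assms by simp
  qed
  have ne: "Im (cnj p * q) \<noteq> 0"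
  proof
    assume *: "Im (cnj p * q) = 0"
    have "convex hull {0, p, q} \<subseteq> {x. (\<i> * p) \<bullet> x = 0}"
      using * by (auto simp: mem_triangle_0 inner_complex_def algebra_simps)
    then have "interior (convex hull {0, p, q}) \<subseteq> interior {x. (\<i> * p) \<bullet> x = 0}" by (rule interior_mono)
    then show False using int p by simp
  qed
  \<comment> \<open>The orientation criterion is phrased with the point \<open>z\<close>; the
    positive coefficient \<open>t\<close> turns it into the determinant of \<open>p\<close> and
    \<open>q\<close>.\<close>
  have "Im ((p - 0) * cnj (p - z)) = t * Im (cnj p * q)"
    unfolding st(4) by (simp add: algebra_simps)
  then have "0 < Im ((p - 0) * cnj (p - z)) \<longleftrightarrow> 0 < Im (cnj p * q)"
    using t by (simp add: zero_less_mult_iff)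
  then show ?thesis using winding_number_triangle[OF int] ne True by (simp add: sgn_if)
next
  case False
  have "closed_segment 0 p \<union> (closed_segment p q \<union> closed_segment q 0) \<subseteq> convex hull {0, p, q}"
    unfolding segment_convex_hull by (intro Un_least hull_mono) auto
  then have "winding_number (linepath 0 p +++ linepath p q +++ linepath q 0) z = 0"
    by (intro winding_number_zero_outside[OF _ convex_convex_hull _ False]) (auto simp: path_image_join)
  then show ?thesis using False by simp
qed

text \<open>Each side is completed to a triangle with apex 0. The contributions of the segments from
  0 to the vertices telescope around the polygon, so the winding number is the sum of those of the
  triangles. The number \<open>s\<close> records the orientation of the vertex list.\<close>

lemma polygon_winding:
  assumes "ngon n P"
  obtains s :: real where "\<bar>s\<bar> = 1" and
    "\<And>z. (\<And>i. z \<notin> closed_segment 0 (vertex P i)) \<Longrightarrow> z \<notin> boundary P \<Longrightarrow>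
      s * indicator (enclosed_region P) z =
      (\<Sum>i<n. sgn (Im (cnj (vertex P i) * vertex P (Suc i))) * indicator (convex hull {0, vertex P i, vertex P (Suc i)}) z)"
proof -
  have len: "length P = n" "n \<ge> 3" using assms by (auto simp: ngon_def)
  obtain m where m: "n = Suc (Suc m)" using len that[of "n - 2"] by simp
  define v where "v = vertex P"
  define \<gamma> where "\<gamma> = polypath v 0 (Suc m)"
  have vn: "v n = v 0" unfolding v_def vertex_def using len by auto
  have sp: "simple_path \<gamma>" unfolding \<gamma>_def v_def by (rule simple_path_polygon[OF assms m])
  have closed: "pathfinish \<gamma> = pathstart \<gamma>" unfolding \<gamma>_def using vn m by simp
  have bd: "boundary P = path_image \<gamma>" unfolding \<gamma>_def v_def using len m
    by (intro boundary_eq_path_image) simp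
  have "\<exists>s\<in>{-1, 1}. \<forall>z\<in>inside (path_image \<gamma>). winding_number \<gamma> z = s"
    by (rule simple_closed_path_winding_number_inside[OF sp]) auto
  then obtain s :: complex
    where s: "s \<in> {-1, 1}" "\<And>z. z \<in> inside (path_image \<gamma>) \<Longrightarrow> winding_number \<gamma> z = s"
    by blast
  have sum: "winding_number \<gamma> z
    = of_real (\<Sum>i<n. sgn (Im (cnj (v i) * v (Suc i))) * indicator (convex hull {0, v i, v (Suc i)}) z)"
    if "\<And>i. z \<notin> closed_segment 0 (v i)" "z \<notin> boundary P" for z
  proof -
    have e: "{0..0 + Suc m} = {..<n}" using m by auto
    have side: "z \<notin> closed_segment (v i) (v (Suc i))" if "i < n" for i
      using \<open>z \<notin> boundary P\<close> that len unfolding boundary_def side_def v_def by auto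
    have "winding_number \<gamma> z = (\<Sum>i<n. winding_number (linepath (v i) (v (Suc i))) z)"
      unfolding \<gamma>_def e[symmetric] by (rule winding_number_polypath) (use that(2) bd \<gamma>_def in auto)
    also have "\<dots> = (\<Sum>i<n. of_real (sgn (Im (cnj (v i) * v (Suc i)))
      * indicator (convex hull {0, v i, v (Suc i)}) z)
        + (winding_number (linepath 0 (v (Suc i))) z - winding_number (linepath 0 (v i)) z))"
      by (rule sum.cong) (use that side in \<open>simp_all add: winding_number_line_triangle winding_number_triangle_eq\<close>)
    also have "\<dots> = of_real (\<Sum>i<n. sgn (Im (cnj (v i) * v (Suc i)))
      * indicator (convex hull {0, v i, v (Suc i)}) z)
        + (winding_number (linepath 0 (v n)) z - winding_number (linepath 0 (v 0)) z)"
      by (simp only: sum.distrib of_real_sum sum_lessThan_telescope[where f = "\<lambda>i. winding_number (linepath 0 (v i)) z"])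
    finally show ?thesis using vn by simp
  qed
  show thesis
  proof (rule that[of "Re s"])
    show "\<bar>Re s\<bar> = 1" using s(1) by auto
    fix z assume z: "\<And>i. z \<notin> closed_segment 0 (vertex P i)" "z \<notin> boundary P"
    have "winding_number \<gamma> z = of_real (Re s * indicator (enclosed_region P) z)"
    proof (cases "z \<in> inside (path_image \<gamma>)")
      case True then show ?thesis using s by (auto simp: enclosed_region_def bd)
    next
      case False
      then have "z \<in> outside (path_image \<gamma>)"
        using z(2) bd union_with_outside[of "path_image \<gamma>"] inside_Un_outside by blast
      then have "winding_number \<gamma> z = 0"
        using winding_number_zero_in_outside closed sp simple_path_imp_path by blast
      then show ?thesis using False by (simp add: enclosed_region_def bd)
    qed
    then show "Re s * indicator (enclosed_region P) z =
      (\<Sum>i<n. sgn (Im (cnj (vertex P i) * vertex P (Suc i))) * indicator (convex hull {0, vertex P i, vertex P (Suc i)}) z)"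
      using sum z unfolding v_def of_real_eq_iff[symmetric, where 'a=complex] by simp
  qed
qed

lemma closed_segment_null_sets: "closed_segment a b \<in> null_sets (lborel :: complex measure)"
proof -
  \<comment> \<open>The segment is viewed as the frontier of a degenerate triangle.\<close>
  have "negligible (frontier (convex hull {a, b, b}))" by (rule negligible_convex_frontier) simp
  then have "negligible (closed_segment a b)"
    using frontier_of_triangle[of a b b] by (auto intro: negligible_subset)
  then show ?thesis
    by (simp add: negligible_iff_null_sets null_sets_completion_iff)
qed

lemma set_integrable_harea:
  assumes "K \<subseteq> ball 0 1" "compact K" "A \<subseteq> K" "A \<in> sets borel"
  shows "set_integrable lborel A (\<lambda>p::complex. (1 - (norm p)\<^sup>2) powr (- 3 / 2))"
proof -
  have "set_integrable lborel K (\<lambda>p::complex. (1 - (norm p)\<^sup>2) powr (- 3 / 2))"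
    unfolding set_integrable_def
  proof (rule borel_integrable_compact[OF assms(2)])
    show "continuous_on K (\<lambda>p::complex. (1 - (norm p)\<^sup>2) powr (- 3 / 2))"
      using assms(1) by (intro continuous_intros) (auto simp: abs_square_eq_1)
  qed
  then show ?thesis by (rule set_integrable_subset) (use assms in auto)
qed

text \<open>The identity of \<open>polygon_winding\<close> is integrated against the area density;
  it fails at most on finitely many segments, a null set. All sets involved lie in the compact hull
  \<open>K\<close> inside the disc, where the density is bounded.\<close>

lemma polygon_area_triangles:
  assumes "ngon n P"
  shows "polygon_area P = \<bar>\<Sum>i<n. sgn (Im (cnj (vertex P i) * vertex P (Suc i))) *
     harea (convex hull {0, vertex P i, vertex P (Suc i)})\<bar>"
proof -
  have len: "length P = n" "n \<ge> 3" "set P \<subseteq> hplane" using assms by (auto simp: ngon_def)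
  define v where "v = vertex P"
  define K where "K = convex hull (insert 0 (set P))"
  define f where "f = (\<lambda>p::complex. (1 - (norm p)\<^sup>2) powr (- 3 / 2))"
  have vP: "v i \<in> set P" for i unfolding v_def vertex_def using len by (auto intro: nth_mem)
  have K: "K \<subseteq> ball 0 1" unfolding K_def using len by (intro hull_minimal) (auto simp: hplane_def)
  have cK: "compact K" unfolding K_def by (intro finite_imp_compact_convex_hull) auto
  have bK: "boundary P \<subseteq> K" unfolding boundary_def side_def K_def v_def[symmetric] segment_convex_hull
    using vP by (intro UN_least hull_mono) auto
  obtain s :: real where s: "\<bar>s\<bar> = 1" and
    w: "\<And>z. (\<And>i. z \<notin> closed_segment 0 (v i)) \<Longrightarrow> z \<notin> boundary P \<Longrightarrow>
      s * indicator (enclosed_region P) z =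
      (\<Sum>i<n. sgn (Im (cnj (v i) * v (Suc i))) * indicator (convex hull {0, v i, v (Suc i)}) z)"
    using polygon_winding[OF assms] unfolding v_def by blast
  have cb: "compact (boundary P)" unfolding boundary_def side_def by (intro compact_UN) auto
  have eK: "enclosed_region P \<subseteq> K"
    unfolding enclosed_region_def
      using outside_subset_convex[OF _ bK] inside_Int_outside[of "boundary P"] K_def convex_convex_hull
        by blast
  have iE: "set_integrable lborel (enclosed_region P) f"
    unfolding f_def by (rule set_integrable_harea[OF K cK eK])
      (use open_inside[OF compact_imp_closed[OF cb]] in \<open>simp add: enclosed_region_def\<close>)
  have iT: "set_integrable lborel (convex hull {0, v i, v (Suc i)}) f" for i
    unfolding f_def
  proof (rule set_integrable_harea[OF K cK])
    show "convex hull {0, v i, v (Suc i)} \<subseteq> K" unfolding K_def using vP by (intro hull_mono) simp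
    have "compact (convex hull {0, v i, v (Suc i)})" by (rule finite_imp_compact_convex_hull) simp
    then show "convex hull {0, v i, v (Suc i)} \<in> sets borel" by (intro borel_closed compact_imp_closed)
  qed
  define N where "N = (\<Union>i. closed_segment 0 (v i) \<union> closed_segment (v i) (v (Suc i)))"
  have "N \<in> null_sets lborel" unfolding N_def
    by (intro null_sets_UN null_sets.Un closed_segment_null_sets)
  then have AE: "AE z in lborel. z \<notin> N" by (rule AE_not_in)
  have "s * harea (enclosed_region P) = (LINT z|lborel. s * (indicator (enclosed_region P) z *\<^sub>R f z))"
    unfolding harea_def f_def[symmetric] set_lebesgue_integral_def by simp
  also have "\<dots> = (LINT z|lborel. (\<Sum>i<n. sgn (Im (cnj (v i) * v (Suc i)))
    * (indicator (convex hull {0, v i, v (Suc i)}) z *\<^sub>R f z)))"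
  proof (rule integral_cong_AE)
    show "(\<lambda>z. s * (indicator (enclosed_region P) z *\<^sub>R f z)) \<in> borel_measurable lborel"
      using iE unfolding set_integrable_def by (intro borel_measurable_times borel_measurable_const) auto
    show "(\<lambda>z. (\<Sum>i<n. sgn (Im (cnj (v i) * v (Suc i)))
      * (indicator (convex hull {0, v i, v (Suc i)}) z *\<^sub>R f z))) \<in> borel_measurable lborel"
      using iT unfolding set_integrable_def
        by (intro borel_measurable_sum borel_measurable_times borel_measurable_const) auto
    show "AE z in lborel. s * (indicator (enclosed_region P) z *\<^sub>R f z) =
       (\<Sum>i<n. sgn (Im (cnj (v i) * v (Suc i))) * (indicator (convex hull {0, v i, v (Suc i)}) z *\<^sub>R f z))"
      using AE
    proof eventually_elim
      case (elim z)
      then have "s * indicator (enclosed_region P) z =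
        (\<Sum>i<n. sgn (Im (cnj (v i) * v (Suc i))) * indicator (convex hull {0, v i, v (Suc i)}) z)"
        by (intro w) (auto simp: N_def boundary_def side_def v_def)
      then have "(s * indicator (enclosed_region P) z) * f z =
        (\<Sum>i<n. sgn (Im (cnj (v i) * v (Suc i))) * indicator (convex hull {0, v i, v (Suc i)}) z) * f z" by simp
      then show ?case by (simp only: sum_distrib_right mult.assoc real_scaleR_def)
    qed
  qed
  also have "\<dots> = (\<Sum>i<n. sgn (Im (cnj (v i) * v (Suc i))) * harea (convex hull {0, v i, v (Suc i)}))"
    unfolding harea_def f_def[symmetric] set_lebesgue_integral_def
    using iT unfolding set_integrable_def by (subst Bochner_Integration.integral_sum) auto
  finally have *: "s * harea (enclosed_region P)
    = (\<Sum>i<n. sgn (Im (cnj (v i) * v (Suc i))) * harea (convex hull {0, v i, v (Suc i)}))" .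
  have "harea (enclosed_region P) \<ge> 0" unfolding harea_def set_lebesgue_integral_def
    by (intro Bochner_Integration.integral_nonneg) auto
  then have "polygon_area P = \<bar>s * harea (enclosed_region P)\<bar>" using s
    by (simp add: polygon_area_def abs_mult)
  then show ?thesis unfolding * v_def .
qed

subsection \<open>Integration over triangles\<close>

text \<open>Lebesgue measure is determined by its values on boxes; splitting it into coordinates
  makes iterated integration available.\<close>

lemma lborel_complex: "lborel = distr (lborel \<Otimes>\<^sub>M lborel) borel (\<lambda>(x, y). Complex x y)"
proof (rule lborel_eqI)
  have [measurable]: "(\<lambda>(x, y). Complex x y) \<in> lborel \<Otimes>\<^sub>M lborel \<rightarrow>\<^sub>M borel"
    unfolding lborel_prod
      by (simp add: borel_measurable_continuous_onI case_prod_unfold continuous_intros)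
  fix l u :: complex assume le: "\<And>b. b \<in> Basis \<Longrightarrow> l \<bullet> b \<le> u \<bullet> b"
  have le': "Re l \<le> Re u" "Im l \<le> Im u" using le[of 1] le[of \<i>]
    by (auto simp: inner_complex_def Basis_complex_def)
  have "(\<lambda>(x, y). Complex x y) -` box l u \<inter> space (lborel \<Otimes>\<^sub>M lborel) = {Re l<..<Re u} \<times> {Im l<..<Im u}"
    by (auto simp: box_def Basis_complex_def inner_complex_def space_pair_measure)
  then have "emeasure (distr (lborel \<Otimes>\<^sub>M lborel) borel (\<lambda>(x, y). Complex x y)) (box l u) =
    emeasure (lborel \<Otimes>\<^sub>M lborel) ({Re l<..<Re u} \<times> {Im l<..<Im u})"
    by (subst emeasure_distr) auto
  also have "\<dots> = ennreal (Re u - Re l) * ennreal (Im u - Im l)"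
    by (subst lborel.emeasure_pair_measure_Times) (auto simp: le')
  also have "\<dots> = ennreal (\<Prod>b\<in>Basis. (u - l) \<bullet> b)"
    using le' by (simp add: Basis_complex_def inner_complex_def ennreal_mult)
  finally show "emeasure (distr (lborel \<Otimes>\<^sub>M lborel) borel (\<lambda>(x, y). Complex x y)) (box l u)
    = ennreal (\<Prod>b\<in>Basis. (u - l) \<bullet> b)" .
qed simp

lemma measurable_Complex [measurable]:
  assumes [measurable]: "f \<in> borel_measurable M" "g \<in> borel_measurable M"
  shows "(\<lambda>x. Complex (f x) (g x)) \<in> borel_measurable M"
  unfolding Complex_eq by measurable

lemma nn_integral_complex:
  fixes f :: "complex \<Rightarrow> ennreal"
  assumes [measurable]: "f \<in> borel_measurable borel"
  shows "(\<integral>\<^sup>+z. f z \<partial>lborel) = (\<integral>\<^sup>+x. \<integral>\<^sup>+y. f (Complex x y) \<partial>lborel \<partial>lborel)"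
proof -
  have "(\<integral>\<^sup>+z. f z \<partial>lborel) = (\<integral>\<^sup>+p. f (case p of (x, y) \<Rightarrow> Complex x y) \<partial>(lborel \<Otimes>\<^sub>M lborel))"
    by (subst lborel_complex, subst nn_integral_distr) (auto simp: case_prod_unfold)
  also have "\<dots> = (\<integral>\<^sup>+x. \<integral>\<^sup>+y. f (Complex x y) \<partial>lborel \<partial>lborel)"
    by (subst lborel.nn_integral_fst[symmetric]) (auto simp: case_prod_unfold)
  finally show ?thesis .
qed

lemma nn_integral_complex_swap:
  fixes f :: "complex \<Rightarrow> ennreal"
  assumes [measurable]: "f \<in> borel_measurable borel"
  shows "(\<integral>\<^sup>+x. \<integral>\<^sup>+y. f (Complex (a * x + b * y) (c * x + d * y)) \<partial>lborel \<partial>lborel) =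
    (\<integral>\<^sup>+y. \<integral>\<^sup>+x. f (Complex (a * x + b * y) (c * x + d * y)) \<partial>lborel \<partial>lborel)"
  by (rule lborel_pair.Fubini') measurable

lemma ennreal_abs_inverse_cancel: "c \<noteq> 0 \<Longrightarrow> ennreal \<bar>c\<bar> * (ennreal \<bar>1 / c\<bar> * x) = x"
  by (simp add: mult.assoc[symmetric] flip: ennreal_mult)

text \<open>A rotation is a product of affine substitutions in one coordinate at a time, with the
  order of integration exchanged in between. These divide by \<open>c\<close>, so the quarter turns
  are treated separately.\<close>

lemma nn_integral_complex_rotation:
  fixes f :: "complex \<Rightarrow> ennreal"
  assumes [measurable]: "f \<in> borel_measurable borel" and u: "norm u = 1"
  shows "(\<integral>\<^sup>+z. f (u * z) \<partial>lborel) = (\<integral>\<^sup>+z. f z \<partial>lborel)"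
proof -
  define c s where "c = Re u" "s = Im u"
  have cs: "c\<^sup>2 + s\<^sup>2 = 1" using u unfolding c_s_def by (simp add: cmod_def)
  have uz: "u * Complex x y = Complex (c * x + (- s) * y) (s * x + c * y)" for x y
    by (simp add: complex_eq_iff c_s_def)
  have L: "(\<integral>\<^sup>+z. f (u * z) \<partial>lborel)
    = (\<integral>\<^sup>+x. \<integral>\<^sup>+y. f (Complex (c * x + (- s) * y) (s * x + c * y)) \<partial>lborel \<partial>lborel)"
    by (subst nn_integral_complex) (simp_all only: uz, measurable)
  show ?thesis
  proof (cases "c = 0")
    case True
    then have s: "s \<noteq> 0" "\<bar>s\<bar> = 1" using cs by (auto simp: power2_eq_1_iff)
    have "(\<integral>\<^sup>+z. f z \<partial>lborel) = (\<integral>\<^sup>+x. \<integral>\<^sup>+y. f (Complex x y) \<partial>lborel \<partial>lborel)"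
      by (rule nn_integral_complex) measurable
    also have "\<dots> = (\<integral>\<^sup>+x. \<integral>\<^sup>+y. f (Complex x (s * y)) \<partial>lborel \<partial>lborel)"
      by (subst nn_integral_real_affine[where t=0 and c=s]) (use s in auto)
    also have "\<dots> = (\<integral>\<^sup>+y. \<integral>\<^sup>+x. f (Complex (- s * y) (s * x)) \<partial>lborel \<partial>lborel)"
      by (subst nn_integral_real_affine[where t=0 and c="-s"]) (use s in auto)
    also have "\<dots> = (\<integral>\<^sup>+z. f (u * z) \<partial>lborel)"
      unfolding L True using nn_integral_complex_swap[OF assms(1), of 0 "-s" s 0] by simp
    finally show ?thesis ..
  next
    case False
    have "(\<integral>\<^sup>+z. f z \<partial>lborel) = (\<integral>\<^sup>+x. \<integral>\<^sup>+y. f (Complex x y) \<partial>lborel \<partial>lborel)"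
      by (rule nn_integral_complex) measurable
    \<comment> \<open>First \<open>y\<close> is replaced by \<open>s / c * x + (1/c) * y\<close>,
      then \<open>x\<close> by \<open>- s * y + c * x\<close>. The Jacobians are inverse to each
      other, and the second coordinate becomes \<open>s * x + c * y\<close> because
      \<open>1 - s\<^sup>2 = c\<^sup>2\<close>.\<close>
    also have "\<dots> = (\<integral>\<^sup>+x. \<bar>1/c\<bar> * \<integral>\<^sup>+y. f (Complex x (s / c * x + (1/c) * y)) \<partial>lborel \<partial>lborel)"
      by (rule nn_integral_cong, rule nn_integral_real_affine) (use False in auto)
    also have "\<dots> = \<bar>1/c\<bar> * (\<integral>\<^sup>+x. \<integral>\<^sup>+y. f (Complex x (s / c * x + (1/c) * y)) \<partial>lborel \<partial>lborel)"
      by (rule nn_integral_cmult) measurable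
    also have "\<dots> = \<bar>1/c\<bar> * (\<integral>\<^sup>+y. \<integral>\<^sup>+x. f (Complex (1 * x + 0 * y) (s / c * x
      + (1/c) * y)) \<partial>lborel \<partial>lborel)"
      using nn_integral_complex_swap[OF assms(1), of 1 0 "s / c" "1 / c"] by simp
    also have "\<dots> = \<bar>1/c\<bar> * (\<integral>\<^sup>+y. \<bar>c\<bar> * \<integral>\<^sup>+x. f (Complex (1 * (- s * y + c * x)
      + 0 * y) (s / c * (- s * y + c * x) + (1/c) * y)) \<partial>lborel \<partial>lborel)"
      by (intro arg_cong2[where f="(*)"] refl nn_integral_cong nn_integral_real_affine)
        (use False in auto)
    also have "\<dots> = \<bar>1/c\<bar> * (\<bar>c\<bar> * (\<integral>\<^sup>+y. \<integral>\<^sup>+x. f (Complex (1 * (- s * y + c * x)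
      + 0 * y) (s / c * (- s * y + c * x) + (1/c) * y)) \<partial>lborel \<partial>lborel))"
      by (intro arg_cong2[where f="(*)"] refl nn_integral_cmult) measurable
    also have "\<dots> = (\<integral>\<^sup>+y. \<integral>\<^sup>+x. f (Complex (1 * (- s * y + c * x) + 0 * y) (s / c * (- s * y + c * x)
      + (1/c) * y)) \<partial>lborel \<partial>lborel)"
      using False ennreal_abs_inverse_cancel[of "1/c"] by simp
    also have "\<dots> = (\<integral>\<^sup>+y. \<integral>\<^sup>+x. f (Complex (c * x + (- s) * y) (s * x + c * y)) \<partial>lborel \<partial>lborel)"
    proof -
      have "s / c * (- s * y + c * x) + (1/c) * y = s * x + c * y" for x y
      proof -
        have "s / c * (- s * y + c * x) + (1/c) * y = s * x + ((1 - s\<^sup>2) / c) * y"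
          using False by (simp add: field_simps power2_eq_square)
        also have "1 - s\<^sup>2 = c\<^sup>2" using cs by simp
        finally show ?thesis using False by (simp add: power2_eq_square)
      qed
      then show ?thesis by (simp add: add.commute)
    qed
    also have "\<dots> = (\<integral>\<^sup>+z. f (u * z) \<partial>lborel)"
      unfolding L by (subst nn_integral_complex_swap) auto
    finally show ?thesis ..
  qed
qed

lemma vertical_primitive_deriv:
  assumes "\<bar>x\<bar> < 1" "x\<^sup>2 + y1\<^sup>2 < 1" "x\<^sup>2 + y2\<^sup>2 < 1" and y: "y \<in> {y1..y2}"
  shows "((\<lambda>y. y / ((1 - x\<^sup>2) * sqrt (1 - x\<^sup>2 - y\<^sup>2))) has_real_derivative (1 - x\<^sup>2
    - y\<^sup>2) powr (- 3 / 2)) (at y)"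
proof -
  have x: "x\<^sup>2 < 1" using assms by (simp add: abs_square_less_1)
  have "y\<^sup>2 \<le> max (y1\<^sup>2) (y2\<^sup>2)"
  proof (cases "y \<ge> 0")
    case True then have "y\<^sup>2 \<le> y2\<^sup>2" using y by (intro power_mono) auto
    then show ?thesis by simp
  next
    case False then have "(-y)\<^sup>2 \<le> (-y1)\<^sup>2" using y by (intro power_mono) auto
    then show ?thesis by simp
  qed
  then have w: "1 - x\<^sup>2 - y\<^sup>2 > 0" using assms by (auto simp: max_def split: if_splits)
  define S where "S = sqrt (1 - x\<^sup>2 - y\<^sup>2)"
  have S: "S > 0" "S\<^sup>2 = 1 - x\<^sup>2 - y\<^sup>2" unfolding S_def using w by auto
  have "(1 - x\<^sup>2 - y\<^sup>2) powr (- 3 / 2) = (S powr 2) powr (- 3 / 2)"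
    using S by (simp add: powr_numeral)
  also have "\<dots> = 1 / S ^ 3" using S unfolding powr_powr by (simp add: powr_minus_divide powr_numeral)
  finally have P: "(1 - x\<^sup>2 - y\<^sup>2) powr (- 3 / 2) = 1 / S ^ 3" .
  have "((\<lambda>y. y / ((1 - x\<^sup>2) * sqrt (1 - x\<^sup>2 - y\<^sup>2))) has_real_derivative
      (1 * ((1 - x\<^sup>2) * S) - y * ((1 - x\<^sup>2) * ((- (2 * y)) * (inverse S / 2)))) / ((1 - x\<^sup>2) * S)\<^sup>2) (at y)"
    unfolding S_def using w x
    by (auto intro!: derivative_eq_intros simp: power2_eq_square)
  also have "(1 * ((1 - x\<^sup>2) * S) - y * ((1 - x\<^sup>2) * ((- (2 * y)) * (inverse S / 2)))) / ((1
    - x\<^sup>2) * S)\<^sup>2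
      = (S\<^sup>2 + y\<^sup>2) / ((1 - x\<^sup>2) * S ^ 3)"
    using S(1) x by (simp add: divide_simps) (simp add: algebra_simps power2_eq_square power3_eq_cube)
  also have "\<dots> = 1 / S ^ 3" unfolding S(2) using x by simp
  finally show ?thesis unfolding P .
qed

lemma nn_integral_vertical_segment:
  assumes "\<bar>x\<bar> < 1" "y1 \<le> y2" "x\<^sup>2 + y1\<^sup>2 < 1" "x\<^sup>2 + y2\<^sup>2 < 1"
  defines "F \<equiv> \<lambda>y. y / ((1 - x\<^sup>2) * sqrt (1 - x\<^sup>2 - y\<^sup>2))"
  shows "(\<integral>\<^sup>+y. ennreal ((1 - x\<^sup>2 - y\<^sup>2) powr (- 3 / 2)) * indicator {y1..y2} y \<partial>lborel)
    = ennreal (F y2 - F y1)"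
    and "F y1 \<le> F y2"
proof -
  have F: "(F has_real_derivative (1 - x\<^sup>2 - y\<^sup>2) powr (- 3 / 2)) (at y)" if "y \<in> {y1..y2}" for y
    unfolding F_def by (rule vertical_primitive_deriv[OF assms(1,3,4) that])
  show "(\<integral>\<^sup>+y. ennreal ((1 - x\<^sup>2 - y\<^sup>2) powr (- 3 / 2)) * indicator {y1..y2} y \<partial>lborel)
    = ennreal (F y2 - F y1)"
    by (rule nn_integral_FTC_Icc) (use F assms(2) in auto)
  show "F y1 \<le> F y2"
    by (rule DERIV_nonneg_imp_nondecreasing[OF assms(2)]) (use F in force)
qed

text \<open>The signed area of the right triangle with vertices \<open>0\<close>, \<open>h\<close>, \<open>h + \<i> b\<close>; along \<open>b = t h\<close> it is the
  antiderivative needed in the outer integral.\<close>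

definition right_area :: "real \<Rightarrow> real \<Rightarrow> real" where
  "right_area h b = arctan (h * b / (sqrt (1 - h\<^sup>2 - b\<^sup>2) + 1 - h\<^sup>2))"

lemma right_area_deriv:
  assumes "x\<^sup>2 + (t * x)\<^sup>2 < 1"
  shows "((\<lambda>x. right_area x (t * x)) has_real_derivative
     t * x / ((1 - x\<^sup>2) * sqrt (1 - x\<^sup>2 - (t * x)\<^sup>2))) (at x)"
proof -
  define u where "u = sqrt (1 - x\<^sup>2 - (t * x)\<^sup>2)"
  have u: "u > 0" "u\<^sup>2 = 1 - x\<^sup>2 - t\<^sup>2 * x\<^sup>2" unfolding u_def using assms
    by (auto simp: power_mult_distrib)
  have x: "x\<^sup>2 < 1" using assms zero_le_power2[of "t * x"] by linarith
  define D where "D = u + 1 - x\<^sup>2"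
  have D: "D > 0" unfolding D_def using u x by simp
  define D' where "D' = (- (2 * x) - 2 * t\<^sup>2 * x) * (inverse u / 2) - 2 * x"
  define N where "N = t * x\<^sup>2"
  have dD: "((\<lambda>x. sqrt (1 - x\<^sup>2 - (t * x)\<^sup>2) + 1 - x\<^sup>2) has_real_derivative D') (at x)"
    unfolding D'_def u_def using assms
    by (auto intro!: derivative_eq_intros simp: power2_eq_square algebra_simps)
  have dN: "((\<lambda>x. x * (t * x)) has_real_derivative 2 * t * x) (at x)"
    by (auto intro!: derivative_eq_intros)
  have "((\<lambda>x. right_area x (t * x)) has_real_derivative
     inverse (1 + (x * (t * x) / D)\<^sup>2) * ((2 * t * x * D - x * (t * x) * D') / (D * D))) (at x)"
    unfolding right_area_def D_def u_def
    by (rule DERIV_arctan[THEN DERIV_chain2] DERIV_divide[OF dN dD])+ (use D in \<open>simp add: D_def u_def\<close>)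
  also have "inverse (1 + (x * (t * x) / D)\<^sup>2) * ((2 * t * x * D - x * (t * x) * D') / (D * D)) =
     (2 * t * x * D - N * D') / (D\<^sup>2 + N\<^sup>2)"
  proof -
    have DN: "D\<^sup>2 + N\<^sup>2 > 0" using D by (simp add: sum_power2_gt_zero_iff)
    have N: "x * (t * x) = N" unfolding N_def by (simp add: power2_eq_square)
    have "inverse (1 + (N / D)\<^sup>2) = D\<^sup>2 / (D\<^sup>2 + N\<^sup>2)"
    proof -
      have "1 + (N / D)\<^sup>2 = (D\<^sup>2 + N\<^sup>2) / D\<^sup>2" using D by (simp add: power_divide field_simps)
      then show ?thesis by simp
    qed
    then show ?thesis unfolding N using D DN by (simp add: power2_eq_square)
  qed
  \<comment> \<open>Denominator and numerator both contain the factor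
    \<open>(1 + u)\<^sup>2\<close>, which then cancels.\<close>
  also have "D\<^sup>2 + N\<^sup>2 = (1 + u)\<^sup>2 * (1 - x\<^sup>2)"
  proof -
    have "N\<^sup>2 = x\<^sup>2 * (1 - x\<^sup>2 - u\<^sup>2)" unfolding N_def u(2) by (simp add: algebra_simps power2_eq_square)
    then show ?thesis unfolding D_def by (simp add: algebra_simps power2_eq_square)
  qed
  also have "2 * t * x * D - N * D' = t * x * (1 + u)\<^sup>2 / u"
  proof -
    have "(2 * t * x * D - N * D') * u = t * x * (2 * D * u + x\<^sup>2 * (1 + t\<^sup>2) + 2 * x\<^sup>2 * u)"
      unfolding N_def D'_def using u(1) by (simp add: field_simps power2_eq_square)
    also have "x\<^sup>2 * (1 + t\<^sup>2) = 1 - u\<^sup>2" unfolding u(2) by (simp add: algebra_simps)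
    also have "2 * D * u + (1 - u\<^sup>2) + 2 * x\<^sup>2 * u = (1 + u)\<^sup>2"
      unfolding D_def by (simp add: algebra_simps power2_eq_square)
    finally show ?thesis using u(1) by (simp add: field_simps)
  qed
  also have "t * x * (1 + u)\<^sup>2 / u / ((1 + u)\<^sup>2 * (1 - x\<^sup>2)) = t * x / ((1 - x\<^sup>2) * u)"
    using u(1) x by (simp add: field_simps)
  finally show ?thesis unfolding u_def .
qed

lemma scaled_sum_squares_less_1: "x\<^sup>2 * (1 + t\<^sup>2) < 1" if "0 \<le> x" "x \<le> h" "h\<^sup>2 + (t * h)\<^sup>2 < 1"
  for x t h :: real
proof -
  have "x\<^sup>2 * (1 + t\<^sup>2) \<le> h\<^sup>2 * (1 + t\<^sup>2)" using that by (intro mult_right_mono power_mono) auto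
  also have "\<dots> < 1" using that by (simp add: algebra_simps power_mult_distrib)
  finally show ?thesis .
qed

text \<open>With the side opposite to 0 vertical, the slice over \<open>x\<close> runs between the
  slopes \<open>a / h\<close> and \<open>b / h\<close>. The inner integral is elementary, and
  \<open>right_area\<close> along a fixed slope is the primitive of the result.\<close>

lemma nn_integral_vertical_triangle:
  assumes h: "0 < h" and ab: "a \<le> b" "h\<^sup>2 + a\<^sup>2 < 1" "h\<^sup>2 + b\<^sup>2 < 1"
  shows "(\<integral>\<^sup>+z. ennreal ((1 - (norm z)\<^sup>2) powr (- 3 / 2)) * indicator {z. 0 \<le> Re z \<and> Re z \<le> h \<and> a * Re z
    \<le> h * Im z \<and> h * Im z \<le> b * Re z} z \<partial>lborel)
     = ennreal (right_area h b - right_area h a)"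
proof -
  define T where "T = {z. 0 \<le> Re z \<and> Re z \<le> h \<and> a * Re z \<le> h * Im z \<and> h * Im z \<le> b * Re z}"
  define t1 t2 where "t1 = a / h" "t2 = b / h"
  have t: "a = t1 * h" "b = t2 * h" "t1 \<le> t2" unfolding t1_t2_def using h ab
    by (auto simp: divide_right_mono)
  have T: "T \<in> sets borel" unfolding T_def
    by (intro borel_closed closed_Collect_conj closed_Collect_le continuous_intros)
  have [measurable]: "(\<lambda>z::complex. ennreal ((1 - (norm z)\<^sup>2) powr (- 3 / 2)) * indicator T z)
    \<in> borel_measurable borel"
    using T by measurable
  define g where "g = (\<lambda>t x. t * x / ((1 - x\<^sup>2) * sqrt (1 - x\<^sup>2 - (t * x)\<^sup>2)))"
  have ind: "indicator T (Complex x y) = (indicator {0..h} x * indicator {t1 * x..t2 * x} y :: ennreal)"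
    for x y
    unfolding T_def t1_t2_def using h by (auto simp: indicator_def field_simps)
  have lt: "x\<^sup>2 + (t1 * x)\<^sup>2 < 1" "x\<^sup>2 + (t2 * x)\<^sup>2 < 1" if "x \<in> {0..h}" for x
    using scaled_sum_squares_less_1[of x h t1] scaled_sum_squares_less_1[of x h t2] that ab
      unfolding t(1,2) by (auto simp: algebra_simps power_mult_distrib)
  have lt1: "x\<^sup>2 < 1" if "x \<in> {0..h}" for x using lt(1)[OF that] zero_le_power2[of "t1 * x"] by linarith
  have inner: "(\<integral>\<^sup>+y. ennreal ((1 - x\<^sup>2 - y\<^sup>2) powr (- 3 / 2)) * indicator {t1 * x..t2 * x} y \<partial>lborel)
    = ennreal (g t2 x - g t1 x)"
    and mono: "g t1 x \<le> g t2 x" if x: "x \<in> {0..h}" for x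
  proof -
    have "t1 * x \<le> t2 * x" using x t(3) by (simp add: mult_right_mono)
    note T = nn_integral_vertical_segment[OF abs_square_less_1[THEN iffD1, OF lt1[OF x]] this lt[OF x]]
    show "(\<integral>\<^sup>+y. ennreal ((1 - x\<^sup>2 - y\<^sup>2) powr (- 3 / 2)) * indicator {t1 * x..t2 * x} y \<partial>lborel)
      = ennreal (g t2 x - g t1 x)"
      unfolding g_def by (rule T(1))
    show "g t1 x \<le> g t2 x" unfolding g_def by (rule T(2))
  qed
  have "(\<integral>\<^sup>+z. ennreal ((1 - (norm z)\<^sup>2) powr (- 3 / 2)) * indicator T z \<partial>lborel) =
     (\<integral>\<^sup>+x. \<integral>\<^sup>+y. ennreal ((1 - (norm (Complex x y))\<^sup>2) powr (- 3 / 2)) * indicator T (Complex x y) \<partial>lborel \<partial>lborel)"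
    by (rule nn_integral_complex) measurable
  also have "\<dots> = (\<integral>\<^sup>+x. ennreal (g t2 x - g t1 x) * indicator {0..h} x \<partial>lborel)"
  proof (rule nn_integral_cong)
    fix x :: real
    show "(\<integral>\<^sup>+y. ennreal ((1
      - (norm (Complex x y))\<^sup>2) powr (- 3 / 2)) * indicator T (Complex x y) \<partial>lborel) =
      ennreal (g t2 x - g t1 x) * indicator {0..h} x"
    proof (cases "x \<in> {0..h}")
      case True
      then show ?thesis using inner[OF True] unfolding ind by (simp add: cmod_power2 diff_diff_eq)
    qed (simp add: ind)
  qed
  also have "\<dots> = ennreal ((right_area h (t2 * h) - right_area h (t1 * h)) - (right_area 0 (t2 * 0)
    - right_area 0 (t1 * 0)))"
  proof (rule nn_integral_FTC_Icc)
    show "(\<lambda>x. g t2 x - g t1 x) \<in> borel_measurable borel" unfolding g_def by measurable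
    show "((\<lambda>x. right_area x (t2 * x) - right_area x (t1 * x)) has_real_derivative g t2 x
      - g t1 x) (at x)"
      if "x \<in> {0..h}" for x
      unfolding g_def by (intro DERIV_diff right_area_deriv lt that)
  qed (use mono h in auto)
  also have "\<dots> = ennreal (right_area h b - right_area h a)"
    unfolding t by (simp add: right_area_def)
  finally show ?thesis unfolding T_def .
qed

subsection \<open>Passage between the two models\<close>

text \<open>Radially this is the duplication formula of the hyperbolic tangent: a point at distance
  d from 0 has norm tanh (d / 2) in the conformal disc and tanh d in the projective one.\<close>

definition klein :: "complex \<Rightarrow> complex" where
  "klein z = 2 * z / of_real (1 + (norm z)\<^sup>2)"

definition kinv :: "complex \<Rightarrow> complex" where
  "kinv p = p / of_real (1 + sqrt (1 - (norm p)\<^sup>2))"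

lemma one_plus_sqrt_pos: "norm (p::complex) < 1 \<Longrightarrow> 0 < 1 + sqrt (1 - (norm p)\<^sup>2)"
  using real_sqrt_ge_zero[of "1 - (norm p)\<^sup>2"] one_minus_norm_pos[of p] by linarith

lemma norm_kinv: assumes "norm p < 1" shows "norm (kinv p) < 1"
proof -
  have "norm (kinv p) = norm p / (1 + sqrt (1 - (norm p)\<^sup>2))"
    unfolding kinv_def norm_divide norm_of_real using one_plus_sqrt_pos[OF assms]
      by (simp only: abs_of_pos)
  also have "\<dots> \<le> norm p / 1" using one_minus_norm_pos[OF assms] one_plus_sqrt_pos[OF assms]
    by (intro divide_left_mono) (simp_all only: mult_1 norm_ge_zero, simp_all)
  finally show ?thesis using assms by simp
qed

lemma one_minus_norm_klein: "1 - (norm (klein z))\<^sup>2 = ((1 - (norm z)\<^sup>2) / (1 + (norm z)\<^sup>2))\<^sup>2"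
proof -
  have p: "1 + (norm z)\<^sup>2 > 0" by (simp add: add_pos_nonneg)
  have n: "norm (klein z) = 2 * norm z / (1 + (norm z)\<^sup>2)"
    using p unfolding klein_def norm_divide norm_mult norm_of_real by simp
  have *: "(1 + (norm z)\<^sup>2)\<^sup>2 - (2 * norm z)\<^sup>2 = (1 - (norm z)\<^sup>2)\<^sup>2"
    by (simp add: algebra_simps power2_eq_square)
  have "1 - (norm (klein z))\<^sup>2 = ((1 + (norm z)\<^sup>2)\<^sup>2 - (2 * norm z)\<^sup>2) / (1 + (norm z)\<^sup>2)\<^sup>2"
    using p unfolding n power_divide by (simp add: diff_divide_distrib)
  then show ?thesis unfolding * power_divide .
qed

lemma norm_klein: assumes "norm z < 1" shows "norm (klein z) < 1"
proof -
  have "1 + (norm z)\<^sup>2 > 0" by (simp add: add_pos_nonneg)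
  then have "0 < 1 - (norm (klein z))\<^sup>2"
    unfolding one_minus_norm_klein using one_minus_norm_pos[OF assms] by simp
  then show ?thesis by (simp add: abs_square_less_1)
qed

lemma klein_kinv: assumes "norm p < 1" shows "klein (kinv p) = p"
proof -
  define c where "c = sqrt (1 - (norm p)\<^sup>2)"
  have c: "c > 0" "(norm p)\<^sup>2 = 1 - c\<^sup>2" unfolding c_def using one_minus_norm_pos[OF assms] by auto
  have "norm (kinv p) = norm p / (1 + c)"
    using c(1) unfolding kinv_def c_def[symmetric] norm_divide norm_of_real by simp
  then have "1 + (norm (kinv p))\<^sup>2 = 1 + (1 - c\<^sup>2) / (1 + c)\<^sup>2" by (simp add: power_divide c(2))
  also have "1 - c\<^sup>2 = (1 - c) * (1 + c)" by (simp add: algebra_simps power2_eq_square)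
  also have "1 + (1 - c) * (1 + c) / (1 + c)\<^sup>2 = 2 / (1 + c)"
    using c(1) by (simp add: power2_eq_square) (simp add: field_simps)
  finally have "1 + (norm (kinv p))\<^sup>2 = 2 / (1 + c)" .
  then have "klein (kinv p) = 2 * kinv p / of_real (2 / (1 + c))" unfolding klein_def by simp
  also have "\<dots> = p" using c(1) unfolding kinv_def c_def[symmetric] by (simp del: of_real_add)
  finally show ?thesis .
qed

lemma kinv_klein: assumes "norm z < 1" shows "kinv (klein z) = z"
proof -
  have p: "1 + (norm z)\<^sup>2 > 0" by (simp add: add_pos_nonneg)
  have "sqrt (1 - (norm (klein z))\<^sup>2) = (1 - (norm z)\<^sup>2) / (1 + (norm z)\<^sup>2)"
    unfolding one_minus_norm_klein using p one_minus_norm_pos[OF assms] by simp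
  then have "1 + sqrt (1 - (norm (klein z))\<^sup>2) = 2 / (1 + (norm z)\<^sup>2)"
    using p by (simp add: field_simps)
  then show ?thesis unfolding kinv_def using p unfolding klein_def by (simp del: of_real_add)
qed

lemma inner_klein: "klein z \<bullet> klein w = 4 * (z \<bullet> w) / ((1 + (norm z)\<^sup>2) * (1 + (norm w)\<^sup>2))"
proof -
  have "klein z = (2 / (1 + (norm z)\<^sup>2)) *\<^sub>R z" for z by (simp add: klein_def scaleR_conv_of_real)
  then show ?thesis by simp
qed

lemma coshd_klein:
  assumes "norm z < 1" "norm w < 1"
  shows "(1 - klein z \<bullet> klein w) / sqrt ((1 - (norm (klein z))\<^sup>2) * (1 - (norm (klein w))\<^sup>2))
    = coshd z w"
proof -
  have p: "1 + (norm z)\<^sup>2 > 0" "1 + (norm w)\<^sup>2 > 0" by (auto simp: add_pos_nonneg)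
  have q: "1 - (norm z)\<^sup>2 > 0" "1 - (norm w)\<^sup>2 > 0" using assms one_minus_norm_pos by auto
  have s: "sqrt ((1 - (norm (klein z))\<^sup>2) * (1 - (norm (klein w))\<^sup>2)) =
     (1 - (norm z)\<^sup>2) / (1 + (norm z)\<^sup>2) * ((1 - (norm w)\<^sup>2) / (1 + (norm w)\<^sup>2))"
    unfolding one_minus_norm_klein real_sqrt_mult using p q by simp
  have n: "(norm (z - w))\<^sup>2 = (norm z)\<^sup>2 + (norm w)\<^sup>2 - 2 * (z \<bullet> w)"
    by (simp add: power2_norm_eq_inner inner_diff_left inner_diff_right inner_commute)
  show ?thesis
  proof -
    define A B C D I where "A = 1 + (norm z)\<^sup>2" "B = 1 + (norm w)\<^sup>2" "C = 1 - (norm z)\<^sup>2"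
      "D = 1 - (norm w)\<^sup>2" "I = z \<bullet> w"
    have "1 - 4 * I / (A * B) = (A * B - 4 * I) / (A * B)" "C / A * (D / B) = C * D / (A * B)"
      using p unfolding A_B_C_D_I_def[symmetric] by (simp_all add: diff_divide_distrib)
    then have "(1 - 4 * I / (A * B)) / (C / A * (D / B)) = (A * B - 4 * I) / (C * D)"
      using p unfolding A_B_C_D_I_def[symmetric] by simp
    also have "\<dots> = (C * D + 2 * ((norm z)\<^sup>2 + (norm w)\<^sup>2) - 4 * I) / (C * D)"
      unfolding A_B_C_D_I_def by (simp add: algebra_simps)
    also have "\<dots> = 1 + 2 * ((norm z)\<^sup>2 + (norm w)\<^sup>2 - 2 * I) / (C * D)"
      using p q unfolding A_B_C_D_I_def[symmetric] by (simp add: add_divide_distrib diff_divide_distrib)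
    finally show ?thesis unfolding s inner_klein coshd_def n unfolding A_B_C_D_I_def .
  qed
qed

lemma hdist_klein:
  assumes "norm z < 1" "norm w < 1"
  shows "hdist (klein z) (klein w) = pdist z w"
  unfolding hdist_def pdist_def coshd_klein[OF assms] ..

lemma hdist_eq_pdist: "norm p < 1 \<Longrightarrow> norm q < 1 \<Longrightarrow> hdist p q = pdist (kinv p) (kinv q)"
  using hdist_klein[of "kinv p" "kinv q"] by (simp add: norm_kinv klein_kinv)

section \<open>Orientation and the signed area of triangles in both models\<close>

definition kdet :: "complex \<Rightarrow> complex \<Rightarrow> complex \<Rightarrow> real" where
  "kdet p q r = Im (cnj (q - p) * (r - p))"

text \<open>Orientation as seen from \<open>x\<close>: once \<open>x\<close> is at 0, geodesics
  through it are straight in the conformal disc and a Euclidean determinant decides.\<close>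

definition orient :: "complex \<Rightarrow> complex \<Rightarrow> complex \<Rightarrow> real" where
  "orient x y w = Im (cnj (mob x y) * mob x w)"

lemma orient_poly:
  fixes x y w :: complex
  shows "(1 + (norm x)\<^sup>2) * Im (cnj (y - x) * (1 - cnj x * y) * (w - x) * (1 - x * cnj w)) =
    (1 - (norm x)\<^sup>2) * Im (cnj (y * of_real (1 + (norm x)\<^sup>2) - x * of_real (1 + (norm y)\<^sup>2)) *
       (w * of_real (1 + (norm x)\<^sup>2) - x * of_real (1 + (norm w)\<^sup>2)))"
proof -
  obtain x1 x2 y1 y2 w1 w2 where "x = Complex x1 x2" "y = Complex y1 y2" "w = Complex w1 w2"
    by (meson complex.exhaust)
  then show ?thesis unfolding cmod_power2 by (simp add: algebra_simps power2_eq_square)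
qed

text \<open>Both determinants decide on which side of a geodesic a point lies. After denominators
  are cleared, \<open>orient_poly\<close> relates them by an explicit positive factor, so signs and
  collinearity pass between the models.\<close>

lemma orient_kdet:
  assumes "norm x < 1" "norm y < 1" "norm w < 1"
  obtains k where "k > 0" "orient x y w = k * kdet (klein x) (klein y) (klein w)"
proof -
  define X Y W where "X = 1 + (norm x)\<^sup>2" "Y = 1 + (norm y)\<^sup>2" "W = 1 + (norm w)\<^sup>2"
  have p: "X > 0" "Y > 0" "W > 0" unfolding X_Y_W_def by (auto simp: add_pos_nonneg)
  define N1 where "N1 = Im (cnj (y - x) * (1 - cnj x * y) * (w - x) * (1 - x * cnj w))"
  define N2 where "N2 = Im (cnj (y * of_real X - x * of_real Y) * (w * of_real X - x * of_real W))"
  have N: "X * N1 = (1 - (norm x)\<^sup>2) * N2" unfolding N1_def N2_def X_Y_W_def by (rule orient_poly)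
  define A where "A = (norm (1 - cnj x * y))\<^sup>2 * (norm (1 - cnj x * w))\<^sup>2"
  have A: "A > 0" unfolding A_def using one_minus_cnj_nz assms by simp
  have o: "orient x y w = N1 / A"
  proof -
    have nz: "1 - cnj x * y \<noteq> 0" "1 - cnj x * w \<noteq> 0" using one_minus_cnj_nz assms by auto
    then have nz': "cnj (1 - cnj x * y) \<noteq> 0" "cnj (1 - cnj x * w) \<noteq> 0" unfolding complex_cnj_zero_iff .
    have "cnj (mob x y) * mob x w = cnj (y - x) / cnj (1 - cnj x * y) * ((w - x) / (1 - cnj x * w))"
      by (simp add: mob_def)
    also have "\<dots> = (cnj (y - x) * (1 - cnj x * y) * (w - x) * cnj (1 - cnj x * w)) /
      (((1 - cnj x * y) * cnj (1 - cnj x * y)) * ((1 - cnj x * w) * cnj (1 - cnj x * w)))"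
      using nz nz' by (simp add: divide_simps del: complex_cnj_diff)
    also have "\<dots> = (cnj (y - x) * (1 - cnj x * y) * (w - x) * (1 - x * cnj w)) / of_real A"
      unfolding A_def of_real_mult complex_norm_square by simp
    finally show ?thesis unfolding orient_def N1_def by simp
  qed
  have d: "kdet (klein x) (klein y) (klein w) = 4 * N2 / (X * X * Y * W)"
  proof -
    have 1: "klein y - klein x = of_real (2 / (X * Y)) * (y * of_real X - x * of_real Y)"
      "klein w - klein x = of_real (2 / (X * W)) * (w * of_real X - x * of_real W)"
      unfolding klein_def X_Y_W_def[symmetric] using p by (simp_all add: field_simps)
    have g: "Im (cnj (of_real a * U) * (of_real b * V)) = a * b * Im (cnj U * V)" for a b U V
      by (simp add: algebra_simps)
    show ?thesis unfolding kdet_def 1 g N2_def[symmetric] by simp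
  qed
  show thesis
  proof (rule that)
    show "(1 - (norm x)\<^sup>2) * X * Y * W / (4 * A) > 0" using p A one_minus_norm_pos[OF assms(1)] by simp
    show "orient x y w = (1 - (norm x)\<^sup>2) * X * Y * W / (4 * A) * kdet (klein x) (klein y) (klein w)"
    proof -
      have "N1 = (1 - (norm x)\<^sup>2) * N2 / X" using N p(1) by (simp add: nonzero_eq_divide_eq mult.commute)
      then show ?thesis unfolding o d using p A by simp
    qed
  qed
qed

lemma tri_area_eq_0: assumes "norm z < 1" "norm w < 1" "Im (cnj z * w) = 0" shows "tri_area z w = 0"
proof -
  have "Arg (1 - cnj z * w) = 0" unfolding Arg_eq_0_iff complex_is_Real_iff
    using Re_one_minus_cnj_pos[OF assms(1,2)] assms(3) by simp
  then show ?thesis by (simp add: tri_area_def)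
qed

text \<open>Once \<open>x\<close> is moved to 0, all three triangles are degenerate; the corrections
  picked up on the way cancel.\<close>

lemma tri_area_collinear:
  assumes "norm x < 1" "norm y < 1" "norm w < 1" "orient x y w = 0"
  shows "tri_area x y + tri_area y w = tri_area x w"
proof -
  define \<phi> where "\<phi> = (\<lambda>z. - 2 * Arg (1 + cnj (- x / 1) * z))"
  have n: "norm (- x) < norm (1::complex)" using assms by simp
  have "tri_area (mob x a) (mob x b) = tri_area a b + \<phi> a - \<phi> b" if "norm a < 1" "norm b < 1" for a b
    unfolding mob_daut \<phi>_def by (rule tri_area_daut[OF n that])
  note t = this
  have "tri_area (mob x x) (mob x y) = 0" "tri_area (mob x x) (mob x w) = 0"
    by (simp_all add: mob_def tri_area_def)
  moreover have "tri_area (mob x y) (mob x w) = 0"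
    by (rule tri_area_eq_0) (use assms norm_mob in \<open>auto simp: orient_def\<close>)
  ultimately show ?thesis using t[of x y] t[of x w] t[of y w] assms by simp
qed

lemma Arg_eq_arctan: "Re z > 0 \<Longrightarrow> Arg z = arctan (Im z / Re z)"
  by (rule arg_conv_arctan)

text \<open>\<open>tri_area\<close> is twice an argument and \<open>right_area\<close> a single
  arctangent; the factor 2 is absorbed by squaring the complex number, after which a positive real
  factor drops out.\<close>

lemma tri_area_right:
  assumes "h\<^sup>2 + b\<^sup>2 < 1"
  shows "tri_area (kinv (of_real h)) (kinv (Complex h b)) = right_area h b"
proof -
  have h: "h\<^sup>2 < 1" using assms zero_le_power2[of b] by linarith
  define c u where "c = sqrt (1 - h\<^sup>2)" "u = sqrt (1 - h\<^sup>2 - b\<^sup>2)"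
  have c: "c > 0" "c\<^sup>2 = 1 - h\<^sup>2" unfolding c_u_def using h by auto
  have u: "u > 0" "u\<^sup>2 = 1 - h\<^sup>2 - b\<^sup>2" unfolding c_u_def using assms by auto
  have n: "norm (complex_of_real h) = \<bar>h\<bar>" "(norm (Complex h b))\<^sup>2 = h\<^sup>2 + b\<^sup>2"
    by (auto simp: cmod_power2)
  \<comment> \<open>The number whose argument is wanted, cleared of the denominators
    \<open>1 + c\<close> and \<open>1 + u\<close> of \<open>kinv\<close>.\<close>
  define V where "V = Complex ((u + c) * (1 + c)) (- (h * b))"
  have V: "1 - cnj (kinv (of_real h)) * kinv (Complex h b)
    = of_real (1 / ((1 + c)\<^sup>2 * (1 + u))) * V * of_real (1 + c)"
  proof -
    have k: "kinv (of_real h) = of_real (h / (1 + c))"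
      "kinv (Complex h b) = Complex (h / (1 + u)) (b / (1 + u))"
      unfolding kinv_def n using c_u_def by (auto simp: complex_eq_iff diff_diff_eq)
    have hh: "h * h = (1 - c) * (1 + c)" using c(2) by (simp add: power2_eq_square algebra_simps)
    have R: "1 - h * h / ((1 + c) * (1 + u)) = (u + c) * (1 + c) / ((1 + c) * (1 + u))"
    proof -
      have "1 - h * h / ((1 + c) * (1 + u)) = ((1 + c) * (1 + u) - h * h) / ((1 + c) * (1 + u))"
        using c(1) u(1) by (simp add: diff_divide_distrib)
      also have "(1 + c) * (1 + u) - h * h = (u + c) * (1 + c)" unfolding hh by (simp add: algebra_simps)
      finally show ?thesis .
    qed
    have "1 - cnj (kinv (of_real h)) * kinv (Complex h b)
      = Complex (1 - h * h / ((1 + c) * (1 + u))) (- (h * b / ((1 + c) * (1 + u))))"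
      unfolding k by (simp add: complex_eq_iff)
    also have "\<dots> = of_real (1 / ((1 + c)\<^sup>2 * (1 + u))) * V * of_real (1 + c)"
      unfolding R V_def using c(1) u(1) by (simp add: complex_eq_iff power2_eq_square)
    finally show ?thesis .
  qed
  have "Arg (1 - cnj (kinv (of_real h)) * kinv (Complex h b)) = Arg V"
    unfolding V using c(1) u(1)
      by (simp add: Arg_times_of_real Arg_times_of_real2 mult.assoc del: of_real_add of_real_mult of_real_divide)
  moreover have "2 * Arg V = Arg (V * V)"
    using c(1) u(1) by (subst Arg_mult_pos) (auto simp: V_def)
  moreover have "V * V = of_real (2 * (u + c) * (1 + c)) * Complex (u + c\<^sup>2) (- (h * b))"
  proof -
    have "(h * b) * (h * b) = h\<^sup>2 * b\<^sup>2" by (simp add: power2_eq_square)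
    also have "\<dots> = (1 - c\<^sup>2) * (c\<^sup>2 - u\<^sup>2)" using c(2) u(2) by simp
    finally have hb: "(h * b) * (h * b) = (1 - c\<^sup>2) * (c\<^sup>2 - u\<^sup>2)" .
    have "((u + c) * (1 + c)) * ((u + c) * (1 + c)) - (1 - c\<^sup>2) * (c\<^sup>2 - u\<^sup>2)
      = 2 * (u + c) * (1 + c) * (u + c\<^sup>2)"
      by (simp add: algebra_simps power2_eq_square)
    then show ?thesis unfolding V_def using hb by (simp add: complex_eq_iff)
  qed
  moreover have "Arg (of_real (2 * (u + c) * (1 + c)) * Complex (u + c\<^sup>2) (- (h * b)))
    = Arg (Complex (u + c\<^sup>2) (- (h * b)))"
    using c(1) u(1) by (intro Arg_times_of_real) simp
  moreover have "Arg (Complex (u + c\<^sup>2) (- (h * b))) = - right_area h b"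
  proof -
    have "u + c\<^sup>2 > 0" using u(1) by (simp add: add_pos_nonneg)
    then have "Arg (Complex (u + c\<^sup>2) (- (h * b))) = - arctan (h * b / (u + c\<^sup>2))"
      by (subst Arg_eq_arctan) (simp_all add: arctan_minus)
    moreover have "u + c\<^sup>2 = u + 1 - h\<^sup>2" using c(2) by simp
    ultimately show ?thesis unfolding right_area_def c_u_def(2)[symmetric] by (simp only:)
  qed
  ultimately show ?thesis unfolding tri_area_def by simp
qed

text \<open>The foot \<open>h\<close> of the perpendicular from 0 lies on the line through both
  points, so the triangle is a signed difference of two right triangles.\<close>

lemma tri_area_vertical:
  assumes "h\<^sup>2 + a\<^sup>2 < 1" "h\<^sup>2 + b\<^sup>2 < 1"
  shows "tri_area (kinv (Complex h a)) (kinv (Complex h b)) = right_area h b - right_area h a"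
proof -
  have h: "\<bar>h\<bar> < 1" using assms(1) zero_le_power2[of a] abs_square_less_1[of h] by linarith
  have n: "norm (complex_of_real h) < 1" "norm (Complex h a) < 1" "norm (Complex h b) < 1"
    using h assms by (auto simp: cmod_def)
  obtain k where "orient (kinv (of_real h)) (kinv (Complex h a)) (kinv (Complex h b)) =
     k * kdet (klein (kinv (of_real h))) (klein (kinv (Complex h a))) (klein (kinv (Complex h b)))"
    using orient_kdet norm_kinv n by metis
  also have "\<dots> = 0" unfolding klein_kinv[OF n(1)] klein_kinv[OF n(2)] klein_kinv[OF n(3)]
    by (simp add: kdet_def)
  finally have "tri_area (kinv (of_real h)) (kinv (Complex h a))
    + tri_area (kinv (Complex h a)) (kinv (Complex h b))
     = tri_area (kinv (of_real h)) (kinv (Complex h b))"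
    by (intro tri_area_collinear norm_kinv n)
  then show ?thesis using tri_area_right assms by simp
qed

lemma tri_area_swap: assumes "norm z < 1" "norm w < 1" shows "tri_area w z = - tri_area z w"
proof -
  have "1 - cnj w * z = cnj (1 - cnj z * w)" by simp
  then have "Arg (1 - cnj w * z) = - Arg (1 - cnj z * w)"
    using Arg_cnj_pos[OF Re_one_minus_cnj_pos[OF assms]] by (simp only:)
  then show ?thesis unfolding tri_area_def by linarith
qed

lemma tri_area_pos: "0 < Im (cnj z * w) \<Longrightarrow> 0 < tri_area z w"
  using Arg_neg_iff[of "1 - cnj z * w"] unfolding tri_area_def by simp

lemma hull_vertical:
  assumes "0 < h" "a < b"
  shows "convex hull {0, Complex h a, Complex h b} = {z. 0 \<le> Re z \<and> Re z \<le> h \<and> a * Re z \<le> h * Im z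
    \<and> h * Im z \<le> b * Re z}"
proof (intro set_eqI iffI)
  fix z assume "z \<in> convex hull {0, Complex h a, Complex h b}"
  then obtain s t where st: "0 \<le> s" "0 \<le> t" "s + t \<le> 1" "z = s *\<^sub>R Complex h a + t *\<^sub>R Complex h b"
    unfolding mem_triangle_0 by blast
  have z: "Re z = (s + t) * h" "Im z = s * a + t * b" using st(4) by (auto simp: algebra_simps)
  have "h * Im z = a * Re z + h * t * (b - a)" "b * Re z = h * Im z + h * s * (b - a)" unfolding z
    by (auto simp: algebra_simps)
  moreover have "h * t * (b - a) \<ge> 0" "h * s * (b - a) \<ge> 0" using st assms by auto
  moreover have "(s + t) * h \<le> 1 * h" using st assms by (intro mult_right_mono) auto
  moreover have "0 \<le> (s + t) * h" using st assms by simp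
  ultimately show "z \<in> {z. 0 \<le> Re z \<and> Re z \<le> h \<and> a * Re z \<le> h * Im z \<and> h * Im z \<le> b * Re z}"
    using z(1) by simp
next
  fix z assume "z \<in> {z. 0 \<le> Re z \<and> Re z \<le> h \<and> a * Re z \<le> h * Im z \<and> h * Im z \<le> b * Re z}"
  then have z: "0 \<le> Re z" "Re z \<le> h" "a * Re z \<le> h * Im z" "h * Im z \<le> b * Re z" by auto
  \<comment> \<open>Barycentric coordinates from Cramer's rule.\<close>
  define s t where "s = (b * Re z - h * Im z) / (h * (b - a))"
    "t = (h * Im z - a * Re z) / (h * (b - a))"
  have nz: "h * (b - a) > 0" using assms by simp
  have "s + t = ((b * Re z - h * Im z) + (h * Im z - a * Re z)) / (h * (b - a))"
    unfolding s_t_def by (simp only: add_divide_distrib)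
  also have "\<dots> = Re z * (b - a) / (h * (b - a))" by (simp add: algebra_simps)
  finally have sum: "s + t = Re z / h" using assms by simp
  have im: "s * a + t * b = Im z"
  proof -
    have "s * a + t * b = ((b * Re z - h * Im z) * a + (h * Im z - a * Re z) * b) / (h * (b - a))"
      unfolding s_t_def by (simp only: add_divide_distrib times_divide_eq_left)
    also have "(b * Re z - h * Im z) * a + (h * Im z - a * Re z) * b = Im z * (h * (b - a))"
      by (simp add: algebra_simps)
    finally show ?thesis using assms by simp
  qed
  have "0 \<le> s" "0 \<le> t" unfolding s_t_def using z nz by auto
  moreover have "s + t \<le> 1" unfolding sum using z assms by simp
  moreover have "z = s *\<^sub>R Complex h a + t *\<^sub>R Complex h b"
    using sum im assms by (auto simp: complex_eq_iff distrib_right[symmetric])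
  ultimately show "z \<in> convex hull {0, Complex h a, Complex h b}" unfolding mem_triangle_0 by blast
qed

lemma hull_rotate:
  fixes u z p q :: complex
  assumes "norm u = 1"
  shows "u * z \<in> convex hull {0, u * p, u * q} \<longleftrightarrow> z \<in> convex hull {0, p, q}"
proof -
  have u: "u \<noteq> 0" using assms by auto
  have "u * z = s *\<^sub>R (u * p) + t *\<^sub>R (u * q) \<longleftrightarrow> z = s *\<^sub>R p + t *\<^sub>R q" for s t
  proof -
    have "s *\<^sub>R (u * p) + t *\<^sub>R (u * q) = u * (s *\<^sub>R p + t *\<^sub>R q)"
      by (simp add: scaleR_conv_of_real algebra_simps)
    then show ?thesis using u by simp
  qed
  then show ?thesis unfolding mem_triangle_0 by simp
qed

lemma kinv_rotate: "norm u = 1 \<Longrightarrow> kinv (u * p) = u * kinv p"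
  by (simp add: kinv_def norm_mult)

lemma tri_area_rotate: assumes "norm u = 1" shows "tri_area (u * z) (u * w) = tri_area z w"
proof -
  have "cnj u * u = 1" using assms complex_norm_square[of u] by (simp add: mult.commute)
  moreover have "cnj (u * z) * (u * w) = (cnj u * u) * (cnj z * w)" by (simp add: mult_ac)
  ultimately have "cnj (u * z) * (u * w) = cnj z * w" by (simp only: mult_1)
  then show ?thesis by (simp only: tri_area_def)
qed

text \<open>Area density and signed area are both rotation invariant, so the side from
  \<open>p\<close> to \<open>q\<close> may be assumed vertical, where the integral has been
  evaluated.\<close>

lemma harea_triangle_pos:
  assumes p: "norm p < 1" and q: "norm q < 1" and pos: "Im (cnj p * q) > 0"
  shows "harea (convex hull {0, p, q}) = tri_area (kinv p) (kinv q)"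
proof -
  have ne: "q \<noteq> p" using pos by auto
  \<comment> \<open>This rotation makes \<open>q - p\<close> point straight up; the positive
    orientation then puts the side to the right of 0.\<close>
  define u where "u = \<i> * of_real (norm (q - p)) / (q - p)"
  have u: "norm u = 1" unfolding u_def using ne by (simp add: norm_mult norm_divide)
  have uu: "cnj u * u = 1" using u complex_norm_square[of u] by (simp add: mult.commute)
  have "u * q - u * p = u * (q - p)" by (simp add: algebra_simps)
  also have "\<dots> = \<i> * of_real (norm (q - p))" using ne unfolding u_def by simp
  finally have d: "u * q - u * p = \<i> * of_real (norm (q - p))" .
  define h a b where "h = Re (u * p)" "a = Im (u * p)" "b = Im (u * q)"
  have "Re (u * q - u * p) = 0" "Im (u * q - u * p) = norm (q - p)" unfolding d by simp_all
  moreover have "norm (q - p) > 0" using ne by simp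
  ultimately have hq: "Re (u * q) = h" "a < b" unfolding h_a_b_def minus_complex.simps by linarith+
  have P: "u * p = Complex h a" "u * q = Complex h b" using hq unfolding h_a_b_def
    by (simp_all add: complex_eq_iff)
  have "Im (cnj (u * p) * (u * q)) = Im (cnj p * q)"
  proof -
    have "cnj (u * p) * (u * q) = (cnj u * u) * (cnj p * q)" by simp
    then show ?thesis by (simp only: uu mult_1)
  qed
  then have "h * (b - a) > 0" using pos unfolding P by (simp add: algebra_simps)
  then have h: "h > 0" using hq by (simp add: zero_less_mult_iff)
  have "norm (u * p) < 1" "norm (u * q) < 1" using p q u by (auto simp: norm_mult)
  then have lt: "h\<^sup>2 + a\<^sup>2 < 1" "h\<^sup>2 + b\<^sup>2 < 1" unfolding P by (auto simp: cmod_def)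
  define f where "f = (\<lambda>z::complex. ennreal ((1
    - (norm z)\<^sup>2) powr (- 3 / 2)) * indicator (convex hull {0, Complex h a, Complex h b}) z)"
  have cl: "closed (convex hull {0, x, y})" for x y :: complex
    by (intro compact_imp_closed finite_imp_compact_convex_hull) auto
  have [measurable]: "convex hull {0, x, y} \<in> sets borel" for x y :: complex using cl
    by (intro borel_closed)
  have "(\<integral>\<^sup>+z. f z \<partial>lborel) = (\<integral>\<^sup>+z. f (u * z) \<partial>lborel)"
    by (rule nn_integral_complex_rotation[symmetric, OF _ u]) (simp add: f_def)
  also have "\<dots> = (\<integral>\<^sup>+z. ennreal (indicator (convex hull {0, p, q}) z *\<^sub>R (1
    - (norm z)\<^sup>2) powr (- 3 / 2)) \<partial>lborel)"
    by (rule nn_integral_cong) (auto simp: f_def P[symmetric] indicator_def hull_rotate[OF u] norm_mult u)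
  finally have 1: "(\<integral>\<^sup>+z. ennreal (indicator (convex hull {0, p, q}) z *\<^sub>R (1
    - (norm z)\<^sup>2) powr (- 3 / 2)) \<partial>lborel)
     = ennreal (right_area h b - right_area h a)"
    using nn_integral_vertical_triangle[of h a b] h hq lt unfolding f_def hull_vertical[OF h hq(2)]
      by simp
  have "tri_area (kinv p) (kinv q) = tri_area (kinv (u * p)) (kinv (u * q))"
    by (simp add: kinv_rotate tri_area_rotate u)
  also have "\<dots> = right_area h b - right_area h a" unfolding P by (rule tri_area_vertical[OF lt])
  finally have 2: "tri_area (kinv p) (kinv q) = right_area h b - right_area h a" .
  have "Im (cnj (kinv p) * kinv q)
    = Im (cnj p * q) / ((1 + sqrt (1 - (norm p)\<^sup>2)) * (1 + sqrt (1 - (norm q)\<^sup>2)))"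
    unfolding kinv_def by (simp add: field_simps del: of_real_add)
  then have "tri_area (kinv p) (kinv q) > 0"
    using pos one_plus_sqrt_pos[OF p] one_plus_sqrt_pos[OF q]
      by (intro tri_area_pos) (simp only: zero_less_divide_iff zero_less_mult_iff simp_thms)
  then show ?thesis unfolding harea_def set_lebesgue_integral_def
    using 1 2 by (subst integral_eq_nn_integral) simp_all
qed

lemma harea_triangle:
  assumes p: "norm p < 1" and q: "norm q < 1"
  shows "sgn (Im (cnj p * q)) * harea (convex hull {0, p, q}) = tri_area (kinv p) (kinv q)"
proof -
  have I: "Im (cnj (kinv p) * kinv q)
    = Im (cnj p * q) / ((1 + sqrt (1 - (norm p)\<^sup>2)) * (1 + sqrt (1 - (norm q)\<^sup>2)))"
    unfolding kinv_def by (simp add: field_simps del: of_real_add)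
  consider "Im (cnj p * q) > 0" | "Im (cnj p * q) = 0" | "Im (cnj p * q) < 0" by linarith
  then show ?thesis
  proof cases
    case 1 then show ?thesis using harea_triangle_pos[OF p q] by simp
  next
    case 2
    then show ?thesis using I by (simp add: tri_area_eq_0 norm_kinv p q)
  next
    case 3
    then have "Im (cnj q * p) > 0" by (simp add: algebra_simps)
    then have "harea (convex hull {0, p, q}) = tri_area (kinv q) (kinv p)"
      using harea_triangle_pos[OF q p] by (simp add: insert_commute)
    then show ?thesis using tri_area_swap[of "kinv q" "kinv p"] norm_kinv p q 3 by simp
  qed
qed

section \<open>Signed area and perimeter of cyclic tuples\<close>

definition cyc_area :: "nat \<Rightarrow> (nat \<Rightarrow> complex) \<Rightarrow> real" where
  "cyc_area n z = (\<Sum>i<n. tri_area (z i) (z (Suc i)))"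

definition cyc_perim :: "nat \<Rightarrow> (nat \<Rightarrow> complex) \<Rightarrow> real" where
  "cyc_perim n z = (\<Sum>i<n. pdist (z i) (z (Suc i)))"

lemma norm_vertex: assumes "ngon n P" shows "norm (vertex P i) < 1"
proof -
  have "vertex P i \<in> set P" unfolding vertex_def using assms
    by (auto simp: ngon_def intro!: nth_mem mod_less_divisor)
  then show ?thesis using assms by (auto simp: ngon_def hplane_def)
qed

lemma polygon_area_eq:
  assumes "ngon n P" shows "polygon_area P = \<bar>cyc_area n (\<lambda>i. kinv (vertex P i))\<bar>"
  unfolding polygon_area_triangles[OF assms] cyc_area_def
  by (simp only: harea_triangle[OF norm_vertex[OF assms] norm_vertex[OF assms]])

lemma perimeter_eq:
  assumes "ngon n P" shows "perimeter P = cyc_perim n (\<lambda>i. kinv (vertex P i))"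
  using assms unfolding perimeter_def cyc_perim_def
  by (simp add: hdist_eq_pdist norm_vertex[OF assms]) (simp add: ngon_def)

subsection \<open>Equilateral and equiangular tuples\<close>

text \<open>Coordinates on the hyperboloid, on which automorphisms act linearly.\<close>

definition lift_space :: "complex \<Rightarrow> complex" where "lift_space z = 2 * z / of_real (1 - (norm z)\<^sup>2)"
definition lift_time :: "complex \<Rightarrow> real" where "lift_time z = (1 + (norm z)\<^sup>2) / (1 - (norm z)\<^sup>2)"

lemma lift_time_pos: assumes "norm z < 1" shows "lift_time z > 0"
  unfolding lift_time_def using one_minus_norm_pos[OF assms]
    by (intro divide_pos_pos add_pos_nonneg) auto

lemma norm_lift_space_less_lift_time: assumes "norm z < 1" shows "norm (lift_space z) < lift_time z"
proof -
  have p: "1 - (norm z)\<^sup>2 > 0" using one_minus_norm_pos[OF assms] .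
  have "norm (lift_space z) = 2 * norm z / (1 - (norm z)\<^sup>2)" using p
    unfolding lift_space_def norm_divide norm_mult norm_of_real by simp
  moreover have "0 < (1 - norm z)\<^sup>2" using assms by simp
  then have "2 * norm z < 1 + (norm z)\<^sup>2" by (simp add: power2_eq_square algebra_simps)
  ultimately show ?thesis unfolding lift_time_def using p by (simp add: divide_strict_right_mono)
qed

lemma lift_space_daut:
  assumes "norm \<beta> < norm \<alpha>" "norm z < 1"
  shows "lift_space (daut \<alpha> \<beta> z)
    = (\<alpha>\<^sup>2 * lift_space z + 2 * \<alpha> * \<beta> * of_real (lift_time z) + \<beta>\<^sup>2 * cnj (lift_space z)) / of_real ((norm \<alpha>)\<^sup>2 - (norm \<beta>)\<^sup>2)"
proof -
  define D where "D = (norm \<alpha>)\<^sup>2 - (norm \<beta>)\<^sup>2"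
  define w where "w = cnj \<beta> * z + cnj \<alpha>"
  define s where "s = 1 - (norm z)\<^sup>2"
  have D: "D > 0" unfolding D_def using assms(1) by (auto intro!: power_strict_mono)
  have s: "s > 0" unfolding s_def using assms(2) by (rule one_minus_norm_pos)
  have w: "w \<noteq> 0" "cnj w \<noteq> 0" unfolding complex_cnj_zero_iff w_def using daut_denom_nz[OF assms] by auto
  have "lift_space (daut \<alpha> \<beta> z) = 2 * ((\<alpha> * z + \<beta>) / w) / of_real (D * s / (norm w)\<^sup>2)"
    unfolding lift_space_def daut_norm_eq[OF assms] D_def s_def w_def by (simp add: daut_def)
  also have "\<dots> = 2 * (\<alpha> * z + \<beta>) * cnj w / of_real (D * s)"
    using w D s by (simp add: complex_norm_square divide_simps del: of_real_power)
  also have "2 * (\<alpha> * z + \<beta>) * cnj w = \<alpha>\<^sup>2 * (2 * z) + 2 * \<alpha> * \<beta> * (1 + z * cnj z) + \<beta>\<^sup>2 * (2 * cnj z)"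
    unfolding w_def by (simp add: algebra_simps power2_eq_square)
  also have "z * cnj z = of_real ((norm z)\<^sup>2)" by (simp only: complex_norm_square)
  also have "(\<alpha>\<^sup>2 * (2 * z) + 2 * \<alpha> * \<beta> * (1 + of_real ((norm z)\<^sup>2))
    + \<beta>\<^sup>2 * (2 * cnj z)) / of_real (D * s) =
     (\<alpha>\<^sup>2 * (2 * z / of_real s) + 2 * \<alpha> * \<beta> * of_real ((1 + (norm z)\<^sup>2) / s) + \<beta>\<^sup>2 * (2 * cnj z / of_real s)) / of_real D"
    using D s by (simp add: field_simps)
  also have "2 * cnj z / of_real s = cnj (2 * z / of_real s)" by simp
  finally show ?thesis unfolding D_def s_def lift_space_def lift_time_def .
qed

text \<open>Automorphisms act transitively on points with a direction: translate \<open>a\<close> to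
  0, turn by \<open>u\<close>, translate 0 to \<open>b\<close>.\<close>

lemma daut_mob_exists:
  assumes "norm a < 1" "norm b < 1" "norm u = 1"
  obtains \<alpha> \<beta> where "norm \<beta> < norm \<alpha>" "\<And>x. norm x < 1 \<Longrightarrow> mob b (daut \<alpha> \<beta> x) = u * mob a x"
proof -
  \<comment> \<open>\<open>daut k 0\<close> multiplies by \<open>k / cnj k\<close>, which is
    \<open>k\<^sup>2\<close> for a unit number; hence the square root.\<close>
  define k where "k = csqrt u"
  have k: "norm k = 1" "k\<^sup>2 = u" "k \<noteq> 0" unfolding k_def using assms(3) by auto
  have kk: "k * cnj k = 1" using complex_norm_square[of k] k by simp
  have "daut k 0 x = u * x" for x
  proof -
    have "daut k 0 x = k * x / cnj k" by (simp add: daut_def)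
    also have "\<dots> = k * x * k / (k * cnj k)" using k by simp
    finally show ?thesis unfolding kk k(2)[symmetric] by (simp add: power2_eq_square mult_ac)
  qed
  note rotu = this
  have n1: "norm (- a) < norm (1::complex)" "norm b < norm (1::complex)" "norm (0::complex) < norm k"
    using assms k by auto
  obtain \<gamma> \<delta> where g: "norm \<delta> < norm \<gamma>" "\<And>x. norm x < 1 \<Longrightarrow> daut k 0 (mob a x) = daut \<gamma> \<delta> x"
    using daut_compose[OF n1(1)] daut_compose_norm[OF n1(3) n1(1)] unfolding mob_daut by blast
  obtain \<alpha> \<beta> where f: "norm \<beta> < norm \<alpha>" "\<And>x. norm x < 1 \<Longrightarrow> daut 1 b (daut \<gamma> \<delta> x) = daut \<alpha> \<beta> x"
    using daut_compose[OF g(1)] daut_compose_norm[OF n1(2) g(1)] by blast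
  show thesis
  proof (rule that[OF f(1)])
    fix x :: complex assume x: "norm x < 1"
    have "mob b (daut 1 b (daut \<gamma> \<delta> x)) = daut \<gamma> \<delta> x"
      using daut_inverse[OF n1(2) norm_daut[OF g(1) x]] by (simp add: mob_daut)
    then show "mob b (daut \<alpha> \<beta> x) = u * mob a x"
      using f(2)[OF x] g(2)[OF x] rotu by simp
  qed
qed

lemma mob_inj: assumes "norm c < 1" "norm x < 1" "norm y < 1" "mob c x = mob c y" shows "x = y"
proof -
  have n: "norm (- c) < norm (1::complex)" using assms by simp
  show ?thesis using daut_inverse[OF n assms(2)] daut_inverse[OF n assms(3)] assms(4) unfolding mob_daut
    by simp
qed

lemma sum_shift_periodic:
  fixes f :: "nat \<Rightarrow> 'a::ab_group_add"
  assumes "f n = f 0" shows "(\<Sum>i<n. f (Suc i)) = (\<Sum>i<n. f i)"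
proof -
  have "(\<Sum>i<n. f (Suc i)) - (\<Sum>i<n. f i) = f n - f 0"
    unfolding sum_subtractf[symmetric] by (rule sum_lessThan_telescope)
  then show ?thesis using assms by simp
qed

text \<open>Periodic sequences in place of lists make \<open>Suc\<close> the cyclic successor, and
  tuples become points of a product space.\<close>

definition ctuple :: "nat \<Rightarrow> (nat \<Rightarrow> complex) \<Rightarrow> bool" where
  "ctuple n z \<longleftrightarrow> (\<forall>i. z (i + n) = z i) \<and> (\<forall>i. norm (z i) < 1)"

lemma ctuple_norm: "ctuple n z \<Longrightarrow> norm (z i) < 1" by (simp add: ctuple_def)

lemma ctuple_period: "ctuple n z \<Longrightarrow> z n = z 0"
  unfolding ctuple_def by (metis add_0)

lemma ctuple_daut: "ctuple n z \<Longrightarrow> norm \<beta> < norm \<alpha> \<Longrightarrow> ctuple n (\<lambda>i. daut \<alpha> \<beta> (z i))"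
  by (simp add: ctuple_def norm_daut)

lemma cyc_perim_daut: "ctuple n z \<Longrightarrow> norm \<beta> < norm \<alpha> \<Longrightarrow> cyc_perim n (\<lambda>i. daut \<alpha> \<beta> (z i)) = cyc_perim n z"
  by (simp add: cyc_perim_def ctuple_def pdist_daut)

lemma cyc_area_daut:
  assumes "ctuple n z" "norm \<beta> < norm \<alpha>" shows "cyc_area n (\<lambda>i. daut \<alpha> \<beta> (z i)) = cyc_area n z"
proof -
  define \<phi> where "\<phi> = (\<lambda>x. - 2 * Arg (1 + cnj (\<beta> / \<alpha>) * x))"
  have "cyc_area n (\<lambda>i. daut \<alpha> \<beta> (z i)) = (\<Sum>i<n. tri_area (z i) (z (Suc i)) + (\<phi> (z i) - \<phi> (z (Suc i))))"
    unfolding cyc_area_def \<phi>_def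
    by (rule sum.cong) (simp_all add: tri_area_daut[OF assms(2)] ctuple_norm[OF assms(1)])
  also have "\<dots> = cyc_area n z + (\<phi> (z 0) - \<phi> (z n))"
    unfolding sum.distrib cyc_area_def using sum_lessThan_telescope'[of "\<lambda>i. \<phi> (z i)" n] by simp
  finally show ?thesis using ctuple_period[OF assms(1)] by simp
qed

text \<open>The hyperbolic centre of mass: lifts to the hyperboloid are future timelike, hence so is
  their sum, and a translation carries it to the time axis.\<close>

lemma ctuple_centre:
  assumes z: "ctuple n z" and n: "n > 0"
  obtains c where "norm c < 1" "(\<Sum>i<n. lift_space (mob c (z i))) = 0"
proof -
  define T where "T = (\<Sum>i<n. lift_time (z i))"
  define Z where "Z = (\<Sum>i<n. lift_space (z i))"
  have "norm Z \<le> (\<Sum>i<n. norm (lift_space (z i)))" unfolding Z_def by (rule norm_sum)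
  also have "\<dots> < T" unfolding T_def
    using n by (intro sum_strict_mono norm_lift_space_less_lift_time ctuple_norm[OF z]) auto
  finally have ZT: "norm Z < T" .
  \<comment> \<open>The translation by \<open>c\<close> kills the space part when
    \<open>Z - 2 * c * T + c\<^sup>2 * cnj Z = 0\<close>. The choice \<open>c = Z / S\<close> leads
    to a quadratic for \<open>S\<close>, whose larger root puts \<open>c\<close> in the
    disc.\<close>
  define S where "S = T + sqrt (T\<^sup>2 - (norm Z)\<^sup>2)"
  have "(norm Z)\<^sup>2 < T\<^sup>2" using ZT by (intro power_strict_mono) auto
  then have root: "sqrt (T\<^sup>2 - (norm Z)\<^sup>2) > 0" "(sqrt (T\<^sup>2 - (norm Z)\<^sup>2))\<^sup>2 = T\<^sup>2 - (norm Z)\<^sup>2" by auto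
  have T: "T > 0" using ZT norm_ge_zero[of Z] by linarith
  have S: "S > T" unfolding S_def using root by simp
  have quad: "S\<^sup>2 - 2 * T * S + (norm Z)\<^sup>2 = 0"
  proof -
    have "S\<^sup>2 - 2 * T * S + (norm Z)\<^sup>2 = (sqrt (T\<^sup>2 - (norm Z)\<^sup>2))\<^sup>2 - (T\<^sup>2 - (norm Z)\<^sup>2)"
      unfolding S_def by (simp only: power2_eq_square) (simp add: algebra_simps)
    then show ?thesis using root(2) by simp
  qed
  define c where "c = Z / of_real S"
  have c: "norm c < 1" unfolding c_def norm_divide norm_of_real using ZT S T by simp
  have n1: "norm (- c) < norm (1::complex)" using c by simp
  have "(\<Sum>i<n. lift_space (mob c (z i)))
    = (\<Sum>i<n. (lift_space (z i) - 2 * c * of_real (lift_time (z i)) + c\<^sup>2 * cnj (lift_space (z i))) / of_real ((norm (1::complex))\<^sup>2 - (norm (- c))\<^sup>2))"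
    unfolding mob_daut by (rule sum.cong) (simp_all add: lift_space_daut[OF n1] ctuple_norm[OF z])
  also have "\<dots> = (Z - 2 * c * of_real T + c\<^sup>2 * cnj Z) / of_real ((norm (1::complex))\<^sup>2
    - (norm (- c))\<^sup>2)"
    unfolding sum_divide_distrib[symmetric] Z_def T_def
    by (simp only: sum.distrib sum_subtractf sum_distrib_left of_real_sum cnj_sum)
  also have "Z - 2 * c * of_real T + c\<^sup>2 * cnj Z = 0"
  proof -
    have S0: "complex_of_real S \<noteq> 0" using S T by simp
    have "(Z - 2 * c * of_real T + c\<^sup>2 * cnj Z) * of_real S * of_real S
      = Z * (of_real S * of_real S - 2 * of_real T * of_real S + Z * cnj Z)"
      unfolding c_def using S0 by (simp add: field_simps power2_eq_square)
    also have "\<dots> = Z * of_real (S\<^sup>2 - 2 * T * S + (norm Z)\<^sup>2)"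
      by (simp only: of_real_add of_real_diff complex_norm_square) (simp add: power2_eq_square)
    finally show ?thesis unfolding quad using S0 by simp
  qed
  finally show thesis using that c by simp
qed

text \<open>The automorphism taking each point to its successor permutes the tuple, hence fixes the sum of the
  lifts to the hyperboloid. Once this sum is moved over \<open>0\<close>, the automorphism is a rotation.\<close>

lemma regular_tuple_rotation:
  assumes z: "ctuple n z" and n: "n > 0" and r: "r > 0"
    and side: "\<And>i. norm (mob (z i) (z (Suc i))) = r"
    and ang: "\<And>i. mob (z (Suc i)) (z (Suc (Suc i))) = \<omega> * mob (z (Suc i)) (z i)"
  obtains c \<eta> where "norm c < 1" "norm \<eta> = 1" "\<And>i. mob c (z (Suc i)) = \<eta> * mob c (z i)"
proof -
  obtain c where c: "norm c < 1" "(\<Sum>i<n. lift_space (mob c (z i))) = 0" using ctuple_centre[OF z n] .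
  define y where "y = (\<lambda>i. mob c (z i))"
  have nc: "norm (- c) < norm (1::complex)" using c by simp
  have y: "ctuple n y" unfolding y_def mob_daut by (rule ctuple_daut[OF z nc])
  note ny = ctuple_norm[OF y]
  have ys: "norm (mob (y i) (y (Suc i))) = r" for i
    unfolding y_def mob_daut[of c] using norm_mob_daut[OF nc] ctuple_norm[OF z] side by simp
  have ya: "mob (y (Suc i)) (y (Suc (Suc i))) = \<omega> * mob (y (Suc i)) (y i)" for i
    unfolding y_def mob_daut[of c] using mob_daut_daut[OF nc] ctuple_norm[OF z] ang by simp
  \<comment> \<open>The turn that makes the automorphism with \<open>y 0\<close> going to
    \<open>y 1\<close> also take \<open>y 1\<close> to \<open>y 2\<close>.\<close>
  define u where "u = mob (y 1) (y 2) / mob (y 0) (y 1)"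
  have y01: "mob (y 0) (y 1) \<noteq> 0" using ys[of 0] r by auto
  have u: "norm u = 1" unfolding u_def norm_divide using ys[of 0] ys[of 1] r
    by (simp add: numeral_2_eq_2)
  obtain \<alpha> \<beta> where ab: "norm \<beta> < norm \<alpha>" "\<And>x. norm x < 1 \<Longrightarrow> mob (y 1) (daut \<alpha> \<beta> x) = u * mob (y 0) x"
    using daut_mob_exists[OF ny ny u] by blast
  define K where "K = daut \<alpha> \<beta>"
  have nK: "norm (K x) < 1" if "norm x < 1" for x unfolding K_def using norm_daut[OF ab(1) that] .
  \<comment> \<open>Two consecutive points are carried through the induction, because the angle
    condition determines the next point from them.\<close>
  have K: "K (y i) = y (Suc i) \<and> K (y (Suc i)) = y (Suc (Suc i))" for i
  proof (induction i)
    case 0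
    have "mob (y 1) (K (y 0)) = mob (y 1) (y 1)" unfolding K_def ab(2)[OF ny] by (simp add: mob_def)
    then have "K (y 0) = y 1" using mob_inj ny nK by blast
    moreover have "mob (y 1) (K (y 1)) = mob (y 1) (y 2)" unfolding K_def ab(2)[OF ny] u_def using y01
      by simp
    then have "K (y 1) = y 2" using mob_inj ny nK by blast
    ultimately show ?case by (simp add: numeral_2_eq_2)
  next
    case (Suc i)
    have *: "mob (K (y (Suc i))) (K x) = daut_factor \<alpha> \<beta> (y (Suc i)) * mob (y (Suc i)) x" if "norm x < 1"
      for x
      unfolding K_def by (rule mob_daut_daut[OF ab(1) ny that])
    have "mob (y (Suc (Suc i))) (K (y (Suc (Suc i)))) = mob (K (y (Suc i))) (K (y (Suc (Suc i))))"
      using Suc by simp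
    also have "\<dots> = \<omega> * (daut_factor \<alpha> \<beta> (y (Suc i)) * mob (y (Suc i)) (y i))" unfolding *[OF ny] ya
      by simp
    also have "\<dots> = \<omega> * mob (y (Suc (Suc i))) (y (Suc i))" unfolding *[OF ny, symmetric] using Suc by simp
    also have "\<dots> = mob (y (Suc (Suc i))) (y (Suc (Suc (Suc i))))" by (rule ya[symmetric])
    finally have "K (y (Suc (Suc i))) = y (Suc (Suc (Suc i)))" using mob_inj ny nK by blast
    then show ?case using Suc by simp
  qed
  define T where "T = (\<Sum>i<n. lift_time (y i))"
  have T: "T > 0" unfolding T_def using n by (intro sum_pos lift_time_pos ny) auto
  have Z: "(\<Sum>i<n. lift_space (y i)) = 0" using c(2) by (simp add: y_def)
  have D: "(norm \<alpha>)\<^sup>2 - (norm \<beta>)\<^sup>2 > 0" using ab(1) by (auto intro!: power_strict_mono)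
  \<comment> \<open>The space part of the sum is 0 before and after the permutation, so only the
    mixed term \<open>2 * \<alpha> * \<beta> * T\<close> survives in the transformation formula; as
    \<open>T > 0\<close>, it forces \<open>\<beta> = 0\<close>.\<close>
  have "0 = (\<Sum>i<n. lift_space (y (Suc i)))"
    using sum_shift_periodic[of "\<lambda>i. lift_space (y i)" n] Z ctuple_period[OF y] by simp
  also have "\<dots> = (\<Sum>i<n. lift_space (K (y i)))" using K by simp
  also have "\<dots> = (\<Sum>i<n. (\<alpha>\<^sup>2 * lift_space (y i) + 2 * \<alpha> * \<beta> * of_real (lift_time (y i))
    + \<beta>\<^sup>2 * cnj (lift_space (y i))) / of_real ((norm \<alpha>)\<^sup>2 - (norm \<beta>)\<^sup>2))"
    unfolding K_def by (simp only: lift_space_daut[OF ab(1) ny])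
  also have "\<dots> = (\<alpha>\<^sup>2 * (\<Sum>i<n. lift_space (y i)) + 2 * \<alpha> * \<beta> * of_real T
    + \<beta>\<^sup>2 * cnj (\<Sum>i<n. lift_space (y i))) / of_real ((norm \<alpha>)\<^sup>2 - (norm \<beta>)\<^sup>2)"
    unfolding sum_divide_distrib[symmetric] T_def
    by (simp only: sum.distrib sum_distrib_left of_real_sum cnj_sum)
  finally have "\<alpha> * \<beta> = 0" unfolding Z using T D by (auto simp del: of_real_diff of_real_power)
  then have b: "\<beta> = 0" "\<alpha> \<noteq> 0" using ab(1) by auto
  show thesis
  proof (rule that[OF c(1)])
    show "norm (\<alpha> / cnj \<alpha>) = 1" using b by (simp add: norm_divide)
    show "mob c (z (Suc i)) = \<alpha> / cnj \<alpha> * mob c (z i)" for i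
      using K[of i] unfolding K_def daut_def b y_def by simp
  qed
qed

text \<open>The area per side of a regular polygon: \<open>2 h\<close> is the central angle of a side and \<open>C\<close> is the hyperbolic
  cosine of half its length, so that half the interior angle is \<open>arcsin (cos h / C)\<close>.\<close>

definition side_area :: "real \<Rightarrow> real \<Rightarrow> real" where
  "side_area C h = pi - 2 * h - 2 * arcsin (cos h / C)"

text \<open>The sine rule sinh a = sinh \<rho> * sin h in the right triangle formed by the centre, a
  vertex and the midpoint of a side, squared and cleared of denominators: \<open>C\<close> is cosh
  a, and sinh \<rho> is 2 * R / (1 - R^2).\<close>

definition radius_relation :: "real \<Rightarrow> real \<Rightarrow> real \<Rightarrow> bool" where
  "radius_relation C h R \<longleftrightarrow> C\<^sup>2 * (1 - R\<^sup>2)\<^sup>2 = (1 - R\<^sup>2)\<^sup>2 + 4 * R\<^sup>2 * (sin h)\<^sup>2"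

text \<open>The angle \<open>h\<close> runs up to \<open>pi\<close>, not \<open>pi / 2\<close>,
  because a rotation by more than a half turn may also occur among the critical tuples; its sides
  have negative signed area.\<close>

lemma rotation_side:
  assumes y: "norm y < 1" and h: "0 < h" "h < pi"
  defines "C \<equiv> norm (1 - of_real ((norm y)\<^sup>2) * cis (2 * h)) / (1 - (norm y)\<^sup>2)"
  shows "C \<ge> 1" "tri_area y (cis (2 * h) * y) = side_area C h"
    "pdist y (cis (2 * h) * y) = arcosh (2 * C\<^sup>2 - 1)"
    "radius_relation C h (norm y)"
proof -
  define R where "R = (norm y)\<^sup>2"
  have R: "0 \<le> R" "R < 1" unfolding R_def using one_minus_norm_pos[OF y] by auto
  define V where "V = 1 - of_real R * cis (2 * h)"
  define W where "W = Complex ((1 - R) * cos h) (- ((1 + R) * sin h))"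
  have sh: "sin h > 0" using h by (rule sin_gt_zero)
  \<comment> \<open>Factoring out half the rotation angle leaves a number whose real and imaginary
    parts are products, from which the modulus and argument can be read off.\<close>
  have V: "V = cis h * W"
  proof -
    have c2: "cos h * cos h = 1 - sin h * sin h" using sin_cos_squared_add[of h]
      by (simp add: power2_eq_square)
    have e: "cis (2 * h) = Complex (1 - 2 * (sin h)\<^sup>2) (2 * sin h * cos h)"
      by (simp add: complex_eq_iff cos_double_sin sin_double)
    show ?thesis unfolding V_def W_def e
      by (simp add: complex_eq_iff power2_eq_square algebra_simps c2)
  qed
  have nV: "norm V = norm W" unfolding V by (simp add: norm_mult)
  have W2: "(norm W)\<^sup>2 = ((1 - R) * cos h)\<^sup>2 + ((1 + R) * sin h)\<^sup>2" unfolding W_def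
    by (simp add: cmod_power2)
  also have "\<dots> = (1 - R)\<^sup>2 + 4 * R * (sin h)\<^sup>2"
    unfolding power_mult_distrib cos_squared_eq by (simp add: algebra_simps power2_eq_square)
  finally have W2': "(norm W)\<^sup>2 = (1 - R)\<^sup>2 + 4 * R * (sin h)\<^sup>2" .
  have W0: "norm W > 0" using R sh by (auto simp: W_def complex_eq_iff)
  have C: "C = norm W / (1 - R)" unfolding C_def R_def[symmetric] V_def[symmetric] nV ..
  have C2: "C\<^sup>2 * (1 - R)\<^sup>2 = (1 - R)\<^sup>2 + 4 * R * (sin h)\<^sup>2" unfolding C power_divide W2' using R by simp
  then show "radius_relation C h (norm y)" unfolding radius_relation_def R_def .
  have "(1 - R)\<^sup>2 \<le> (norm W)\<^sup>2" unfolding W2' using R by simp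
  then have "1 - R \<le> norm W" by (rule power2_le_imp_le) simp
  then show "C \<ge> 1" unfolding C using R by simp
  define x where "x = cos h / C"
  have x: "x = (1 - R) * cos h / norm W" unfolding x_def C using R by simp
  have "\<bar>(1 - R) * cos h\<bar> \<le> norm W" using abs_Re_le_cmod[of W] by (simp add: W_def)
  then have x1: "-1 \<le> x" "x \<le> 1" unfolding x using W0 by (auto simp: abs_le_iff field_simps)
  define \<beta> where "\<beta> = arcsin x"
  have b: "- (pi / 2) \<le> \<beta>" "\<beta> \<le> pi / 2" unfolding \<beta>_def using arcsin_bounded[OF x1] by auto
  have sb: "sin \<beta> = x" unfolding \<beta>_def using x1 by simp
  have cb: "cos \<beta> = (1 + R) * sin h / norm W"
  proof -
    have "1 - x\<^sup>2 = ((1 + R) * sin h / norm W)\<^sup>2"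
    proof -
      have "1 - x\<^sup>2 = ((norm W)\<^sup>2 - ((1 - R) * cos h)\<^sup>2) / (norm W)\<^sup>2"
        unfolding x power_divide using W0 by (simp add: diff_divide_distrib)
      also have "(norm W)\<^sup>2 - ((1 - R) * cos h)\<^sup>2 = ((1 + R) * sin h)\<^sup>2" using W2 by linarith
      finally show ?thesis by (simp only: power_divide)
    qed
    moreover have "(1 + R) * sin h / norm W \<ge> 0" using R sh W0 by simp
    ultimately have "sqrt (1 - x\<^sup>2) = (1 + R) * sin h / norm W"
      by (simp only: real_sqrt_abs abs_of_nonneg)
    then show ?thesis unfolding \<beta>_def using x1 by (simp add: cos_arcsin)
  qed
  \<comment> \<open>\<open>\<beta>\<close> is half the interior angle. As its cosine is positive,
    \<open>W\<close> points in the direction \<open>\<beta> - pi / 2\<close>.\<close>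
  have "W = rcis (norm W) (\<beta> - pi / 2)"
    unfolding rcis_def using W0 by (simp add: complex_eq_iff W_def cos_diff sin_diff sb cb x)
  then have "V = rcis (norm W) (h + (\<beta> - pi / 2))" unfolding V rcis_def
    by (simp add: cis_mult[symmetric] mult_ac)
  then have A: "Arg V = h + (\<beta> - pi / 2)" using W0 b h by (intro Arg_unique') auto
  have yy: "cnj y * (cis (2 * h) * y) = of_real R * cis (2 * h)"
    using complex_norm_square[of y] unfolding R_def by (simp add: mult_ac)
  show "tri_area y (cis (2 * h) * y) = side_area C h"
    unfolding tri_area_def yy V_def[symmetric] A side_area_def x_def[symmetric] \<beta>_def by simp
  have "(norm (y - cis (2 * h) * y))\<^sup>2 = (norm (1 - cnj y * (cis (2 * h) * y)))\<^sup>2 - (1 - R) * (1 - R)"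
    unfolding norm_one_minus_cnj R_def by (simp add: norm_mult)
  also have "\<dots> = 4 * R * (sin h)\<^sup>2" unfolding yy V_def[symmetric] nV W2' by (simp add: power2_eq_square)
  finally have "coshd y (cis (2 * h) * y) = 1 + 8 * R * (sin h)\<^sup>2 / (1 - R)\<^sup>2"
    unfolding coshd_def by (simp add: norm_mult R_def power2_eq_square)
  also have "\<dots> = 2 * C\<^sup>2 - 1"
  proof -
    have "C\<^sup>2 = 1 + 4 * R * (sin h)\<^sup>2 / (1 - R)\<^sup>2" using C2 R by (simp add: field_simps)
    then show ?thesis by simp
  qed
  finally show "pdist y (cis (2 * h) * y) = arcosh (2 * C\<^sup>2 - 1)" by (simp add: pdist_def)
qed

text \<open>The subtracted arcsine is evaluated closer to 0 and slowed down by the factor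
  \<open>1 / C\<close>, so its derivative is strictly smaller.\<close>

lemma arcsin_diff_strict_mono:
  assumes C: "C > 1" and x: "0 \<le> x" "x < y" "y < 1"
  shows "arcsin x - arcsin (x / C) < arcsin y - arcsin (y / (C::real))"
proof (rule DERIV_pos_imp_increasing[OF x(2)])
  fix t assume t: "x \<le> t" "t \<le> y"
  then have t1: "0 \<le> t" "t < 1" using x by auto
  have tC: "t / C \<le> t" using mult_left_mono[of 1 C t] t1 C by (simp add: divide_le_eq)
  have tC1: "0 \<le> t / C" "t / C < 1" using tC t1 C by auto
  then have tC2: "-1 < t / C" by linarith
  have "(t / C)\<^sup>2 \<le> t\<^sup>2" using tC tC1 by (intro power_mono) auto
  then have "sqrt (1 - t\<^sup>2) \<le> sqrt (1 - (t / C)\<^sup>2)" by simp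
  moreover have "sqrt (1 - t\<^sup>2) > 0" using t1 by (simp add: abs_square_less_1)
  ultimately have "inverse (sqrt (1 - (t / C)\<^sup>2)) \<le> inverse (sqrt (1 - t\<^sup>2))"
    by (intro le_imp_inverse_le)
  moreover have "inverse (sqrt (1 - (t / C)\<^sup>2)) > 0" using tC1 by (simp add: abs_square_less_1)
  then have "inverse (sqrt (1 - (t / C)\<^sup>2)) * (1 / C) < inverse (sqrt (1 - (t / C)\<^sup>2))"
    using C by (simp add: divide_less_eq)
  ultimately have "inverse (sqrt (1 - t\<^sup>2)) - inverse (sqrt (1 - (t / C)\<^sup>2)) * (1 / C) > 0" by linarith
  moreover have "((\<lambda>x. arcsin x - arcsin (x / C)) has_real_derivative inverse (sqrt (1 - t\<^sup>2))
    - inverse (sqrt (1 - (t / C)\<^sup>2)) * (1 / C)) (at t)"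
    using t1 tC1(2) tC2 C by (auto intro!: derivative_eq_intros)
  ultimately show "\<exists>D. ((\<lambda>x. arcsin x - arcsin (x / C)) has_real_derivative D) (at t) \<and> 0 < D" by blast
qed

text \<open>Writing \<open>pi / 2 - h\<close> as an arcsine leaves \<open>cos h\<close> as the only
  way in which \<open>h\<close> enters.\<close>

lemma side_area_eq: "0 \<le> h \<Longrightarrow> h \<le> pi \<Longrightarrow> side_area C h = 2 * (arcsin (cos h) - arcsin (cos h / C))"
proof -
  assume "0 \<le> h" "h \<le> pi"
  then have "arcsin (sin (pi / 2 - h)) = pi / 2 - h" by (intro arcsin_sin) auto
  then show ?thesis unfolding side_area_def cos_sin_eq[of h] by simp
qed

text \<open>Positivity excludes \<open>C = 1\<close> and angles with \<open>cos h \<le> 0\<close>.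
  On the remaining range the area decreases strictly in \<open>h\<close> and increases strictly in
  \<open>C\<close>; \<open>side_area C h1\<close> is the intermediate value.\<close>

lemma side_area_compare:
  assumes C: "1 \<le> C" "C \<le> C1" and h: "0 < h1" "h1 \<le> h" "h < pi" "h1 < pi / 2"
    and pos: "side_area C h > 0"
  shows "side_area C h \<le> side_area C1 h1" and "side_area C h = side_area C1 h1 \<Longrightarrow> C = C1 \<and> h = h1"
proof -
  have C1: "C > 1"
  proof (rule ccontr)
    assume "\<not> C > 1"
    then have "C = 1" using C by simp
    then show False using pos h by (simp add: side_area_eq)
  qed
  have cx: "cos h > 0"
  proof (rule ccontr)
    assume "\<not> cos h > 0"
    then have "cos h \<le> cos h / C" using C1 mult_left_mono_neg[of 1 C "cos h"]
      by (simp add: pos_le_divide_eq)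
    moreover have "cos h / C \<le> 0" using \<open>\<not> cos h > 0\<close> C1 by (simp add: divide_nonpos_pos)
    ultimately have "arcsin (cos h) \<le> arcsin (cos h / C)" using cos_ge_minus_one[of h]
      by (intro arcsin_le_arcsin) auto
    then show False using pos h by (simp add: side_area_eq)
  qed
  have step1: "side_area C h \<le> side_area C h1" "h1 < h \<Longrightarrow> side_area C h < side_area C h1"
  proof -
    show *: "side_area C h < side_area C h1" if "h1 < h"
    proof -
      have "cos h < cos h1" using that h by (intro cos_monotone_0_pi) auto
      moreover have "cos h1 < 1" using h cos_monotone_0_pi[of 0 h1] by simp
      ultimately show ?thesis using arcsin_diff_strict_mono[OF C1, of "cos h" "cos h1"] cx h
        by (simp add: side_area_eq)
    qed
    show "side_area C h \<le> side_area C h1" using * h by (cases "h1 = h") auto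
  qed
  have c1: "cos h1 > 0" using h by (intro cos_gt_zero) auto
  have step2: "side_area C h1 \<le> side_area C1 h1" "C < C1 \<Longrightarrow> side_area C h1 < side_area C1 h1"
  proof -
    show *: "side_area C h1 < side_area C1 h1" if "C < C1"
    proof -
      have "cos h1 / C1 < cos h1 / C" using c1 that C1 by (intro divide_strict_left_mono) auto
      moreover have "cos h1 \<le> C" using C1 cos_le_one[of h1] by linarith
      then have "cos h1 / C \<le> 1" using C1 by (simp add: divide_le_eq)
      moreover have "cos h1 / C1 > 0" using c1 C C1 by simp
      ultimately have "arcsin (cos h1 / C1) < arcsin (cos h1 / C)" by (intro arcsin_less_arcsin) auto
      then show ?thesis by (simp add: side_area_def)
    qed
    show "side_area C h1 \<le> side_area C1 h1" using * C by (cases "C = C1") auto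
  qed
  show "side_area C h \<le> side_area C1 h1" using step1(1) step2(1) by linarith
  show "C = C1 \<and> h = h1" if "side_area C h = side_area C1 h1"
    using that step1 step2 C h by (metis less_eq_real_def not_le)
qed

subsection \<open>Existence of tuples of maximal area\<close>

lemma continuous_on_pdist:
  assumes "continuous_on S f" "continuous_on S g" "\<And>x. x \<in> S \<Longrightarrow> norm (f x) < 1"
    "\<And>x. x \<in> S \<Longrightarrow> norm (g x) < 1"
  shows "continuous_on S (\<lambda>x. pdist (f x) (g x))"
proof -
  have "continuous_on S (\<lambda>x. coshd (f x) (g x))"
    unfolding coshd_def using assms one_minus_norm_pos
      by (intro continuous_intros) (fastforce simp: abs_square_eq_1)+
  then show ?thesis unfolding pdist_def
    by (rule continuous_on_compose2[OF continuous_on_arcosh[of "{1..}", OF order.refl]])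
      (use assms coshd_ge_1 in auto)
qed

lemma continuous_on_tri_area:
  assumes "continuous_on S f" "continuous_on S g" "\<And>x. x \<in> S \<Longrightarrow> norm (f x) < 1"
    "\<And>x. x \<in> S \<Longrightarrow> norm (g x) < 1"
  shows "continuous_on S (\<lambda>x. tri_area (f x) (g x))"
proof -
  have "1 - cnj (f x) * g x \<notin> \<real>\<^sub>\<le>\<^sub>0" if "x \<in> S" for x
    using Re_one_minus_cnj_pos[OF assms(3)[OF that] assms(4)[OF that]]
      by (simp add: complex_nonpos_Reals_iff)
  then show ?thesis unfolding tri_area_def using assms(1,2) by (intro continuous_intros) auto
qed

text \<open>A step of bounded length cannot approach the ideal boundary, uniformly over starting
  points in a smaller disc.\<close>

lemma norm_bound_step:
  assumes "0 < K" "\<rho> < 1"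
  obtains \<rho>' where "\<rho>' < 1" "\<And>x y. norm x < 1 \<Longrightarrow> norm y < 1 \<Longrightarrow> norm x \<le> \<rho> \<Longrightarrow> coshd x y \<le> K \<Longrightarrow> norm y \<le> \<rho>'"
proof (rule that)
  \<comment> \<open>The value that results from
    \<open>(1 - a)\<^sup>2 \<le> K * (1 - a\<^sup>2) * (1 - b\<^sup>2)\<close> after a factor
    \<open>1 - a\<close> is cancelled and \<open>1 + a\<close> is estimated by 2.\<close>
  define e where "e = (1 - \<rho>) / (2 * K)"
  have e: "e > 0" unfolding e_def using assms by simp
  show "sqrt (1 - e) < 1" using e by simp
  fix x y :: complex assume xy: "norm x < 1" "norm y < 1" "norm x \<le> \<rho>" "coshd x y \<le> K"
  define a b where "a = norm x" "b = norm y"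
  have ab: "0 \<le> a" "a < 1" "0 \<le> b" "b < 1" "a \<le> \<rho>" unfolding a_b_def using xy by auto
  have p: "1 - a\<^sup>2 > 0" "1 - b\<^sup>2 > 0" unfolding a_b_def using xy one_minus_norm_pos by auto
  have "(a - b)\<^sup>2 \<le> (norm (x - y))\<^sup>2"
    using norm_triangle_ineq3[of x y] unfolding a_b_def abs_le_square_iff[symmetric] by simp
  moreover have "coshd x y * ((1 - a\<^sup>2) * (1 - b\<^sup>2)) = (1 - a\<^sup>2) * (1 - b\<^sup>2) + 2 * (norm (x - y))\<^sup>2"
    unfolding coshd_def a_b_def[symmetric] using p by (simp add: distrib_right)
  ultimately have "(1 - a\<^sup>2) * (1 - b\<^sup>2) + 2 * (a - b)\<^sup>2 \<le> coshd x y * ((1 - a\<^sup>2) * (1 - b\<^sup>2))" by simp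
  also have "\<dots> \<le> K * ((1 - a\<^sup>2) * (1 - b\<^sup>2))" using xy p by (intro mult_right_mono) auto
  finally have 1: "(1 - a\<^sup>2) * (1 - b\<^sup>2) + 2 * (a - b)\<^sup>2 \<le> K * ((1 - a\<^sup>2) * (1 - b\<^sup>2))" .
  \<comment> \<open>As a sum of nonnegative terms the left side is visibly at least
    \<open>(1 - a)\<^sup>2\<close>.\<close>
  have "(1 - a\<^sup>2) * (1 - b\<^sup>2) + 2 * (a - b)\<^sup>2 = (1 - a)\<^sup>2 + (1 - a)\<^sup>2 * b\<^sup>2 + 2 * a * (1 - b)\<^sup>2"
    by (simp add: power2_eq_square algebra_simps)
  then have "(1 - a)\<^sup>2 \<le> K * ((1 - a\<^sup>2) * (1 - b\<^sup>2))" using 1 ab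
    by (smt (verit) mult_nonneg_nonneg zero_le_power2)
  also have "1 - a\<^sup>2 = (1 - a) * (1 + a)" by (simp add: power2_eq_square algebra_simps)
  finally have "(1 - a) * (1 - a) \<le> (1 - a) * (K * (1 + a) * (1 - b\<^sup>2))"
    by (simp add: power2_eq_square mult_ac)
  then have "1 - a \<le> K * (1 + a) * (1 - b\<^sup>2)" using ab by (simp add: mult_le_cancel_left)
  also have "\<dots> \<le> K * 2 * (1 - b\<^sup>2)" using ab assms p by (intro mult_right_mono mult_left_mono) auto
  finally have "1 - \<rho> \<le> 2 * K * (1 - b\<^sup>2)" using ab by simp
  then have "e \<le> 1 - b\<^sup>2" unfolding e_def using assms by (simp add: divide_le_eq mult_ac)
  then have "b\<^sup>2 \<le> 1 - e" by simp
  then show "norm y \<le> sqrt (1 - e)" unfolding a_b_def by (rule real_le_rsqrt)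
qed

lemma pdist_le_cyc_perim:
  assumes "ctuple n z" "i < n" shows "pdist (z i) (z (Suc i)) \<le> cyc_perim n z"
  unfolding cyc_perim_def using assms
  by (intro member_le_sum[of i "{..<n}"
    "\<lambda>i. pdist (z i) (z (Suc i))"]) (auto intro: pdist_nonneg ctuple_norm)

lemma ctuple_mod: assumes "ctuple n z" shows "z i = z (i mod n)"
proof -
  have "z (j + k * n) = z j" for j k
  proof (induction k)
    case (Suc k)
    have "z (j + Suc k * n) = z ((j + k * n) + n)" by (simp add: algebra_simps)
    then show ?case using Suc assms unfolding ctuple_def by simp
  qed simp
  from this[of "i mod n" "i div n"] show ?thesis by (simp add: mult.commute)
qed

text \<open>The condition \<open>z 0 = 0\<close> removes the noncompact freedom of translating the
  tuple. Every side is at most \<open>L\<close>, so \<open>norm_bound_step\<close> yields bounds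
  index by index, up to one period.\<close>

lemma ctuple_bounded:
  assumes "n > 0"
  obtains \<rho> where "\<rho> < 1" "\<And>z i. ctuple n z \<Longrightarrow> z 0 = 0 \<Longrightarrow> cyc_perim n z \<le> L \<Longrightarrow> norm (z i) \<le> \<rho>"
proof -
  have "\<exists>\<rho><1. \<forall>z. ctuple n z \<and> z 0 = 0 \<and> cyc_perim n z \<le> L \<longrightarrow> (\<forall>i\<le>m. norm (z i) \<le> \<rho>)" if "m \<le> n" for m
    using that
  proof (induction m)
    case 0 then show ?case by (intro exI[of _ 0]) auto
  next
    case (Suc m)
    then obtain \<rho> where r: "\<rho> < 1"
      "\<And>z i. ctuple n z \<Longrightarrow> z 0 = 0 \<Longrightarrow> cyc_perim n z \<le> L \<Longrightarrow> i \<le> m \<Longrightarrow> norm (z i) \<le> \<rho>" by auto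
    obtain \<rho>' where r': "\<rho>' < 1"
      "\<And>x y. norm x < 1 \<Longrightarrow> norm y < 1 \<Longrightarrow> norm x \<le> \<rho> \<Longrightarrow> coshd x y \<le> cosh L \<Longrightarrow> norm y \<le> \<rho>'"
      using norm_bound_step[OF cosh_real_pos r(1)] by metis
    show ?case
    proof (intro exI[of _ "max \<rho> \<rho>'"] conjI allI impI)
      show "max \<rho> \<rho>' < 1" using r r' by simp
      fix z i assume z: "ctuple n z \<and> z 0 = 0 \<and> cyc_perim n z \<le> L" and i: "i \<le> Suc m"
      have "norm (z (Suc m)) \<le> \<rho>'"
      proof (rule r'(2))
        show "norm (z m) < 1" "norm (z (Suc m)) < 1" "norm (z m) \<le> \<rho>" using z r(2) ctuple_norm by auto
        have p: "pdist (z m) (z (Suc m)) \<le> L" using pdist_le_cyc_perim[of n z m] z Suc(2) by simp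
        have p0: "0 \<le> pdist (z m) (z (Suc m))" using z by (intro pdist_nonneg ctuple_norm) auto
        have "coshd (z m) (z (Suc m)) = cosh (pdist (z m) (z (Suc m)))"
          unfolding pdist_def using z ctuple_norm by (subst cosh_arcosh_real) (auto intro!: coshd_ge_1)
        also have "\<dots> \<le> cosh L" using p p0 by (subst cosh_real_nonneg_le_iff) auto
        finally show "coshd (z m) (z (Suc m)) \<le> cosh L" .
      qed
      then show "norm (z i) \<le> max \<rho> \<rho>'" using r(2)[of z i] z i
        by (cases "i = Suc m") (auto simp: le_max_iff_disj)
    qed
  qed
  from this[of n] obtain \<rho>
    where r: "\<rho> < 1" "\<And>z i. ctuple n z \<Longrightarrow> z 0 = 0 \<Longrightarrow> cyc_perim n z \<le> L \<Longrightarrow> i \<le> n \<Longrightarrow> norm (z i) \<le> \<rho>"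
    by auto
  show thesis
  proof (rule that[OF r(1)])
    fix z i assume z: "ctuple n z" "z 0 = 0" "cyc_perim n z \<le> L"
    show "norm (z i) \<le> \<rho>" unfolding ctuple_mod[OF z(1), of i] using r(2)[OF z] assms
      by (simp add: less_imp_le)
  qed
qed

text \<open>With an inequality as constraint, a competitor only has to shorten the perimeter to
  first order instead of keeping it fixed.\<close>

definition area_maximal :: "nat \<Rightarrow> real \<Rightarrow> (nat \<Rightarrow> complex) \<Rightarrow> bool" where
  "area_maximal n L z \<longleftrightarrow> ctuple n z \<and> cyc_perim n z \<le> L \<and>
     (\<forall>w. ctuple n w \<and> cyc_perim n w \<le> L \<longrightarrow> cyc_area n w \<le> cyc_area n z)"

text \<open>The normalised tuples form a closed subset of a product of closed discs, compact by
  Tychonoff's theorem; other competitors are normalised by an automorphism, which changes neither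
  functional.\<close>

lemma area_maximal_exists:
  assumes n: "n > 0" and L: "0 \<le> L" obtains z where "area_maximal n L z"
proof -
  obtain \<rho> where r: "\<rho> < 1" "\<And>z i. ctuple n z \<Longrightarrow> z 0 = 0 \<Longrightarrow> cyc_perim n z \<le> L \<Longrightarrow> norm (z i) \<le> \<rho>"
    using ctuple_bounded[OF n, of L] by blast
  define B where "B = PiE UNIV (\<lambda>_::nat. cball (0::complex) \<rho>)"
  define S where "S = {z. ctuple n z \<and> z 0 = 0 \<and> cyc_perim n z \<le> L}"
  have "compactin (product_topology (\<lambda>_::nat. euclidean) UNIV) B"
    unfolding B_def compactin_PiE by simp
  then have compB: "compact B" unfolding euclidean_product_topology by simp
  have nB: "norm (z i) < 1" if "z \<in> B" for z i
  proof -
    have "z i \<in> cball 0 \<rho>" using that unfolding B_def by (rule PiE_mem) simp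
    then show ?thesis using r(1) by simp
  qed
  have co: "continuous_on B (\<lambda>z. z i)" for i
    by (rule continuous_on_subset[OF continuous_on_product_coordinates subset_UNIV])
  have cp: "continuous_on B (cyc_perim n)" unfolding cyc_perim_def
    by (intro continuous_on_sum continuous_on_pdist co nB)
  have ca: "continuous_on B (cyc_area n)" unfolding cyc_area_def
    by (intro continuous_on_sum continuous_on_tri_area co nB)
  have SB: "S \<subseteq> B" unfolding S_def B_def using r(2) by auto
  \<comment> \<open>The perimeter is continuous only where all points lie in the open disc, so its
    bound enters as a preimage taken inside \<open>B\<close>.\<close>
  have Seq: "S = {z. z 0 = 0} \<inter> (\<Inter>i. {z. z (i + n) = z i}) \<inter> (B \<inter> cyc_perim n -` {..L})"
    using SB nB unfolding S_def by (auto simp: ctuple_def)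
  have cc: "closed {z :: nat \<Rightarrow> complex. z i = z j}" "closed {z :: nat \<Rightarrow> complex. z i = 0}" for i j
    by (intro closed_Collect_eq continuous_intros continuous_on_product_coordinates)+
  have "closed S" unfolding Seq
    by (intro closed_Int closed_INT ballI cc continuous_closed_preimage[OF cp] compact_imp_closed[OF compB] closed_atMost)
  then have "compact S" using compB SB compact_Int_closed[of B S] by (simp add: Int_absorb1)
  moreover have "(\<lambda>_. 0) \<in> S" unfolding S_def using L by (simp add: ctuple_def cyc_perim_def pdist_self)
  ultimately obtain z where z: "z \<in> S" "\<And>w. w \<in> S \<Longrightarrow> cyc_area n w \<le> cyc_area n z"
    using continuous_attains_sup[OF _ _ continuous_on_subset[OF ca SB]] by blast
  show thesis
  proof (rule that, unfold area_maximal_def, intro conjI allI impI)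
    show "ctuple n z" "cyc_perim n z \<le> L" using z(1) by (auto simp: S_def)
    fix w assume w: "ctuple n w \<and> cyc_perim n w \<le> L"
    have nw: "norm (- w 0) < norm (1::complex)" using ctuple_norm[of n w 0] w by simp
    have "(\<lambda>i. mob (w 0) (w i)) \<in> S"
      unfolding S_def mob_daut using ctuple_daut[OF _ nw] cyc_perim_daut[OF _ nw] w
        by (simp add: daut_def)
    then have "cyc_area n (\<lambda>i. mob (w 0) (w i)) \<le> cyc_area n z" by (rule z(2))
    then show "cyc_area n w \<le> cyc_area n z" unfolding mob_daut using cyc_area_daut[OF _ nw] w by simp
  qed
qed

section \<open>Repeated vertices\<close>

lemma pdist_ln: assumes "norm z < 1" "norm w < 1"
  shows "pdist z w = ln ((1 + norm (mob z w)) / (1 - norm (mob z w)))"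
proof -
  define r where "r = norm (mob z w)"
  have r: "0 \<le> r" "r < 1" unfolding r_def using norm_mob[OF assms] by auto
  then have r2: "1 - r\<^sup>2 > 0" by (simp add: abs_square_less_1)
  have c: "coshd z w = (1 + r\<^sup>2) / (1 - r\<^sup>2)" unfolding r_def by (rule coshd_mob[OF assms])
  have "(coshd z w)\<^sup>2 - 1 = ((1 + r\<^sup>2)\<^sup>2 - (1 - r\<^sup>2)\<^sup>2) / (1 - r\<^sup>2)\<^sup>2"
    unfolding c power_divide using r2 by (simp add: diff_divide_distrib)
  also have "(1 + r\<^sup>2)\<^sup>2 - (1 - r\<^sup>2)\<^sup>2 = (2 * r)\<^sup>2" by (simp add: power2_eq_square algebra_simps)
  finally have "sqrt ((coshd z w)\<^sup>2 - 1) = 2 * r / (1 - r\<^sup>2)"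
    using r r2 by (simp only: real_sqrt_divide real_sqrt_abs) simp
  then have "coshd z w + sqrt ((coshd z w)\<^sup>2 - 1) = (1 + r) * (1 + r) / ((1 - r) * (1 + r))"
    unfolding c by (simp add: add_divide_distrib[symmetric] power2_eq_square algebra_simps)
  also have "\<dots> = (1 + r) / (1 - r)" using r by simp
  finally show ?thesis unfolding pdist_def r_def[symmetric] using coshd_ge_1[OF assms]
    by (simp add: arcosh_real_def)
qed

text \<open>Seen from \<open>a\<close>, the point lies halfway along the Euclidean vector to
  \<open>b\<close>. It is not the hyperbolic midpoint, but it is interior to the side and all norms
  stay rational in \<open>t\<close>.\<close>

lemma intermediate_point:
  assumes a: "norm a < 1" and b: "norm b < 1" and ab: "a \<noteq> b"
  obtains m where "norm m < 1" "m \<noteq> a" "m \<noteq> b" "tri_area a m + tri_area m b = tri_area a b"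
    "pdist a m + pdist m b = pdist a b"
proof -
  define w where "w = mob a b"
  have w: "norm w < 1" "w \<noteq> 0" unfolding w_def using norm_mob[OF a b] mob_eq_0_iff[OF a b] ab by auto
  define m where "m = daut 1 a (w / 2)"
  have n1: "norm a < norm (1::complex)" using a by simp
  have w2: "norm (w / 2) < 1" using w by (simp add: norm_divide)
  have m: "norm m < 1" unfolding m_def by (rule norm_daut[OF n1 w2])
  have mm: "mob a m = w / 2" unfolding m_def mob_daut using daut_inverse[OF n1 w2] by simp
  have na: "norm (- a) < norm (1::complex)" using a by simp
  have mb: "norm (mob m b) = norm (mob (w / 2) w)"
    using norm_mob_daut[OF na m b] unfolding mob_daut[of a, symmetric] mm w_def[symmetric] by simp
  define t where "t = norm w"
  have t: "0 < t" "t < 1" unfolding t_def using w by auto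
  have "mob (w / 2) w = (w / 2) / of_real (1 - t\<^sup>2 / 2)"
  proof -
    have "cnj (w / 2) * w = of_real (t\<^sup>2 / 2)"
      unfolding t_def of_real_divide complex_norm_square by simp
    then show ?thesis unfolding mob_def by simp
  qed
  then have "norm (mob (w / 2) w) = (t / 2) / (1 - t\<^sup>2 / 2)"
  proof -
    have "1 - t\<^sup>2 / 2 > 0" using t abs_square_less_1[of t] by simp
    then show ?thesis using \<open>mob (w / 2) w = _\<close>
      by (simp only: norm_divide norm_of_real t_def abs_of_pos) simp
  qed
  then have s: "norm (mob m b) = t / (2 - t\<^sup>2)" "norm (mob a m) = t / 2" "norm (mob a b) = t"
    unfolding mb mm by (simp_all add: field_simps norm_divide t_def w_def)
  have t2: "2 - t\<^sup>2 > 1" using t abs_square_less_1[of t] by simp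
  show thesis
  proof (rule that[OF m])
    show "m \<noteq> a" using mm w by (auto simp: mob_def)
    show "m \<noteq> b" using mm w by (auto simp: w_def)
    have "orient a m b = 0" unfolding orient_def mm w_def[symmetric] by simp
    then show "tri_area a m + tri_area m b = tri_area a b" by (rule tri_area_collinear[OF a m b])
    have lt: "t / (2 - t\<^sup>2) < 1" using t t2 by (simp add: divide_less_eq)
    \<comment> \<open>Distances are logarithms of \<open>(1 + r) / (1 - r)\<close>, so their
      additivity is multiplicativity of these quotients.\<close>
    have "(1 + t / 2) / (1 - t / 2) * ((1 + t / (2 - t\<^sup>2)) / (1 - t / (2 - t\<^sup>2))) = (1 + t) / (1 - t)"
    proof -
      have g: "(1 + t / u) / (1 - t / u) = (u + t) / (u - t)" if "u > 0" for u
      proof -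
        have "1 + t / u = (u + t) / u" "1 - t / u = (u - t) / u"
          using that by (simp_all add: add_divide_distrib diff_divide_distrib)
        then show ?thesis using that by simp
      qed
      have "(1 + t / 2) / (1 - t / 2) = (2 + t) / (2 - t)" by (rule g) simp
      moreover have "(1 + t / (2 - t\<^sup>2)) / (1 - t / (2 - t\<^sup>2)) = (2 - t\<^sup>2 + t) / (2 - t\<^sup>2 - t)"
        by (rule g) (use t2 in simp)
      moreover have "2 - t\<^sup>2 + t = (2 - t) * (1 + t)" "2 - t\<^sup>2 - t = (2 + t) * (1 - t)"
        by (simp_all add: algebra_simps power2_eq_square)
      ultimately show ?thesis using t by simp
    qed
    then show "pdist a m + pdist m b = pdist a b"
      unfolding pdist_ln[OF a m] pdist_ln[OF m b] pdist_ln[OF a b] s using t t2 lt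
      by (subst ln_mult_pos[symmetric]) (auto intro!: divide_pos_pos add_pos_pos)
  qed
qed

definition zero_sides :: "nat \<Rightarrow> (nat \<Rightarrow> complex) \<Rightarrow> nat" where
  "zero_sides n z = (\<Sum>i<n. of_bool (z i = z (Suc i)))"

lemma sum_shift_add:
  fixes f :: "nat \<Rightarrow> 'a::cancel_comm_monoid_add"
  assumes "\<And>i. f (i + n) = f i" shows "(\<Sum>i<n. f (i + j)) = (\<Sum>i<n. f i)"
proof (induction j)
  case (Suc j)
  have "f j + (\<Sum>i<n. f (i + Suc j)) = (\<Sum>i<Suc n. f (i + j))"
    unfolding sum.lessThan_Suc_shift by simp
  also have "\<dots> = f j + (\<Sum>i<n. f i)" using Suc assms[of j] by (simp add: add.commute)
  finally show ?case by simp
qed simp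

lemma ctuple_shift:
  assumes "ctuple n z"
  shows "ctuple n (\<lambda>i. z (i + j))" "cyc_area n (\<lambda>i. z (i + j)) = cyc_area n z"
    "cyc_perim n (\<lambda>i. z (i + j)) = cyc_perim n z" "zero_sides n (\<lambda>i. z (i + j)) = zero_sides n z"
proof -
  have p: "z (i + n) = z i" "z (Suc (i + n)) = z (Suc i)" for i
    using assms unfolding ctuple_def by (auto simp flip: add_Suc)
  show "ctuple n (\<lambda>i. z (i + j))" using assms p(1)[of "i + j" for i] unfolding ctuple_def
    by (simp add: ac_simps)
  show "cyc_area n (\<lambda>i. z (i + j)) = cyc_area n z" unfolding cyc_area_def
    using sum_shift_add[of "\<lambda>i. tri_area (z i) (z (Suc i))" n j] p by simp
  show "cyc_perim n (\<lambda>i. z (i + j)) = cyc_perim n z" unfolding cyc_perim_def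
    using sum_shift_add[of "\<lambda>i. pdist (z i) (z (Suc i))" n j] p by simp
  show "zero_sides n (\<lambda>i. z (i + j)) = zero_sides n z" unfolding zero_sides_def
    using sum_shift_add[of "\<lambda>i. of_bool (z i = z (Suc i)) :: nat" n j] p by simp
qed

lemma remove_zero_side:
  assumes z: "ctuple n z" and n: "n \<ge> 3" and eq: "z 0 = z 1" and ne: "z 1 \<noteq> z 2"
  obtains w where "ctuple n w" "cyc_area n w = cyc_area n z" "cyc_perim n w = cyc_perim n z"
    "zero_sides n w < zero_sides n z"
proof -
  obtain m where m: "norm m < 1" "m \<noteq> z 1" "m \<noteq> z 2"
    "tri_area (z 1) m + tri_area m (z 2) = tri_area (z 1) (z 2)"
     "pdist (z 1) m + pdist m (z 2) = pdist (z 1) (z 2)"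
    using intermediate_point[OF _ _ ne] ctuple_norm[OF z] by blast
  \<comment> \<open>Changing every index congruent to 1 keeps the sequence periodic.\<close>
  define w where "w = (\<lambda>i. if i mod n = 1 then m else z i)"
  have w: "ctuple n w" using z m(1) unfolding ctuple_def w_def by simp
  have e: "{..<n} = insert 0 (insert 1 {2..<n})" using n by auto
  have split: "(\<Sum>i<n. f i) = f 0 + (f 1 + (\<Sum>i\<in>{2..<n}. f i))" for f :: "nat \<Rightarrow> 'b::comm_monoid_add"
    unfolding e by simp
  have w012: "w 0 = z 1" "w (Suc 0) = m" "w 1 = m" "w (Suc 1) = z 2" unfolding w_def using n eq
    by (auto simp: numeral_2_eq_2)
  have w2: "w i = z i" "w (Suc i) = z (Suc i)" if "i \<in> {2..<n}" for i
    unfolding w_def using that by (auto simp: mod_Suc)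
  have z1: "z (Suc 0) = z 1" "z (Suc 1) = z 2" by (simp_all add: numeral_2_eq_2)
  have t0: "tri_area (z 1) (z 1) = 0" using ctuple_norm[OF z] by (intro tri_area_eq_0) auto
  show thesis
  proof (rule that[OF w])
    show "cyc_area n w = cyc_area n z" unfolding cyc_area_def split w012 z1 eq t0 using m(4) w2 by simp
    show "cyc_perim n w = cyc_perim n z" unfolding cyc_perim_def split w012 z1 eq pdist_self
      using m(5) w2 by simp
    show "zero_sides n w < zero_sides n z" unfolding zero_sides_def split w012 z1 eq using m(2,3) w2 ne
      by simp
  qed
qed

text \<open>A repeated vertex is moved into the interior of an adjacent side, which changes neither area nor
  perimeter; hence a maximizer with the fewest zero sides has none.\<close>

lemma area_maximal_no_zero_sides:
  assumes n: "n \<ge> 3" and L: "0 \<le> L" and pos: "ctuple n w" "cyc_perim n w \<le> L" "cyc_area n w > 0"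
  obtains z where "area_maximal n L z" "\<And>i. z i \<noteq> z (Suc i)"
proof -
  obtain z0 where "area_maximal n L z0" using area_maximal_exists[of n L] n L by auto
  then obtain z where z: "area_maximal n L z"
    and min: "\<And>y. area_maximal n L y \<Longrightarrow> zero_sides n z \<le> zero_sides n y"
    using ex_has_least_nat[of "area_maximal n L" z0 "zero_sides n"] by blast
  have ct: "ctuple n z" using z by (simp add: area_maximal_def)
  have az: "cyc_area n z > 0" using z pos unfolding area_maximal_def by force
  have "z i \<noteq> z (Suc i)" for i
  proof
    assume i: "z i = z (Suc i)"
    show False
    proof (cases "\<exists>j. z j = z (Suc j) \<and> z (Suc j) \<noteq> z (Suc (Suc j))")
      case True
      then obtain j where j: "z j = z (Suc j)" "z (Suc j) \<noteq> z (Suc (Suc j))" by blast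
      note sh = ctuple_shift[OF ct, of j]
      obtain y where y: "ctuple n y" "cyc_area n y = cyc_area n (\<lambda>i. z (i + j))"
        "cyc_perim n y = cyc_perim n (\<lambda>i. z (i + j))"
         "zero_sides n y < zero_sides n (\<lambda>i. z (i + j))"
        using remove_zero_side[OF sh(1) n] j by (auto simp: numeral_2_eq_2)
      have "area_maximal n L y" using z y unfolding sh area_maximal_def by simp
      then show False using min[of y] y(4) unfolding sh by simp
    next
      case False
      \<comment> \<open>If no zero side is followed by a nonzero one, equality spreads from
        \<open>i\<close> onwards; the tuple is constant and has area 0.\<close>
      then have const: "z (i + k) = z i \<and> z (Suc (i + k)) = z i" for k
        by (induction k) (use i in auto)
      have "cyc_area n (\<lambda>k. z (k + i)) = 0"
        unfolding cyc_area_def using const[unfolded add.commute[of i]] ctuple_norm[OF ct]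
        by (intro sum.neutral) (auto intro!: tri_area_eq_0)
      then show False using az ctuple_shift[OF ct, of i] by simp
    qed
  qed
  then show thesis using that z by blast
qed

subsection \<open>First variation\<close>

text \<open>The Euclidean gradient of \<open>tri_area z w\<close> in its first argument;
  antisymmetry gives the second one with a minus sign.\<close>

definition area_grad :: "complex \<Rightarrow> complex \<Rightarrow> complex" where
  "area_grad z w = - 2 * \<i> * w / (1 - cnj z * w)"

text \<open>The Euclidean gradient of \<open>pdist z w\<close> in its first argument: it points away
  from \<open>w\<close> and its length is the conformal factor
  \<open>2 / (1 - (norm z)\<^sup>2)\<close>.\<close>

definition dist_grad :: "complex \<Rightarrow> complex \<Rightarrow> complex" where
  "dist_grad z w = - 2 * mob z w / of_real (norm (mob z w) * (1 - (norm z)\<^sup>2))"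

text \<open>Each gradient is affine in \<open>mob z w\<close> with the same constant term, which the
  difference removes. The area gradient at a vertex thus depends only on the neighbours as seen from
  it.\<close>

lemma area_grad_diff:
  assumes "norm z < 1" "norm p < 1" "norm q < 1"
  shows "area_grad z q - area_grad z p = - 2 * \<i> * (mob z q - mob z p) / of_real (1 - (norm z)\<^sup>2)"
proof -
  have k: "complex_of_real (1 - (norm z)\<^sup>2) \<noteq> 0" using one_minus_norm_pos[OF assms(1)]
    by (simp del: of_real_diff)
  have *: "w / (1 - cnj z * w) = (mob z w + z) / of_real (1 - (norm z)\<^sup>2)" if "norm w < 1" for w
  proof -
    have n: "1 - cnj z * w \<noteq> 0" using one_minus_cnj_nz[OF assms(1) that] .
    have e: "complex_of_real (1 - (norm z)\<^sup>2) = 1 - z * cnj z"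
      by (simp only: of_real_diff of_real_1 complex_norm_square)
    have "(mob z w + z) * (1 - cnj z * w) = w * (1 - z * cnj z)"
      unfolding mob_def using n by (simp add: distrib_right) (simp add: algebra_simps)
    then show ?thesis using n k unfolding e by (simp add: frac_eq_eq mult.commute)
  qed
  have "area_grad z q - area_grad z p = - 2 * \<i> * (q / (1 - cnj z * q) - p / (1 - cnj z * p))"
    unfolding area_grad_def by (simp add: right_diff_distrib)
  also have "\<dots> = - 2 * \<i> * (mob z q - mob z p) / of_real (1 - (norm z)\<^sup>2)"
    unfolding *[OF assms(2)] *[OF assms(3)]
      by (simp add: diff_divide_distrib[symmetric] del: of_real_diff)
  finally show ?thesis .
qed

lemma tri_area_deriv:
  assumes "norm z < 1" "norm w < 1"
  shows "((\<lambda>t. tri_area (z + of_real t * v) (w + of_real t * u)) has_real_derivative v \<bullet> area_grad z w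
    - u \<bullet> area_grad w z) (at 0)"
proof -
  define f where "f = (\<lambda>t::real. 1 - cnj (z + of_real t * v) * (w + of_real t * u))"
  define D where "D = - (cnj v * w + cnj z * u)"
  have f0: "f 0 = 1 - cnj z * w" by (simp add: f_def)
  have pos: "Re (f 0) > 0" unfolding f0 by (rule Re_one_minus_cnj_pos[OF assms])
  have Re: "((\<lambda>t. Re (f t)) has_real_derivative Re D) (at 0)"
    unfolding f_def D_def by (auto intro!: derivative_eq_intros simp: algebra_simps)
  have Im: "((\<lambda>t. Im (f t)) has_real_derivative Im D) (at 0)"
    unfolding f_def D_def by (auto intro!: derivative_eq_intros simp: algebra_simps)
  have "((\<lambda>t. - 2 * arctan (Im (f t) / Re (f t))) has_real_derivative
     - 2 * (inverse (1 + (Im (f 0) / Re (f 0))\<^sup>2) * ((Im D * Re (f 0) - Im (f 0) * Re D) / (Re (f 0) * Re (f 0))))) (at 0)"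
    using pos by (intro DERIV_cmult DERIV_arctan[THEN DERIV_chain2] DERIV_divide Re Im) auto
  also have "inverse (1 + (Im (f 0) / Re (f 0))\<^sup>2) * ((Im D * Re (f 0)
    - Im (f 0) * Re D) / (Re (f 0) * Re (f 0))) = Im (D / f 0)"
  proof -
    have "inverse (1 + (Im (f 0) / Re (f 0))\<^sup>2) = (Re (f 0))\<^sup>2 / ((Re (f 0))\<^sup>2 + (Im (f 0))\<^sup>2)"
    proof -
      have "1 + (Im (f 0) / Re (f 0))\<^sup>2 = ((Re (f 0))\<^sup>2 + (Im (f 0))\<^sup>2) / (Re (f 0))\<^sup>2"
        using pos by (simp add: power_divide add_divide_distrib)
      then show ?thesis by simp
    qed
    then show ?thesis unfolding Im_divide using pos by (simp add: power2_eq_square mult.commute)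
  qed
  also have "- 2 * Im (D / f 0) = v \<bullet> area_grad z w - u \<bullet> area_grad w z"
  proof -
    have "- 2 * Im (D / f 0)
      = 2 * Im (cnj v * w / (1 - cnj z * w)) + 2 * Im (cnj z * u / (1 - cnj z * w))"
      unfolding D_def f0 by (simp add: add_divide_distrib diff_divide_distrib)
    also have "2 * Im (cnj v * w / (1 - cnj z * w)) = v \<bullet> area_grad z w"
    proof -
      define X where "X = cnj v * w / (1 - cnj z * w)"
      have "cnj v * area_grad z w = - 2 * \<i> * X" by (simp add: area_grad_def X_def)
      moreover have "v \<bullet> area_grad z w = Re (cnj v * area_grad z w)" by (simp add: inner_complex_def)
      ultimately show ?thesis unfolding X_def[symmetric] by simp
    qed
    also have "2 * Im (cnj z * u / (1 - cnj z * w)) = - (u \<bullet> area_grad w z)"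
    proof -
      define X where "X = cnj u * z / (1 - cnj w * z)"
      have "cnj z * u / (1 - cnj z * w) = cnj X" unfolding X_def by (simp add: mult.commute)
      moreover have "cnj u * area_grad w z = - 2 * \<i> * X" by (simp add: area_grad_def X_def)
      moreover have "u \<bullet> area_grad w z = Re (cnj u * area_grad w z)" by (simp add: inner_complex_def)
      ultimately show ?thesis by simp
    qed
    finally show ?thesis by simp
  qed
  finally have der: "((\<lambda>t. - 2 * arctan (Im (f t) / Re (f t))) has_real_derivative v \<bullet> area_grad z w
    - u \<bullet> area_grad w z) (at 0)" .
  \<comment> \<open>The arctangent formula for the argument is valid only in the right half plane;
    continuity keeps \<open>f t\<close> there for small \<open>t\<close>.\<close>
  have "isCont (\<lambda>t. Re (f t)) 0" using Re by (rule DERIV_isCont)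
  then have "((\<lambda>t. Re (f t)) \<longlongrightarrow> Re (f 0)) (nhds 0)"
    using tendsto_at_iff_tendsto_nhds[of "\<lambda>t. Re (f t)" 0] by (simp add: isCont_def)
  then have "eventually (\<lambda>t. Re (f t) > 0) (nhds 0)" using pos by (rule order_tendstoD(1))
  then have "eventually (\<lambda>t. tri_area (z + of_real t * v) (w + of_real t * u)
    = - 2 * arctan (Im (f t) / Re (f t))) (nhds 0)"
    by eventually_elim (simp add: tri_area_def f_def arg_conv_arctan)
  then show ?thesis using der by (simp add: DERIV_cong_ev)
qed

text \<open>The shape in which differentiating \<open>coshd\<close> produces the gradient.\<close>

lemma dist_grad_formula:
  assumes "norm z < 1" "norm w < 1" "z \<noteq> w"
  shows "dist_grad z w = (2 * (z - w) + of_real (2 * (norm (z - w))\<^sup>2 / (1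
    - (norm z)\<^sup>2)) * z) / of_real (norm (z - w) * norm (1 - cnj z * w))"
proof -
  define M where "M = 1 - cnj z * w"
  have M: "M \<noteq> 0" unfolding M_def using one_minus_cnj_nz[OF assms(1,2)] .
  define A where "A = 1 - (norm z)\<^sup>2"
  have A: "A > 0" unfolding A_def using one_minus_norm_pos[OF assms(1)] .
  have Ac: "complex_of_real A = 1 - z * cnj z" unfolding A_def
    by (simp only: of_real_diff of_real_1 complex_norm_square)
  define d where "d = norm (z - w)"
  have d: "d > 0" unfolding d_def using assms(3) by simp
  have m: "mob z w = - (z - w) / M" "norm (mob z w) = d / norm M"
    unfolding mob_def M_def d_def by (simp_all add: norm_divide norm_minus_commute)
  have "dist_grad z w = 2 * (z - w) * of_real (norm M) / (M * of_real (d * A))"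
    unfolding dist_grad_def m(2) A_def[symmetric] unfolding m(1) using M d A by (simp add: field_simps)
  also have "\<dots> = 2 * ((z - w) * cnj M) / of_real (d * A * norm M)"
  proof -
    have "2 * (z - w) * of_real (norm M) * of_real (d * A * norm M)
      = 2 * ((z - w) * cnj M) * (M * of_real (d * A))"
      using complex_norm_square[of M] by (simp add: power2_eq_square mult_ac)
    then show ?thesis using M A d by (simp add: frac_eq_eq)
  qed
  also have "(z - w) * cnj M = (z - w) * of_real A + of_real (d\<^sup>2) * z"
    unfolding Ac M_def d_def complex_norm_square by (simp add: algebra_simps)
  finally have "dist_grad z w = 2 * ((z - w) * of_real A + of_real (d\<^sup>2) * z) / of_real (d * A * norm M)"
    by (simp add: mult.assoc)
  also have "\<dots> = (2 * (z - w) + of_real (2 * d\<^sup>2 / A) * z) / of_real (d * norm M)"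
    using A d M by (simp add: field_simps)
  finally show ?thesis unfolding d_def A_def M_def .
qed

text \<open>The chain rule for \<open>arcosh\<close> requires \<open>coshd\<close> to exceed 1; this
  is where repeated neighbours must be excluded.\<close>

lemma pdist_deriv:
  assumes z: "norm z < 1" and w: "norm w < 1" and ne: "z \<noteq> w"
  shows "((\<lambda>t. pdist (z + of_real t * v) (w + of_real t * u)) has_real_derivative v \<bullet> dist_grad z w
    + u \<bullet> dist_grad w z) (at 0)"
proof -
  define A B d M where "A = 1 - (norm z)\<^sup>2" "B = 1 - (norm w)\<^sup>2" "d = norm (z - w)"
    "M = norm (1 - cnj z * w)"
  have p: "A > 0" "B > 0" "d > 0" unfolding A_B_d_M_def using assms one_minus_norm_pos by auto
  have M2: "M\<^sup>2 = d\<^sup>2 + A * B" unfolding A_B_d_M_def by (rule norm_one_minus_cnj)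
  have "M\<^sup>2 > 0" unfolding M2 using p by (simp add: add_pos_pos)
  then have "M \<noteq> 0" by auto
  then have M: "M > 0" unfolding A_B_d_M_def by simp
  define a b e where "a = 2 * (z \<bullet> v)" "b = 2 * (w \<bullet> u)" "e = 2 * ((z - w) \<bullet> (v - u))"
  have nA: "1 - (norm (z + of_real t * v))\<^sup>2 = A - t * a - t\<^sup>2 * (v \<bullet> v)" for t
    unfolding A_B_d_M_def a_b_e_def power2_norm_eq_inner
      by (simp add: inner_complex_def algebra_simps power2_eq_square)
  have nB: "1 - (norm (w + of_real t * u))\<^sup>2 = B - t * b - t\<^sup>2 * (u \<bullet> u)" for t
    unfolding A_B_d_M_def a_b_e_def power2_norm_eq_inner
      by (simp add: inner_complex_def algebra_simps power2_eq_square)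
  have nN: "(norm ((z + of_real t * v) - (w + of_real t * u)))\<^sup>2
    = d\<^sup>2 + t * e + t\<^sup>2 * ((v - u) \<bullet> (v - u))" for t
    unfolding A_B_d_M_def a_b_e_def power2_norm_eq_inner
      by (simp add: inner_complex_def algebra_simps power2_eq_square)
  define E where "E = (\<lambda>t. coshd (z + of_real t * v) (w + of_real t * u))"
  have E: "E = (\<lambda>t. 1 + 2 * (d\<^sup>2 + t * e + t\<^sup>2 * ((v - u) \<bullet> (v - u))) / ((A - t * a - t\<^sup>2 * (v \<bullet> v)) * (B
    - t * b - t\<^sup>2 * (u \<bullet> u))))"
    unfolding E_def coshd_def nA nB nN ..
  have E0: "E 0 = 1 + 2 * d\<^sup>2 / (A * B)" unfolding E by simp
  have E': "(E has_real_derivative (2 * e * (A * B) - 2 * d\<^sup>2 * (- a * B - b * A)) / (A * B)\<^sup>2) (at 0)"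
    unfolding E using p by (auto intro!: derivative_eq_intros simp: power2_eq_square algebra_simps)
  have E1: "E 0 > 1" unfolding E0 using p by simp
  have s: "sqrt ((E 0)\<^sup>2 - 1) = 2 * d * M / (A * B)"
  proof -
    have "(E 0)\<^sup>2 - 1 = 4 * d\<^sup>2 * (d\<^sup>2 + A * B) / (A * B)\<^sup>2" unfolding E0 using p
      by (simp add: field_simps power2_eq_square)
    also have "\<dots> = (2 * d * M / (A * B))\<^sup>2" unfolding M2[symmetric]
      by (simp add: power_divide power_mult_distrib)
    finally show ?thesis using p M by (simp only: real_sqrt_abs) simp
  qed
  have "((\<lambda>t. arcosh (E t)) has_real_derivative 1 / sqrt ((E 0)\<^sup>2 - 1) * ((2 * e * (A * B)
    - 2 * d\<^sup>2 * (- a * B - b * A)) / (A * B)\<^sup>2)) (at 0)"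
    by (rule DERIV_chain2[OF arcosh_real_has_field_derivative[OF E1] E'])
  also have "1 / sqrt ((E 0)\<^sup>2 - 1) * ((2 * e * (A * B) - 2 * d\<^sup>2 * (- a * B - b * A)) / (A * B)\<^sup>2)
    = (e + d\<^sup>2 * (a / A + b / B)) / (d * M)"
    unfolding s using p M by (simp add: field_simps power2_eq_square)
  also have "\<dots> = v \<bullet> dist_grad z w + u \<bullet> dist_grad w z"
  proof -
    have sym: "norm (w - z) = d" "norm (1 - cnj w * z) = M"
      unfolding A_B_d_M_def using complex_mod_cnj[of "1 - cnj z * w"]
        by (simp_all add: norm_minus_commute mult.commute)
    have g: "v' \<bullet> ((2 * x + of_real k * y) / of_real l) = (2 * (v' \<bullet> x) + k * (v' \<bullet> y)) / l"
      for v' x y :: complex and k l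
      by (simp add: inner_complex_def algebra_simps add_divide_distrib diff_divide_distrib)
    have "v \<bullet> dist_grad z w + u \<bullet> dist_grad w z
      = (2 * (v \<bullet> (z - w)) + 2 * d\<^sup>2 / A * (v \<bullet> z)) / (d * M) + (2 * (u \<bullet> (w - z)) + 2 * d\<^sup>2 / B * (u \<bullet> w)) / (d * M)"
      unfolding dist_grad_formula[OF z w ne] dist_grad_formula[OF w z ne[symmetric]] sym g A_B_d_M_def ..
    also have "\<dots> = ((2 * (v \<bullet> (z - w)) + 2 * (u \<bullet> (w - z))) + d\<^sup>2 * (2 * (v \<bullet> z) / A
      + 2 * (u \<bullet> w) / B)) / (d * M)"
      by (simp add: add_divide_distrib distrib_left mult_ac)
    also have "2 * (v \<bullet> (z - w)) + 2 * (u \<bullet> (w - z)) = e" unfolding a_b_e_def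
      by (simp add: inner_complex_def algebra_simps)
    finally show ?thesis unfolding a_b_e_def by (simp add: inner_commute)
  qed
  finally show ?thesis unfolding pdist_def E_def .
qed

text \<open>Euclidean scaling from 0 lengthens every side to first order. Hence the perimeter has no
  critical points, which is the constraint qualification for the multiplier rule.\<close>

lemma dist_grad_scaling:
  assumes "norm z < 1" "norm w < 1" "z \<noteq> w" shows "z \<bullet> dist_grad z w + w \<bullet> dist_grad w z > 0"
proof -
  define A B d M where "A = 1 - (norm z)\<^sup>2" "B = 1 - (norm w)\<^sup>2" "d = norm (z - w)"
    "M = norm (1 - cnj z * w)"
  have p: "A > 0" "B > 0" "d > 0" "M > 0" unfolding A_B_d_M_def
    using assms one_minus_norm_pos one_minus_cnj_nz by auto
  have sym: "norm (w - z) = d" "norm (1 - cnj w * z) = M"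
    unfolding A_B_d_M_def using complex_mod_cnj[of "1 - cnj z * w"]
      by (simp_all add: norm_minus_commute mult.commute)
  have g: "v' \<bullet> ((2 * x + of_real k * y) / of_real l) = (2 * (v' \<bullet> x) + k * (v' \<bullet> y)) / l"
    for v' x y :: complex and k l
    by (simp add: inner_complex_def algebra_simps add_divide_distrib diff_divide_distrib)
  have "z \<bullet> dist_grad z w + w \<bullet> dist_grad w z
    = (2 * (z \<bullet> (z - w)) + 2 * d\<^sup>2 / A * (z \<bullet> z)) / (d * M) + (2 * (w \<bullet> (w - z)) + 2 * d\<^sup>2 / B * (w \<bullet> w)) / (d * M)"
    unfolding dist_grad_formula[OF assms] dist_grad_formula[OF assms(2,1) assms(3)[symmetric]] sym g A_B_d_M_def ..
  also have "\<dots> = ((2 * (z \<bullet> (z - w)) + 2 * (w \<bullet> (w - z))) + (2 * d\<^sup>2 / A * (z \<bullet> z)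
    + 2 * d\<^sup>2 / B * (w \<bullet> w))) / (d * M)"
    by (simp add: add_divide_distrib)
  also have "2 * (z \<bullet> (z - w)) + 2 * (w \<bullet> (w - z)) = 2 * d\<^sup>2"
    unfolding A_B_d_M_def power2_norm_eq_inner by (simp add: inner_complex_def algebra_simps)
  also have "(2 * d\<^sup>2 + (2 * d\<^sup>2 / A * (z \<bullet> z) + 2 * d\<^sup>2 / B * (w \<bullet> w))) / (d * M) > 0"
    using p by (intro divide_pos_pos add_pos_nonneg add_nonneg_nonneg) auto
  finally show ?thesis .
qed

text \<open>Otherwise a short move along \<open>v\<close> would shorten the perimeter and enlarge
  the area at once.\<close>

lemma area_maximal_variation:
  assumes max: "area_maximal n L z" and ns: "\<And>i. z i \<noteq> z (Suc i)" and v: "\<And>i. v (i + n) = v i"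
    and dP: "(\<Sum>i<n. v i \<bullet> dist_grad (z i) (z (Suc i)) + v (Suc i) \<bullet> dist_grad (z (Suc i)) (z i)) < 0"
  shows "(\<Sum>i<n. v i \<bullet> area_grad (z i) (z (Suc i)) - v (Suc i) \<bullet> area_grad (z (Suc i)) (z i)) \<le> 0"
proof (rule ccontr)
  assume dF: "\<not> ?thesis"
  define Z where "Z = (\<lambda>t::real. \<lambda>i. z i + of_real t * v i)"
  have ct: "ctuple n z" using max by (simp add: area_maximal_def)
  note nz = ctuple_norm[OF ct]
  have Z0: "Z 0 = z" by (simp add: Z_def)
  have "((\<lambda>t. cyc_perim n (Z t)) has_real_derivative (\<Sum>i<n. v i \<bullet> dist_grad (z i) (z (Suc i))
    + v (Suc i) \<bullet> dist_grad (z (Suc i)) (z i))) (at 0)"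
    unfolding cyc_perim_def Z_def by (intro DERIV_sum pdist_deriv nz ns)
  from DERIV_neg_dec_right[OF this dP] obtain d1
    where d1: "d1 > 0" "\<And>t. 0 < t \<Longrightarrow> t < d1 \<Longrightarrow> cyc_perim n (Z t) < cyc_perim n z"
    by (auto simp: Z0)
  have "((\<lambda>t. cyc_area n (Z t)) has_real_derivative (\<Sum>i<n. v i \<bullet> area_grad (z i) (z (Suc i))
    - v (Suc i) \<bullet> area_grad (z (Suc i)) (z i))) (at 0)"
    unfolding cyc_area_def Z_def by (intro DERIV_sum tri_area_deriv nz)
  from DERIV_pos_inc_right[OF this] dF obtain d2
    where d2: "d2 > 0" "\<And>t. 0 < t \<Longrightarrow> t < d2 \<Longrightarrow> cyc_area n z < cyc_area n (Z t)"
    by (auto simp: Z0 not_le)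
  \<comment> \<open>By periodicity finitely many indices decide whether the varied tuple stays in
    the disc.\<close>
  have "eventually (\<lambda>t. \<forall>i\<in>{..n}. norm (Z t i) < 1) (at_right 0)"
  proof (rule eventually_ball_finite, simp, intro ballI)
    fix i
    have "((\<lambda>t. norm (z i + of_real t * v i)) \<longlongrightarrow> norm (z i + of_real 0 * v i)) (at_right 0)"
      by (intro tendsto_intros)
    then show "eventually (\<lambda>t. norm (Z t i) < 1) (at_right 0)"
      unfolding Z_def using nz[of i] by (intro order_tendstoD(2)) auto
  qed
  then obtain d3 where d3: "d3 > 0" "\<And>t i. 0 < t \<Longrightarrow> t < d3 \<Longrightarrow> i \<le> n \<Longrightarrow> norm (Z t i) < 1"
    unfolding eventually_at_right[OF zero_less_one] by auto
  define t where "t = min d1 (min d2 d3) / 2"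
  have t: "0 < t" "t < d1" "t < d2" "t < d3" unfolding t_def using d1(1) d2(1) d3(1) by auto
  have per: "Z t (i + n) = Z t i" for i unfolding Z_def using ct v by (simp add: ctuple_def)
  have perk: "Z t (i + k * n) = Z t i" for i k
  proof (induction k)
    case (Suc k)
    have "Z t (i + Suc k * n) = Z t ((i + k * n) + n)" by (simp add: algebra_simps)
    then show ?case using Suc per by simp
  qed simp
  have "ctuple n (Z t)" unfolding ctuple_def
  proof (intro conjI allI)
    fix i show "Z t (i + n) = Z t i" by (rule per)
    show "norm (Z t i) < 1"
    proof (cases "n = 0")
      case False
      then have "norm (Z t (i mod n)) < 1" using t by (intro d3(2)) (auto simp: less_imp_le)
      then show ?thesis using perk[of "i mod n" "i div n"] by (simp add: mult.commute)
    next
      case True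
      then show ?thesis using dP by simp
    qed
  qed
  then have "cyc_area n (Z t) \<le> cyc_area n z"
    using max d1(2)[OF t(1,2)] unfolding area_maximal_def by force
  then show False using d2(2)[OF t(1,3)] by simp
qed

text \<open>The area gradient \<open>A\<close> must be a multiple of the perimeter gradient
  \<open>B\<close>: its component orthogonal to \<open>B\<close>, tilted slightly against
  \<open>B\<close>, would be an improving direction.\<close>

lemma area_maximal_lagrange:
  assumes max: "area_maximal n L z" and n: "n > 0" and ns: "\<And>i. z i \<noteq> z (Suc i)"
  obtains \<mu> :: real where "\<And>i. area_grad (z (Suc i)) (z (Suc (Suc i))) - area_grad (z (Suc i)) (z i) =
     \<mu> *\<^sub>R (dist_grad (z (Suc i)) (z (Suc (Suc i))) + dist_grad (z (Suc i)) (z i))"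
proof -
  define A where "A = (\<lambda>i. area_grad (z (Suc i)) (z (Suc (Suc i))) - area_grad (z (Suc i)) (z i))"
  define B where "B = (\<lambda>i. dist_grad (z (Suc i)) (z (Suc (Suc i))) + dist_grad (z (Suc i)) (z i))"
  have ct: "ctuple n z" using max by (simp add: area_maximal_def)
  have per: "z (i + n) = z i" "z (Suc (i + n)) = z (Suc i)" "z (Suc (Suc (i + n))) = z (Suc (Suc i))"
    for i
    using ct unfolding ctuple_def by (auto simp flip: add_Suc)
  have perAB: "A (i + n) = A i" "B (i + n) = B i" for i unfolding A_def B_def using per by auto
  have regroupP: "(\<Sum>i<n. v i \<bullet> dist_grad (z i) (z (Suc i)) + v (Suc i) \<bullet> dist_grad (z (Suc i)) (z i))
    = (\<Sum>i<n. v (Suc i) \<bullet> B i)"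
    and regroupA: "(\<Sum>i<n. v i \<bullet> area_grad (z i) (z (Suc i)) - v (Suc i) \<bullet> area_grad (z (Suc i)) (z i))
      = (\<Sum>i<n. v (Suc i) \<bullet> A i)"
    if v: "\<And>i. v (i + n) = v i" for v
  proof -
    have 0: "v n = v 0" "z n = z 0" "z (Suc n) = z (Suc 0)" using v[of 0] per[of 0] by auto
    show "(\<Sum>i<n. v i \<bullet> dist_grad (z i) (z (Suc i)) + v (Suc i) \<bullet> dist_grad (z (Suc i)) (z i))
      = (\<Sum>i<n. v (Suc i) \<bullet> B i)"
      unfolding B_def inner_add_right sum.distrib
      using sum_shift_periodic[of "\<lambda>i. v i \<bullet> dist_grad (z i) (z (Suc i))" n] 0 by simp
    show "(\<Sum>i<n. v i \<bullet> area_grad (z i) (z (Suc i)) - v (Suc i) \<bullet> area_grad (z (Suc i)) (z i))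
      = (\<Sum>i<n. v (Suc i) \<bullet> A i)"
      unfolding A_def inner_diff_right sum_subtractf
      using sum_shift_periodic[of "\<lambda>i. v i \<bullet> area_grad (z i) (z (Suc i))" n] 0 by simp
  qed
  have var: "(\<Sum>i<n. w i \<bullet> A i) \<le> 0" if w: "\<And>i. w (i + n) = w i" and "(\<Sum>i<n. w i \<bullet> B i) < 0" for w
  proof -
    \<comment> \<open>\<open>A i\<close> and \<open>B i\<close> belong to the vertex
      \<open>Suc i\<close>, so the field is shifted by one index; the added period keeps the
      subtraction harmless at 0.\<close>
    define v where "v = (\<lambda>i. w (i + n - 1))"
    have v: "v (i + n) = v i" for i
    proof -
      have "i + n + n - 1 = (i + n - 1) + n" using n by simp
      then show ?thesis unfolding v_def using w[of "i + n - 1"] by simp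
    qed
    have vS: "v (Suc i) = w i" for i unfolding v_def using w by simp
    show ?thesis
      using area_maximal_variation[where z = z and v = v, OF max ns v] that(2)
        unfolding regroupP[of v, OF v] regroupA[of v, OF v] unfolding vS by simp
  qed
  define N where "N = (\<Sum>i<n. B i \<bullet> B i)"
  have N: "N > 0"
  proof (rule ccontr)
    assume "\<not> N > 0"
    moreover have "N \<ge> 0" unfolding N_def by (intro sum_nonneg) auto
    ultimately have "N = 0" by simp
    then have B0: "B i = 0" if "i < n" for i
      unfolding N_def using that by (subst (asm) sum_nonneg_eq_0_iff) auto
    have "(\<Sum>i<n. z i \<bullet> dist_grad (z i) (z (Suc i)) + z (Suc i) \<bullet> dist_grad (z (Suc i)) (z i)) > 0"
      using n by (intro sum_pos dist_grad_scaling ctuple_norm[OF ct] ns) auto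
    then show False unfolding regroupP[of z, OF per(1)] using B0 by simp
  qed
  \<comment> \<open>The coefficient of the orthogonal projection of \<open>A\<close> to
    \<open>B\<close>. The direction \<open>w - \<epsilon> B\<close> strictly shortens the perimeter,
    and letting \<open>\<epsilon>\<close> tend to 0 shows that the squared length of
    \<open>w\<close> is at most 0.\<close>
  define l where "l = (\<Sum>i<n. B i \<bullet> A i) / N"
  define w where "w = (\<lambda>i. A i - l *\<^sub>R B i)"
  have wB: "(\<Sum>i<n. w i \<bullet> B i) = 0"
    unfolding w_def inner_diff_left sum_subtractf inner_scaleR_left sum_distrib_left[symmetric] N_def[symmetric]
    using N by (simp add: l_def inner_commute)
  have le: "(\<Sum>i<n. w i \<bullet> A i) \<le> \<epsilon> * (\<Sum>i<n. B i \<bullet> A i)" if e: "\<epsilon> > 0" for \<epsilon>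
  proof -
    have "(\<Sum>i<n. (w i - \<epsilon> *\<^sub>R B i) \<bullet> B i) = - \<epsilon> * N"
      unfolding inner_diff_left sum_subtractf wB inner_scaleR_left sum_distrib_left[symmetric] N_def
        by simp
    then have "(\<Sum>i<n. (w i - \<epsilon> *\<^sub>R B i) \<bullet> B i) < 0" using e N by simp
    then have "(\<Sum>i<n. (w i - \<epsilon> *\<^sub>R B i) \<bullet> A i) \<le> 0" by (intro var) (simp_all add: w_def perAB)
    then show ?thesis unfolding inner_diff_left sum_subtractf inner_scaleR_left sum_distrib_left[symmetric] by simp
  qed
  have "(\<Sum>i<n. w i \<bullet> A i) \<le> 0"
  proof (rule field_le_epsilon)
    fix e :: real assume e: "e > 0"
    define S where "S = (\<Sum>i<n. B i \<bullet> A i)"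
    have "(\<Sum>i<n. w i \<bullet> A i) \<le> e / (\<bar>S\<bar> + 1) * S" unfolding S_def[symmetric]
      using e le[of "e / (\<bar>S\<bar> + 1)"] S_def by simp
    also have "\<dots> \<le> e / (\<bar>S\<bar> + 1) * (\<bar>S\<bar> + 1)" using e by (intro mult_left_mono) auto
    finally show "(\<Sum>i<n. w i \<bullet> A i) \<le> 0 + e" by simp
  qed
  moreover have "(\<Sum>i<n. w i \<bullet> A i) = (\<Sum>i<n. w i \<bullet> w i)"
  proof -
    have "(\<Sum>i<n. w i \<bullet> w i) = (\<Sum>i<n. w i \<bullet> A i) - l * (\<Sum>i<n. w i \<bullet> B i)"
      by (subst (2) w_def) (simp add: inner_diff_right sum_subtractf sum_distrib_left)
    then show ?thesis unfolding wB by simp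
  qed
  moreover have "(\<Sum>i<n. w i \<bullet> w i) \<ge> 0" by (intro sum_nonneg) auto
  ultimately have "(\<Sum>i<n. w i \<bullet> w i) = 0" by linarith
  then have w0: "w i = 0" if "i < n" for i using that by (subst (asm) sum_nonneg_eq_0_iff) auto
  have wper: "w (j + k * n) = w j" for j k
  proof (induction k)
    case (Suc k)
    have "w (j + Suc k * n) = w ((j + k * n) + n)" by (simp add: algebra_simps)
    then show ?case using Suc perAB unfolding w_def by simp
  qed simp
  have "w i = 0" for i using wper[of "i mod n" "i div n"] w0[of "i mod n"] n by (simp add: mult.commute)
  then show thesis using that[of l] unfolding w_def A_def B_def by simp
qed

text \<open>With \<open>z\<close> moved to the origin and \<open>a\<close>, \<open>b\<close> the images of its neighbours, the multiplier equation reads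
  \<open>\<i> (b - a) = \<mu> (a / norm a + b / norm b)\<close>; comparing norms after separating \<open>a\<close> and \<open>b\<close> gives
  \<open>norm a = norm b\<close>.\<close>

lemma balanced_vertex:
  assumes z: "norm z < 1" "norm p < 1" "norm q < 1" "z \<noteq> p" "z \<noteq> q"
    and eq: "area_grad z q - area_grad z p = \<mu> *\<^sub>R (dist_grad z q + dist_grad z p)"
  shows "norm (mob z q) = norm (mob z p)"
    "mob z q * (\<i> * of_real (norm (mob z p)) - of_real \<mu>)
      = mob z p * (\<i> * of_real (norm (mob z p)) + of_real \<mu>)"
proof -
  define a b where "a = mob z p" "b = mob z q"
  have nz: "a \<noteq> 0" "b \<noteq> 0" unfolding a_b_def using z mob_eq_0_iff by auto
  define s where "s = 1 - (norm z)\<^sup>2"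
  have s: "s > 0" unfolding s_def using one_minus_norm_pos[OF z(1)] .
  have "- 2 * \<i> * (b - a) / of_real s
    = \<mu> *\<^sub>R (- 2 * b / of_real (norm b * s) + - 2 * a / of_real (norm a * s))"
    using eq unfolding area_grad_diff[OF z(1-3)] dist_grad_def a_b_def s_def .
  then have "(- 2 / of_real s) * (\<i> * (b - a))
    = (- 2 / of_real s) * (of_real \<mu> * (b / of_real (norm b) + a / of_real (norm a)))"
    using s nz by (simp add: scaleR_conv_of_real field_simps)
  then have *: "\<i> * (b - a) = of_real \<mu> * (b / of_real (norm b) + a / of_real (norm a))"
    using s by (subst (asm) mult_cancel_left) auto
  then have e: "b * (\<i> - of_real (\<mu> / norm b)) = a * (\<i> + of_real (\<mu> / norm a))"
    by (simp add: algebra_simps)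
  have n: "(norm (x * (\<i> + of_real (l / norm x))))\<^sup>2 = (norm x)\<^sup>2 + l\<^sup>2" if "x \<noteq> 0" for x l
  proof -
    have "(norm (\<i> + of_real k))\<^sup>2 = 1 + k\<^sup>2" for k by (simp add: cmod_power2)
    then have "(norm (x * (\<i> + of_real (l / norm x))))\<^sup>2 = (norm x)\<^sup>2 * (1 + (l / norm x)\<^sup>2)"
      by (simp only: norm_mult power_mult_distrib)
    then show ?thesis using that by (simp add: distrib_left power_divide)
  qed
  have "(norm b)\<^sup>2 + (- \<mu>)\<^sup>2 = (norm a)\<^sup>2 + \<mu>\<^sup>2"
    using n[OF nz(2), of "- \<mu>"] n[OF nz(1), of \<mu>] e by simp
  then have ab: "norm b = norm a" by (simp add: power2_eq_iff_nonneg)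
  then show "norm (mob z q) = norm (mob z p)" unfolding a_b_def .
  have "b * (\<i> - of_real (\<mu> / norm a)) * of_real (norm a)
    = a * (\<i> + of_real (\<mu> / norm a)) * of_real (norm a)" using e ab by simp
  then have "b * (\<i> * of_real (norm a) - of_real \<mu>) = a * (\<i> * of_real (norm a) + of_real \<mu>)"
    using nz by (simp add: algebra_simps)
  then show "mob z q * (\<i> * of_real (norm (mob z p)) - of_real \<mu>)
    = mob z p * (\<i> * of_real (norm (mob z p)) + of_real \<mu>)"
    unfolding a_b_def .
qed

text \<open>Equality of adjacent sides propagates around the tuple. The ratio
  \<open>\<omega>\<close> depends only on the common side \<open>r\<close> and the multiplier
  \<open>l\<close>, so the turning is the same at all vertices.\<close>

theorem area_maximal_rotation:
  assumes max: "area_maximal n L z" and n: "n > 0" and ns: "\<And>i. z i \<noteq> z (Suc i)"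
  obtains c \<eta> where "norm c < 1" "norm \<eta> = 1" "\<And>i. mob c (z (Suc i)) = \<eta> * mob c (z i)"
proof -
  have ct: "ctuple n z" using max by (simp add: area_maximal_def)
  note nz = ctuple_norm[OF ct]
  obtain l where l: "\<And>i. area_grad (z (Suc i)) (z (Suc (Suc i))) - area_grad (z (Suc i)) (z i) =
     l *\<^sub>R (dist_grad (z (Suc i)) (z (Suc (Suc i))) + dist_grad (z (Suc i)) (z i))"
    using area_maximal_lagrange[OF max n ns] by blast
  note bal = balanced_vertex[OF nz nz nz ns[symmetric] ns l]
  define r where "r = norm (mob (z 0) (z (Suc 0)))"
  have side: "norm (mob (z i) (z (Suc i))) = r" for i
  proof (induction i)
    case (Suc i)
    then show ?case using bal(1)[of i] norm_mob_commute[OF nz nz, of "Suc i" i] by simp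
  qed (simp add: r_def)
  have r: "r > 0" unfolding r_def using mob_eq_0_iff[OF nz nz] ns[of 0] by simp
  define \<omega> where "\<omega> = (\<i> * of_real r + of_real l) / (\<i> * of_real r - of_real l)"
  have d: "\<i> * of_real r - of_real l \<noteq> 0" using r by (simp add: complex_eq_iff)
  have "mob (z (Suc i)) (z (Suc (Suc i))) = \<omega> * mob (z (Suc i)) (z i)" for i
  proof -
    have "norm (mob (z (Suc i)) (z i)) = r" using side[of i] norm_mob_commute[OF nz nz, of "Suc i" i]
      by simp
    then have "mob (z (Suc i)) (z (Suc (Suc i))) * (\<i> * of_real r - of_real l)
      = mob (z (Suc i)) (z i) * (\<i> * of_real r + of_real l)"
      using bal(2)[of i] by simp
    then show ?thesis unfolding \<omega>_def using d by (simp add: field_simps)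
  qed
  from regular_tuple_rotation[OF ct n r side this] show thesis using that by blast
qed

section \<open>Rotation orbits and the sharp bound\<close>

lemma rotation_tuple_values:
  assumes z: "ctuple n z" and c: "norm c < 1" and h: "0 < h" "h < pi"
    and rot: "\<And>i. mob c (z (Suc i)) = cis (2 * h) * mob c (z i)"
  obtains C where "C \<ge> 1" "cyc_area n z = real n * side_area C h"
    "cyc_perim n z = real n * arcosh (2 * C\<^sup>2 - 1)"
    "radius_relation C h (norm (mob c (z 0)))"
proof -
  define y where "y = (\<lambda>i. mob c (z i))"
  have nc: "norm (- c) < norm (1::complex)" using c by simp
  have y: "ctuple n y" unfolding y_def mob_daut by (rule ctuple_daut[OF z nc])
  have yS: "y (Suc i) = cis (2 * h) * y i" for i unfolding y_def by (rule rot)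
  have ny: "norm (y i) = norm (y 0)" for i by (induction i) (simp_all add: yS norm_mult)
  define C where "C = norm (1 - of_real ((norm (y 0))\<^sup>2) * cis (2 * h)) / (1 - (norm (y 0))\<^sup>2)"
  have side: "C \<ge> 1" "tri_area (y i) (cis (2 * h) * y i) = side_area C h"
    "pdist (y i) (cis (2 * h) * y i) = arcosh (2 * C\<^sup>2 - 1)"
    "radius_relation C h (norm (y 0))" for i
    using rotation_side[OF ctuple_norm[OF y, of i] h] unfolding ny[of i] C_def by auto
  have "cyc_area n z = cyc_area n y" unfolding y_def mob_daut by (rule cyc_area_daut[OF z nc, symmetric])
  also have "\<dots> = real n * side_area C h" unfolding cyc_area_def yS side(2) by simp
  finally have 1: "cyc_area n z = real n * side_area C h" .
  have "cyc_perim n z = cyc_perim n y" unfolding y_def mob_daut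
    by (rule cyc_perim_daut[OF z nc, symmetric])
  also have "\<dots> = real n * arcosh (2 * C\<^sup>2 - 1)" unfolding cyc_perim_def yS side(3) by simp
  finally have 2: "cyc_perim n z = real n * arcosh (2 * C\<^sup>2 - 1)" .
  from that[OF side(1) 1 2] side(4) show thesis unfolding y_def by blast
qed

text \<open>Closing up after \<open>n\<close> steps makes \<open>\<eta>\<close> a root of unity, and
  \<open>k = 0\<close> would give zero sides. Star-shaped and multiply traversed orbits remain
  possible here.\<close>

lemma rotation_root:
  assumes z: "ctuple n z" and c: "norm c < 1" and n: "n > 0" and ne: "z 0 \<noteq> z (Suc 0)"
    and rot: "\<And>i. mob c (z (Suc i)) = \<eta> * mob c (z i)"
  obtains k where "0 < k" "k < n" "\<eta> = cis (2 * (pi * real k / real n))"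
proof -
  have y: "mob c (z i) = \<eta> ^ i * mob c (z 0)" for i by (induction i) (simp_all add: rot)
  have y0: "mob c (z 0) \<noteq> 0"
  proof
    assume "mob c (z 0) = 0"
    then have "mob c (z (Suc 0)) = mob c (z 0)" using rot[of 0] by simp
    then show False using mob_inj[OF c] ctuple_norm[OF z] ne by metis
  qed
  have "\<eta> ^ n = 1" using y[of n] ctuple_period[OF z] y0 by simp
  then obtain k where k: "k < n" "\<eta> = cis (2 * pi * real k / real n)"
    using Complex.bij_betw_roots_unity[OF n] unfolding bij_betw_def by auto
  have "k \<noteq> 0"
  proof
    assume "k = 0"
    then have "mob c (z (Suc 0)) = mob c (z 0)" using rot[of 0] k by simp
    then show False using mob_inj[OF c] ctuple_norm[OF z] ne by metis
  qed
  then show thesis using that[of k] k by (simp add: mult.assoc)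
qed

lemma le_if_arcosh_le: assumes "1 \<le> C" "1 \<le> C1" "arcosh (2 * C\<^sup>2 - 1) \<le> arcosh (2 * C1\<^sup>2 - (1::real))"
  shows "C \<le> C1"
proof -
  have "1 \<le> C\<^sup>2" "1 \<le> C1\<^sup>2" using assms(1,2) by (simp_all add: one_le_power)
  then have "2 * C\<^sup>2 - 1 \<le> 2 * C1\<^sup>2 - 1"
    using assms(3) arcosh_less_iff_real[of "2 * C1\<^sup>2 - 1" "2 * C\<^sup>2 - 1"] by linarith
  then have "C\<^sup>2 \<le> C1\<^sup>2" by simp
  then show ?thesis by (rule power2_le_imp_le) (use assms(2) in linarith)
qed

text \<open>Half the central angle is \<open>pi * k / n\<close>, which is at least
  \<open>pi / n\<close>, and the perimeter constraint bounds the side length;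
  \<open>side_area_compare\<close> then decides both the bound and its equality case.\<close>

lemma maximal_rotation_bound:
  assumes max: "area_maximal n L z" and n: "n \<ge> 3" and ns: "\<And>i. z i \<noteq> z (Suc i)"
    and C1: "1 \<le> C1" and L: "L = real n * arcosh (2 * C1\<^sup>2 - 1)" and pos: "cyc_area n z > 0"
  shows "cyc_area n z \<le> real n * side_area C1 (pi / real n)"
    and "cyc_area n z = real n * side_area C1 (pi / real n) \<Longrightarrow> \<exists>c. norm c < 1 \<and>
      (\<forall>i. mob c (z (Suc i)) = cis (2 * (pi / real n)) * mob c (z i)) \<and>
      radius_relation C1 (pi / real n) (norm (mob c (z 0)))"
proof -
  have ct: "ctuple n z" and pz: "cyc_perim n z \<le> L" using max by (auto simp: area_maximal_def)
  have n0: "n > 0" using n by simp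
  obtain c \<eta> where c: "norm c < 1" "\<And>i. mob c (z (Suc i)) = \<eta> * mob c (z i)"
    by (rule area_maximal_rotation[OF max n0 ns]) (rule that)
  obtain k where k: "0 < k" "k < n" "\<eta> = cis (2 * (pi * real k / real n))"
    by (rule rotation_root[OF ct c(1) n0 ns c(2)]) (rule that)
  define h where "h = pi * real k / real n"
  have "pi * real k < pi * real n" "pi * 1 \<le> pi * real k" using k pi_gt_zero by simp_all
  then have h: "0 < h" "h < pi" "pi / real n \<le> h" using n k unfolding h_def
    by (simp_all add: divide_less_eq divide_right_mono)
  have rot: "mob c (z (Suc i)) = cis (2 * h) * mob c (z i)" for i using c(2)[of i]
    by (simp only: k(3) h_def)
  obtain C where C: "C \<ge> 1" "cyc_area n z = real n * side_area C h"
    "cyc_perim n z = real n * arcosh (2 * C\<^sup>2 - 1)"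
    "radius_relation C h (norm (mob c (z 0)))"
    by (rule rotation_tuple_values[OF ct c(1) h(1,2) rot]) (rule that)
  have "real n * arcosh (2 * C\<^sup>2 - 1) \<le> real n * arcosh (2 * C1\<^sup>2 - 1)"
    using pz unfolding C(3) L .
  then have "arcosh (2 * C\<^sup>2 - 1) \<le> arcosh (2 * C1\<^sup>2 - 1)" by (rule mult_left_le_imp_le)
    (use n in linarith)
  then have "C \<le> C1" by (rule le_if_arcosh_le[OF C(1) C1])
  moreover have "side_area C h > 0" using pos n unfolding C(2) by (simp add: zero_less_mult_iff)
  moreover have "0 < pi / real n" using n by simp
  moreover have "pi / real n < pi / 2" by (rule divide_strict_left_mono) (use n in auto)
  ultimately have cmp: "side_area C h \<le> side_area C1 (pi / real n)"
    "side_area C h = side_area C1 (pi / real n) \<Longrightarrow> C = C1 \<and> h = pi / real n"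
    using side_area_compare[of C C1 "pi / real n" h] C(1) h by auto
  show "cyc_area n z \<le> real n * side_area C1 (pi / real n)" unfolding C(2) using cmp(1)
    by (intro mult_left_mono) auto
  assume "cyc_area n z = real n * side_area C1 (pi / real n)"
  then have "C = C1 \<and> h = pi / real n" using cmp(2) n unfolding C(2) by simp
  then have Ch: "C = C1" "h = pi / real n" by auto
  show "\<exists>c. norm c < 1 \<and>
      (\<forall>i. mob c (z (Suc i)) = cis (2 * (pi / real n)) * mob c (z i)) \<and>
      radius_relation C1 (pi / real n) (norm (mob c (z 0)))"
    using c C(4) unfolding k(3) h_def[symmetric] Ch by blast
qed

text \<open>The relation determines \<open>R / (1 - R\<^sup>2)\<close>, and this is injective on [0,
  1).\<close>

lemma circumradius_unique:
  assumes "0 \<le> R" "R < 1" "0 \<le> R'" "R' < 1" "sin h \<noteq> 0"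
    and "radius_relation C h R" "radius_relation C h R'"
  shows "R = R'"
proof -
  have p: "1 - R\<^sup>2 > 0" "1 - R'\<^sup>2 > 0" using assms by (simp_all add: abs_square_less_1)
  have e: "(C\<^sup>2 - 1) * (1 - R\<^sup>2)\<^sup>2 = 4 * R\<^sup>2 * (sin h)\<^sup>2"
    "(C\<^sup>2 - 1) * (1 - R'\<^sup>2)\<^sup>2 = 4 * R'\<^sup>2 * (sin h)\<^sup>2"
    using assms(6,7) unfolding radius_relation_def by (simp_all add: left_diff_distrib)
  have "4 * R\<^sup>2 * (sin h)\<^sup>2 * (1 - R'\<^sup>2)\<^sup>2 = 4 * R'\<^sup>2 * (sin h)\<^sup>2 * (1 - R\<^sup>2)\<^sup>2"
    unfolding e[symmetric] by (simp only: mult_ac)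
  then have "4 * (sin h)\<^sup>2 * (R * (1 - R'\<^sup>2))\<^sup>2 = 4 * (sin h)\<^sup>2 * (R' * (1 - R\<^sup>2))\<^sup>2"
    by (simp only: power_mult_distrib mult_ac)
  then have "(R * (1 - R'\<^sup>2))\<^sup>2 = (R' * (1 - R\<^sup>2))\<^sup>2"
    by (rule mult_left_cancel[THEN iffD1, rotated]) (use assms(5) in simp)
  then have "R * (1 - R'\<^sup>2) = R' * (1 - R\<^sup>2)"
    by (rule power2_eq_imp_eq) (use assms p in \<open>auto intro: mult_nonneg_nonneg\<close>)
  then have "(R - R') * (1 + R * R') = 0" by (simp add: algebra_simps power2_eq_square)
  moreover have "R * R' \<ge> 0" using assms by (intro mult_nonneg_nonneg)
  then have "1 + R * R' \<noteq> 0" by linarith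
  ultimately show ?thesis by simp
qed

text \<open>The bound for some maximizer \<open>m\<close> equals the area of \<open>w\<close>, so
  \<open>w\<close> is a maximizer too and the equality case applies to \<open>w\<close>
  itself.\<close>

theorem isoperimetric_tuple:
  assumes n: "n \<ge> 3" and z: "ctuple n z" and c: "norm c < 1"
    and rot: "\<And>i. mob c (z (Suc i)) = cis (2 * (pi / real n)) * mob c (z i)"
    and pos: "cyc_area n z > 0"
    and w: "ctuple n w" and ns: "\<And>i. w i \<noteq> w (Suc i)" and area: "cyc_area n w = cyc_area n z"
    and perim: "cyc_perim n w \<le> cyc_perim n z"
  obtains e where "norm e < 1" "\<And>i. mob e (w (Suc i)) = cis (2 * (pi / real n)) * mob e (w i)"
    "norm (mob e (w 0)) = norm (mob c (z 0))"
proof -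
  have h: "0 < pi / real n" "pi / real n < pi" using n by (simp_all add: divide_less_eq)
  obtain C1 where C1: "C1 \<ge> 1" "cyc_area n z = real n * side_area C1 (pi / real n)"
    "cyc_perim n z = real n * arcosh (2 * C1\<^sup>2 - 1)"
    "radius_relation C1 (pi / real n) (norm (mob c (z 0)))"
    by (rule rotation_tuple_values[OF z c h rot]) (rule that)
  define L where "L = real n * arcosh (2 * C1\<^sup>2 - 1)"
  have L: "0 \<le> L" unfolding L_def using C1(1) by (simp add: one_le_power)
  have wL: "cyc_perim n w \<le> L" using perim C1(3) L_def by simp
  obtain m where m: "area_maximal n L m" "\<And>i. m i \<noteq> m (Suc i)"
    using area_maximal_no_zero_sides[OF n L w wL] area pos by metis
  have "cyc_area n w \<le> cyc_area n m" using m(1) w wL by (auto simp: area_maximal_def)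
  then have mpos: "cyc_area n m > 0" using area pos by simp
  have "cyc_area n m \<le> cyc_area n w"
    using maximal_rotation_bound(1)[OF m(1) n m(2) C1(1) L_def mpos] area C1(2) by simp
  then have wmax: "area_maximal n L w"
    using m(1) w wL unfolding area_maximal_def by (meson order_trans)
  obtain e where e: "norm e < 1" "\<And>i. mob e (w (Suc i)) = cis (2 * (pi / real n)) * mob e (w i)"
    "radius_relation C1 (pi / real n) (norm (mob e (w 0)))"
    using maximal_rotation_bound(2)[OF wmax n ns C1(1) L_def] area pos C1(2) by metis
  have "sin (pi / real n) \<noteq> 0" using sin_gt_zero[OF h] by simp
  then have "norm (mob e (w 0)) = norm (mob c (z 0))"
    using norm_mob[OF e(1) ctuple_norm[OF w]] norm_mob[OF c ctuple_norm[OF z]]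
    by (intro circumradius_unique[OF _ _ _ _ _ e(3) C1(4)]) auto
  then show thesis using that e by blast
qed

subsection \<open>Regular polygons\<close>

lemma coshd_mob_mob:
  assumes "norm z < 1" "norm x < 1" "norm y < 1" shows "coshd (mob z x) (mob z y) = coshd x y"
proof -
  have n: "norm (- z) < norm (1::complex)" using assms by simp
  show ?thesis
    unfolding coshd_eq_iff_norm_mob[OF norm_mob[OF assms(1,2)] norm_mob[OF assms(1,3)] assms(2,3)]
    unfolding mob_daut[of z] by (rule norm_mob_daut[OF n assms(2,3)])
qed

text \<open>The hyperbolic law of cosines with vertex 0: the quotients are cosh and, together with
  the norms, sinh of the distances from 0.\<close>

lemma coshd_cosine:
  assumes "norm u < 1" "norm w < 1"
  shows "(1 + (norm u)\<^sup>2) / (1 - (norm u)\<^sup>2) * ((1 + (norm w)\<^sup>2) / (1 - (norm w)\<^sup>2)) - coshd u w =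
    2 / (1 - (norm u)\<^sup>2) * (2 / (1 - (norm w)\<^sup>2)) * Re (cnj u * w)"
proof -
  define A B I where "A = (norm u)\<^sup>2" "B = (norm w)\<^sup>2" "I = Re (cnj u * w)"
  have p: "1 - A > 0" "1 - B > 0" unfolding A_B_I_def using assms one_minus_norm_pos by auto
  have n: "(norm (u - w))\<^sup>2 = A + B - 2 * I"
    unfolding A_B_I_def cmod_power2 by (simp add: algebra_simps power2_eq_square)
  have "(1 + A) / (1 - A) * ((1 + B) / (1 - B)) - (1 + 2 * (A + B - 2 * I) / ((1 - A) * (1 - B)))
      = ((1 + A) * (1 + B) - ((1 - A) * (1 - B) + 2 * (A + B - 2 * I))) / ((1 - A) * (1 - B))"
  proof -
    define D where "D = (1 - A) * (1 - B)"
    have D: "D > 0" unfolding D_def using p by simp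
    have "(1 + A) / (1 - A) * ((1 + B) / (1 - B)) = (1 + A) * (1 + B) / D" unfolding D_def by simp
    moreover have "1 + 2 * (A + B - 2 * I) / D = (D + 2 * (A + B - 2 * I)) / D"
      using D by (simp add: add_divide_distrib)
    ultimately show ?thesis unfolding D_def[symmetric] by (simp only: diff_divide_distrib)
  qed
  also have "(1 + A) * (1 + B) - ((1 - A) * (1 - B) + 2 * (A + B - 2 * I)) = 4 * I"
    by (simp add: algebra_simps)
  finally show ?thesis unfolding coshd_def n A_B_I_def[symmetric] by simp
qed

text \<open>The metric is expressed by the Lorentz products \<open>1 - p \<bullet> q\<close>, which
  are distances up to normalisation.\<close>

lemma hmetric_formula:
  assumes "norm p < 1"
  shows "hmetric p (q - p) (r - p) =
    ((1 - p \<bullet> q) * (1 - p \<bullet> r) - (1 - (norm p)\<^sup>2) * (1 - q \<bullet> r)) / (1 - (norm p)\<^sup>2)\<^sup>2"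
proof -
  define S where "S = 1 - (norm p)\<^sup>2"
  have S: "S > 0" unfolding S_def using one_minus_norm_pos[OF assms] .
  have pp: "p \<bullet> p = 1 - S" unfolding S_def power2_norm_eq_inner by simp
  have "hmetric p (q - p) (r - p) = (S * ((q - p) \<bullet> (r - p)) + (p \<bullet> (q - p)) * (p \<bullet> (r - p))) / S\<^sup>2"
    unfolding hmetric_def S_def[symmetric] using S by (simp add: add_divide_distrib power2_eq_square)
  also have "S * ((q - p) \<bullet> (r - p)) + (p \<bullet> (q - p)) * (p \<bullet> (r - p))
    = (1 - p \<bullet> q) * (1 - p \<bullet> r) - S * (1 - q \<bullet> r)"
    by (simp add: inner_diff_left inner_diff_right pp inner_commute[of q p] algebra_simps)
  finally show ?thesis unfolding S_def .
qed

text \<open>By the law of cosines at \<open>z\<close>, each value of \<open>hmetric\<close> is an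
  inner product of vectors \<open>mob z a\<close>, \<open>mob z b\<close> with positive weights, and
  the weights cancel in the quotient. Angles of the projective model thus become Euclidean angles in
  the conformal one.\<close>

lemma hangle_klein:
  assumes z: "norm z < 1" and x: "norm x < 1" and y: "norm y < 1" and ne: "x \<noteq> z" "y \<noteq> z"
  shows "hangle (klein x) (klein z) (klein y) =
    arccos (Re (cnj (mob z x) * mob z y) / (norm (mob z x) * norm (mob z y)))"
proof -
  define p where "p = klein z"
  define s where "s a = sqrt (1 - (norm (klein a))\<^sup>2)" for a
  have s: "s a > 0" if "norm a < 1" for a unfolding s_def
    using one_minus_norm_pos[OF norm_klein[OF that]] by simp
  have ch: "1 - klein a \<bullet> klein b = coshd a b * (s a * s b)" if ab: "norm a < 1" "norm b < 1" for a b
    using coshd_klein[OF ab] s[OF ab(1)] s[OF ab(2)] unfolding real_sqrt_mult s_def[symmetric]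
      by (simp add: divide_eq_eq split: if_splits)
  have S: "1 - (norm p)\<^sup>2 = s z * s z" unfolding p_def s_def
    using one_minus_norm_pos[OF norm_klein[OF z]] by simp
  define l where "l = (\<lambda>a. s a / s z * (2 / (1 - (norm (mob z a))\<^sup>2)))"
  have l: "l a > 0" if "norm a < 1" for a
    unfolding l_def using s[OF that] s[OF z] one_minus_norm_pos[OF norm_mob[OF z that]] by simp
  have hm: "hmetric p (klein a - p) (klein b - p) = l a * l b * Re (cnj (mob z a) * mob z b)"
    if ab: "norm a < 1" "norm b < 1" for a b
  proof -
    have np: "norm p < 1" unfolding p_def by (rule norm_klein[OF z])
    have "hmetric p (klein a - p) (klein b - p)
      = (coshd z a * (s z * s a) * (coshd z b * (s z * s b)) - s z * s z * (coshd a b * (s a * s b))) / (s z * s z)\<^sup>2"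
      unfolding hmetric_formula[OF np] S unfolding p_def ch[OF z ab(1)] ch[OF z ab(2)] ch[OF ab] ..
    also have "\<dots> = s a / s z * (s b / s z) * (coshd z a * coshd z b - coshd a b)"
      using s[OF z] by (simp add: divide_simps power2_eq_square) (simp add: algebra_simps)
    also have "coshd z a * coshd z b - coshd a b
      = 2 / (1 - (norm (mob z a))\<^sup>2) * (2 / (1 - (norm (mob z b))\<^sup>2)) * Re (cnj (mob z a) * mob z b)"
      using coshd_cosine[OF norm_mob[OF z ab(1)] norm_mob[OF z ab(2)]]
      unfolding coshd_mob_mob[OF z ab] coshd_mob[OF z ab(1)] coshd_mob[OF z ab(2)] .
    finally show ?thesis unfolding l_def by (simp add: mult_ac)
  qed
  have sq: "Re (cnj u * u) = (norm u)\<^sup>2" for u unfolding cmod_power2 by (simp add: power2_eq_square)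
  have "sqrt (hmetric p (klein x - p) (klein x - p) * hmetric p (klein y - p) (klein y - p))
    = sqrt ((l x * l y * (norm (mob z x) * norm (mob z y)))\<^sup>2)"
    unfolding hm[OF x x] hm[OF y y] sq by (simp add: power_mult_distrib power2_eq_square mult_ac)
  also have "\<dots> = l x * l y * (norm (mob z x) * norm (mob z y))" using l[OF x] l[OF y] by simp
  finally show ?thesis unfolding hangle_def p_def[symmetric] using l[OF x] l[OF y]
    by (simp add: hm[OF x y])
qed

lemma Re_cnj_mult_eq_of_hangle_eq:
  assumes "norm a = r" "norm b = r" "norm c = r" "norm d = r" "r > 0"
    "arccos (Re (cnj a * b) / (norm a * norm b)) = arccos (Re (cnj c * d) / (norm c * norm d))"
  shows "Re (cnj a * b) = Re (cnj c * d)"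
proof -
  have "\<bar>Re (cnj x * y) / (norm x * norm y)\<bar> \<le> 1" for x y
  proof -
    have "\<bar>Re (cnj x * y)\<bar> \<le> norm x * norm y" using abs_Re_le_cmod[of "cnj x * y"]
      by (simp only: norm_mult complex_mod_cnj)
    then show ?thesis by (simp only: abs_divide abs_mult abs_norm_cancel) (auto intro!: divide_le_eq_1[THEN iffD2] simp: less_le)
  qed
  then have "Re (cnj a * b) / (norm a * norm b) = Re (cnj c * d) / (norm c * norm d)"
    using arccos_eq_iff assms(6) by blast
  then show ?thesis using assms(1-5) by simp
qed

section \<open>Convexity and the choice of the root of unity\<close>

lemma orient_daut:
  assumes "norm \<beta> < norm \<alpha>" "norm x < 1" "norm y < 1" "norm w < 1"
  shows "orient (daut \<alpha> \<beta> x) (daut \<alpha> \<beta> y) (daut \<alpha> \<beta> w) = orient x y w"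
proof -
  define u where "u = daut_factor \<alpha> \<beta> x"
  have u: "cnj u * u = 1" using norm_daut_factor[OF assms(1,2)] complex_norm_square[of u] unfolding u_def
    by (simp add: mult.commute)
  have "cnj (u * mob x y) * (u * mob x w) = (cnj u * u) * (cnj (mob x y) * mob x w)" by simp
  also have "\<dots> = cnj (mob x y) * mob x w" unfolding u by simp
  finally show ?thesis
    unfolding orient_def mob_daut_daut[OF assms(1-3)] mob_daut_daut[OF assms(1,2,4)] u_def[symmetric]
      by (simp only:)
qed

text \<open>Distinct powers exhaust all roots of unity, so the root next to 1 is some
  \<open>\<eta> ^ j\<close>. If \<open>\<eta>\<close> were another root, that point would lie
  strictly on the wrong side of the line from 1 to \<open>\<eta>\<close>.\<close>

lemma primitive_root_convex:
  assumes n: "n \<ge> 3" and root: "\<eta> ^ n = 1" and inj: "inj_on (\<lambda>i. \<eta> ^ i) {..<n}"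
    and conv: "\<And>j. 0 \<le> Im (cnj (\<eta> - 1) * (\<eta> ^ j - 1))"
  shows "\<eta> = cis (2 * pi / real n)"
proof -
  have n0: "n > 0" using n by simp
  have "(\<lambda>i. \<eta> ^ i) ` {..<n} = {z. z ^ n = 1}"
  proof (rule card_subset_eq)
    show "finite {z::complex. z ^ n = 1}" using n0 by (intro finite_roots_unity) simp
    show "(\<lambda>i. \<eta> ^ i) ` {..<n} \<subseteq> {z. z ^ n = 1}"
    proof clarify
      fix i
      have "(\<eta> ^ i) ^ n = (\<eta> ^ n) ^ i" by (simp only: power_mult[symmetric] mult.commute)
      then show "(\<eta> ^ i) ^ n = 1" using root by simp
    qed
    show "card ((\<lambda>i. \<eta> ^ i) ` {..<n}) = card {z::complex. z ^ n = 1}"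
      using card_image[OF inj] Complex.card_roots_unity_eq[OF n0] by simp
  qed
  moreover have "cis (2 * pi / real n) ^ n = 1" using n0 by (simp add: Complex.DeMoivre)
  ultimately have "cis (2 * pi / real n) \<in> (\<lambda>i. \<eta> ^ i) ` {..<n}" by simp
  then obtain j where "cis (2 * pi / real n) = \<eta> ^ j" by (rule imageE)
  then have j: "\<eta> ^ j = cis (2 * pi / real n)" ..
  obtain k where k: "k < n" "\<eta> = cis (2 * pi * real k / real n)"
    using Complex.bij_betw_roots_unity[OF n0] root unfolding bij_betw_def by auto
  define t where "t = pi * real k / real n"
  define f where "f = pi / real n"
  have eta: "\<eta> = cis (2 * t)" "\<eta> ^ j = cis (2 * f)" unfolding j unfolding k t_def f_def
    by (simp_all add: mult.assoc)
  have k0: "k \<noteq> 0"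
  proof
    assume "k = 0"
    then have "\<eta> ^ 0 = \<eta> ^ 1" using k by simp
    then show False using inj_onD[OF inj, of 0 1] n by simp
  qed
  have "k = 1"
  proof (rule ccontr)
    assume "k \<noteq> 1"
    then have k2: "1 < k" using k0 by simp
    have f: "0 < f" "f < pi" unfolding f_def using n by (simp_all add: divide_less_eq)
    have "pi * real k < pi * real n" "pi * 1 < pi * real k" using k k2 pi_gt_zero by simp_all
    then have t: "f < t" "t < pi" unfolding t_def f_def using n0
      by (simp_all add: divide_less_eq divide_strict_right_mono)
    \<comment> \<open>Twice the signed area of a triangle inscribed in the unit circle, which is a
      product of sines of half the central angles.\<close>
    have "Im (cnj (\<eta> - 1) * (\<eta> ^ j - 1)) = sin (2 * f - 2 * t) + sin (2 * t) - sin (2 * f)"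
      unfolding eta(2) unfolding eta(1) by (simp add: sin_diff algebra_simps)
    also have "\<dots> = - (4 * sin (t - f) * sin f * sin t)"
    proof -
      have "sin (2 * f - 2 * t) = - (2 * sin (t - f) * cos (t - f))"
        using sin_double[of "t - f"] sin_minus[of "2 * (t - f)"] by (simp add: algebra_simps)
      moreover have "sin (2 * t) - sin (2 * f) = 2 * sin (t - f) * cos (t + f)"
      proof -
        have "(2 * t - 2 * f) / 2 = t - f" "(2 * t + 2 * f) / 2 = t + f" by simp_all
        then show ?thesis using sin_diff_sin[of "2 * t" "2 * f"] by (simp only: mult.assoc)
      qed
      ultimately have "sin (2 * f - 2 * t) + sin (2 * t) - sin (2 * f)
        = 2 * sin (t - f) * (cos (t + f) - cos (t - f))"
        by (simp add: algebra_simps)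
      also have "cos (t + f) - cos (t - f) = - (2 * sin t * sin f)" by (simp add: cos_add cos_diff)
      finally show ?thesis by simp
    qed
    finally have "Im (cnj (\<eta> - 1) * (\<eta> ^ j - 1)) = - (4 * sin (t - f) * sin f * sin t)" .
    moreover have "sin (t - f) > 0" "sin f > 0" "sin t > 0" using f t by (auto intro!: sin_gt_zero)
    ultimately have "Im (cnj (\<eta> - 1) * (\<eta> ^ j - 1)) < 0" by simp
    then show False using conv[of j] by simp
  qed
  then show ?thesis using k by simp
qed

text \<open>A supporting line at the midpoint of a side contains both ends, the midpoint being their
  average. It is therefore the line of that side, and all vertices lie on one side of it.\<close>

lemma convex_polygon_support:
  assumes P: "ngon n P" and conv: "convex (enclosed_region P)"
  obtains s :: real where "\<bar>s\<bar> = 1" "\<And>j. 0 \<le> s * kdet (vertex P i) (vertex P (Suc i)) (vertex P j)"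
proof -
  have len: "length P = n" "n \<ge> 3" using P by (auto simp: ngon_def)
  define m where "m = n - 2"
  have m: "n = Suc (Suc m)" unfolding m_def using len by simp
  define v where "v = vertex P"
  define \<gamma> where "\<gamma> = polypath v 0 (Suc m)"
  have vn: "v n = v 0" unfolding v_def vertex_def using len by auto
  have bd: "boundary P = path_image \<gamma>" unfolding \<gamma>_def v_def using len m
    by (intro boundary_eq_path_image) simp
  have "simple_path \<gamma>" unfolding \<gamma>_def v_def by (rule simple_path_polygon[OF P m])
  moreover have "pathfinish \<gamma> = pathstart \<gamma>" unfolding \<gamma>_def using vn m by simp
  ultimately have K: "open (enclosed_region P)" "frontier (enclosed_region P) = boundary P"
    using Jordan_inside_outside[of \<gamma>] unfolding enclosed_region_def bd by auto
  have vmod: "v j = v (j mod n)" "v (Suc j) = v (Suc (j mod n))" for j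
    unfolding v_def vertex_def len by (simp_all add: mod_Suc_eq)
  have seg: "closed_segment (v j) (v (Suc j)) \<subseteq> boundary P" for j
  proof -
    have "closed_segment (v j) (v (Suc j)) = side P (j mod n)"
      by (simp only: side_def v_def[symmetric] vmod[of j, symmetric])
    also have "\<dots> \<subseteq> boundary P" unfolding boundary_def using len by (intro UN_upper) simp
    finally show ?thesis .
  qed
  define x where "x = midpoint (v i) (v (Suc i))"
  have "x \<in> boundary P" using seg[of i] midpoint_in_closed_segment unfolding x_def by blast
  then have x: "x \<in> closure (enclosed_region P)" "x \<notin> rel_interior (enclosed_region P)"
    using K unfolding frontier_def by (auto simp: rel_interior_open interior_open)
  obtain a where a: "a \<noteq> 0" "\<And>y. y \<in> closure (enclosed_region P) \<Longrightarrow> a \<bullet> x \<le> a \<bullet> y"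
    by (rule supporting_hyperplane_relative_frontier[OF conv x]) (rule that)
  have av: "a \<bullet> x \<le> a \<bullet> v j" for j
  proof -
    have "v j \<in> boundary P" using seg[of j] by auto
    then have "v j \<in> closure (enclosed_region P)" using K(2) by (auto simp: frontier_def)
    then show ?thesis by (rule a(2))
  qed
  have "a \<bullet> x = (a \<bullet> v i + a \<bullet> v (Suc i)) / 2" unfolding x_def midpoint_def
    by (simp add: inner_add_right)
  then have sum: "a \<bullet> v i + a \<bullet> v (Suc i) = 2 * (a \<bullet> x)" by simp
  have ax: "a \<bullet> v i = a \<bullet> x" using sum av[of i] av[of "Suc i"] by linarith
  have ax': "a \<bullet> v (Suc i) = a \<bullet> x" using sum ax by linarith
  define d where "d = v (Suc i) - v i"
  have d: "d \<noteq> 0" unfolding d_def v_def using ngon_vertex_Suc_neq[OF P, of i] by simp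
  have ad: "a \<bullet> d = 0" unfolding d_def inner_diff_right ax ax' by simp
  \<comment> \<open>As \<open>a\<close> is orthogonal to the side, it is a multiple of
    \<open>\<i> * d\<close>, and \<open>\<mu>\<close> has the sign of the factor.\<close>
  define \<mu> where "\<mu> = a \<bullet> (\<i> * d)"
  have dec: "(a \<bullet> w) * (norm d)\<^sup>2 = \<mu> * Im (cnj d * w)" for w
  proof -
    have "(a \<bullet> w) * (norm d)\<^sup>2 = (a \<bullet> d) * (d \<bullet> w) + \<mu> * Im (cnj d * w)"
      unfolding \<mu>_def cmod_power2 by (simp add: inner_complex_def algebra_simps power2_eq_square)
    then show ?thesis unfolding ad by simp
  qed
  have "\<mu> \<noteq> 0" using dec[of a] a(1) d by auto
  show thesis
  proof (rule that[of "sgn \<mu>"])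
    show "\<bar>sgn \<mu>\<bar> = 1" using \<open>\<mu> \<noteq> 0\<close> by (simp add: abs_sgn_eq)
    fix j
    have "0 \<le> (a \<bullet> (v j - v i)) * (norm d)\<^sup>2" using av[of j] ax by (simp add: inner_diff_right)
    then have "0 \<le> \<mu> * Im (cnj d * (v j - v i))" unfolding dec .
    then have "0 \<le> \<mu> * kdet (v i) (v (Suc i)) (v j)" unfolding kdet_def d_def .
    then show "0 \<le> sgn \<mu> * kdet (vertex P i) (vertex P (Suc i)) (vertex P j)"
      unfolding v_def[symmetric] by (auto simp: zero_le_mult_iff sgn_if split: if_splits)
  qed
qed

lemma kdet_rotate: "kdet q r p = kdet p q r" and kdet_swap: "kdet q p r = - kdet p q r"
  unfolding kdet_def by (simp_all add: algebra_simps)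

lemma mob_cnj: "mob (cnj c) (cnj z) = cnj (mob c z)"
  by (simp add: mob_def)

text \<open>Equal values of \<open>hangle\<close> leave the sense of turning open; convexity shows
  that it is the same at all vertices and that the polygon winds only once. The map \<open>b\<close>
  makes the orientation positive.\<close>

lemma regular_ngon_rotation:
  assumes reg: "regular_ngon n P"
  obtains b c where "b = (\<lambda>z. z) \<or> b = cnj" "norm c < 1"
    "\<And>i. mob c (b (kinv (vertex P (Suc i)))) = cis (2 * pi / real n) * mob c (b (kinv (vertex P i)))"
proof -
  have P: "ngon n P" and conv: "convex (enclosed_region P)" using reg by (auto simp: regular_ngon_def)
  have n: "n \<ge> 3" "length P = n" using P by (auto simp: ngon_def)
  then have n0: "n > 0" by simp
  define v where "v = vertex P"
  define z where "z = (\<lambda>i. kinv (v i))"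
  have nv: "norm (v i) < 1" for i unfolding v_def by (rule norm_vertex[OF P])
  have nz: "norm (z i) < 1" for i unfolding z_def by (rule norm_kinv[OF nv])
  have kz: "klein (z i) = v i" for i unfolding z_def by (rule klein_kinv[OF nv])
  have vper: "v (i + n) = v i" for i unfolding v_def using vertex_add_length[of P i] n by simp
  have ct: "ctuple n z" unfolding ctuple_def using nz vper by (simp add: z_def)
  have vm: "v i = v (i mod n)" "v (Suc i) = v (Suc (i mod n))"
    "v (Suc (Suc i)) = v (Suc (Suc (i mod n)))" for i
    unfolding v_def vertex_def n by (simp_all add: mod_Suc_eq mod_Suc_Suc_eq)
  have vinj: "i = j" if "v i = v j" "i < n" "j < n" for i j
    using ngon_vertex_distinct[OF P that(2,3)] that(1) unfolding v_def by blast
  have vne: "v i \<noteq> v (Suc i)" for i unfolding v_def by (rule ngon_vertex_Suc_neq[OF P])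
  have zne: "z i \<noteq> z (Suc i)" for i using vne[of i] kz by metis
  define r where "r = norm (mob (z 0) (z (Suc 0)))"
  have r: "r > 0" unfolding r_def using mob_eq_0_iff[OF nz nz] zne[of 0] by simp
  have side: "norm (mob (z i) (z (Suc i))) = r" for i
  proof -
    have "\<forall>i<n. \<forall>j<n. hdist (v i) (v (Suc i)) = hdist (v j) (v (Suc j))" using reg
      unfolding regular_ngon_def v_def by blast
    then have "hdist (v (i mod n)) (v (Suc (i mod n))) = hdist (v 0) (v (Suc 0))"
      by (elim allE[of _ "i mod n"] allE[of _ 0] impE) (use n0 in auto)
    then have "hdist (v i) (v (Suc i)) = hdist (v 0) (v (Suc 0))" unfolding vm[of i, symmetric] .
    then have "pdist (z i) (z (Suc i)) = pdist (z 0) (z (Suc 0))"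
      unfolding kz[symmetric] hdist_klein[OF nz nz] .
    then show ?thesis
      unfolding pdist_eq_iff_coshd[OF nz nz nz nz] coshd_eq_iff_norm_mob[OF nz nz nz nz] r_def .
  qed
  define a b where "a i = mob (z (Suc i)) (z i)" and "b i = mob (z (Suc i)) (z (Suc (Suc i)))" for i
  have na: "norm (a i) = r" "norm (b i) = r" for i
    unfolding a_def b_def using side norm_mob_commute[OF nz nz, of "Suc i" i] by auto
  have re: "Re (cnj (a i) * b i) = Re (cnj (a 0) * b 0)" for i
  proof -
    have "\<forall>i<n. \<forall>j<n. hangle (v i) (v (Suc i)) (v (Suc (Suc i)))
      = hangle (v j) (v (Suc j)) (v (Suc (Suc j)))"
      using reg unfolding regular_ngon_def v_def by blast
    then have "hangle (v (i mod n)) (v (Suc (i mod n))) (v (Suc (Suc (i mod n))))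
      = hangle (v 0) (v (Suc 0)) (v (Suc (Suc 0)))"
      by (elim allE[of _ "i mod n"] allE[of _ 0] impE) (use n0 in auto)
    then have "hangle (v i) (v (Suc i)) (v (Suc (Suc i))) = hangle (v 0) (v (Suc 0)) (v (Suc (Suc 0)))"
      unfolding vm[of i, symmetric] .
    then have "arccos (Re (cnj (a i) * b i) / (norm (a i) * norm (b i)))
      = arccos (Re (cnj (a 0) * b 0) / (norm (a 0) * norm (b 0)))"
      unfolding kz[symmetric] hangle_klein[OF nz nz nz zne zne[symmetric]] a_def b_def .
    then show ?thesis by (rule Re_cnj_mult_eq_of_hangle_eq[OF na na r])
  qed
  have "\<exists>s::real. \<bar>s\<bar> = 1 \<and> (\<forall>j. 0 \<le> s * kdet (v i) (v (Suc i)) (v j))" for i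
    unfolding v_def by (rule convex_polygon_support[OF P conv, of i]) blast
  then obtain s :: "nat \<Rightarrow> real" where s: "\<bar>s i\<bar> = 1" "0 \<le> s i * kdet (v i) (v (Suc i)) (v j)" for i j
    by metis
  \<comment> \<open>The angle condition controls the cosine; \<open>t i\<close> is the sine at the
    vertex \<open>Suc i\<close>, scaled by \<open>r\<^sup>2\<close>. Its square is therefore
    constant and only its sign is left to settle.\<close>
  define t where "t i = Im (cnj (a i) * b i)" for i
  have t2: "(t i)\<^sup>2 = (t 0)\<^sup>2" for i
  proof -
    have "(Re (cnj (a i) * b i))\<^sup>2 + (t i)\<^sup>2 = (r * r)\<^sup>2" for i
      using cmod_power2[of "cnj (a i) * b i"] na[of i] unfolding t_def
        by (simp only: norm_mult complex_mod_cnj)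
    from this[of i] this[of 0] show ?thesis using re[of i] by simp
  qed
  have tD: "\<exists>k>0. t i = - (k * kdet (v i) (v (Suc i)) (v (Suc (Suc i))))" for i
  proof -
    obtain k where "k > 0"
      "orient (z (Suc i)) (z i) (z (Suc (Suc i)))
        = k * kdet (klein (z (Suc i))) (klein (z i)) (klein (z (Suc (Suc i))))"
      using orient_kdet[OF nz nz nz] by blast
    then show ?thesis unfolding t_def a_def b_def orient_def[symmetric] kz kdet_swap[of "v (Suc i)"]
      by auto
  qed
  \<comment> \<open>The determinant of three consecutive vertices is tested by the supporting lines
    of both sides involved, which ties the signs of neighbouring sides together.\<close>
  have st: "s i * t i \<le> 0" "s (Suc i) * t i \<le> 0" for i
  proof -
    define D where "D = kdet (v i) (v (Suc i)) (v (Suc (Suc i)))"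
    obtain k where k: "k > 0" "t i = - (k * D)" using tD[of i] unfolding D_def by blast
    have "0 \<le> s i * D" "0 \<le> s (Suc i) * D"
      using s(2)[of i "Suc (Suc i)"] s(2)[of "Suc i" i]
        unfolding D_def kdet_rotate[of "v (Suc i)" "v (Suc (Suc i))" "v i"] .
    then have "0 \<le> k * (s i * D)" "0 \<le> k * (s (Suc i) * D)" using k(1) by simp_all
    then show "s i * t i \<le> 0" "s (Suc i) * t i \<le> 0" unfolding k(2) by (simp_all add: mult.left_commute)
  qed
  have tc: "t i = t 0" for i
  proof (cases "t 0 = 0")
    case True then show ?thesis using t2[of i] by simp
  next
    case False
    have t0: "t i \<noteq> 0" for i using t2[of i] False by auto
    have s0: "s i = s 0" for i
    proof (induction i)
      case (Suc i)
      have "s i = s (Suc i)"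
        using st[of i] t0[of i] s(1)[of i] s(1)[of "Suc i"] by (auto simp: mult_le_0_iff abs_if split:
          if_splits)
      then show ?case using Suc by simp
    qed simp
    have "t i = t 0 \<or> t i = - t 0" using t2[of i] by (simp add: power2_eq_iff)
    moreover have "t i \<noteq> - t 0"
      using st(1)[of i] st(1)[of 0] s(1)[of 0] False unfolding s0[of i]
        by (auto simp: mult_le_0_iff abs_if split: if_splits)
    ultimately show ?thesis by blast
  qed
  define \<kappa> where "\<kappa> = cnj (a 0) * b 0"
  have kap: "cnj (a i) * b i = \<kappa>" for i unfolding \<kappa>_def complex_eq_iff using re[of i] tc[of i]
    unfolding t_def by blast
  have ang: "mob (z (Suc i)) (z (Suc (Suc i))) = \<kappa> / of_real (r\<^sup>2) * mob (z (Suc i)) (z i)" for i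
  proof -
    have aa: "a i * cnj (a i) = of_real (r\<^sup>2)" using complex_norm_square[of "a i"] na(1)[of i] by simp
    have "\<kappa> * a i = (a i * cnj (a i)) * b i" using kap[of i] by (simp add: mult_ac)
    then have "b i = \<kappa> / of_real (r\<^sup>2) * a i" unfolding aa using r by (simp add: field_simps)
    then show ?thesis unfolding a_def b_def .
  qed
  obtain c \<eta> where c: "norm c < 1" "norm \<eta> = 1" "\<And>i. mob c (z (Suc i)) = \<eta> * mob c (z i)"
    by (rule regular_tuple_rotation[OF ct n0 r side ang]) (rule that)
  define y where "y i = mob c (z i)" for i
  have ye: "y i = \<eta> ^ i * y 0" for i unfolding y_def by (induction i) (simp_all add: c(3))
  have nc: "norm (- c) < norm (1::complex)" using c by simp
  have ny: "norm (y i) < 1" for i unfolding y_def by (rule norm_mob[OF c(1) nz])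
  have nyi: "norm (y i) = norm (y 0)" for i unfolding ye[of i] by (simp add: norm_mult norm_power c(2))
  have yz: "z i = z j" if "y i = y j" for i j using mob_inj[OF c(1) nz nz] that unfolding y_def by blast
  have y0: "y 0 \<noteq> 0" using yz[of 0 1] zne[of 0] ye[of 1] by auto
  have root: "\<eta> ^ n = 1" using ye[of n] ctuple_period[OF ct] y0 unfolding y_def by simp
  have inj: "inj_on (\<lambda>i. \<eta> ^ i) {..<n}"
  proof (rule inj_onI)
    fix i j assume ij: "i \<in> {..<n}" "j \<in> {..<n}" "\<eta> ^ i = \<eta> ^ j"
    then have "y i = y j" using ye[of i] ye[of j] by simp
    then have "v i = v j" using yz kz by metis
    then show "i = j" using vinj ij by simp
  qed
  \<comment> \<open>The support condition of the first side, moved to the circle around 0. All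
    \<open>y i\<close> have the same norm, so \<open>klein\<close> scales them by one real factor
    and the determinant reduces to powers of \<open>\<eta>\<close>.\<close>
  have conv: "0 \<le> s 0 * Im (cnj (\<eta> - 1) * (\<eta> ^ j - 1))" for j
  proof -
    obtain k where k: "k > 0" "orient (z 0) (z 1) (z j) = k * kdet (v 0) (v 1) (v j)"
      using orient_kdet[OF nz nz nz] unfolding kz by blast
    obtain k' where k': "k' > 0"
      "orient (y 0) (y 1) (y j) = k' * kdet (klein (y 0)) (klein (y 1)) (klein (y j))"
      using orient_kdet[OF ny ny ny] by blast
    have oo: "orient (y 0) (y 1) (y j) = orient (z 0) (z 1) (z j)"
      unfolding y_def mob_daut by (rule orient_daut[OF nc nz nz nz])
    define q where "q = 2 / (1 + (norm (y 0))\<^sup>2)"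
    have q: "q > 0" unfolding q_def by (simp add: add_pos_nonneg)
    have ky: "klein (y i) = of_real q * (\<eta> ^ i * y 0)" for i
      unfolding klein_def nyi[of i] q_def unfolding ye[of i] by simp
    have "cnj (klein (y 1) - klein (y 0)) * (klein (y j) - klein (y 0))
      = (of_real q * of_real q * (y 0 * cnj (y 0))) * (cnj (\<eta> - 1) * (\<eta> ^ j - 1))"
      unfolding ky by (simp add: algebra_simps)
    moreover have "of_real q * of_real q * (y 0 * cnj (y 0)) = complex_of_real (q * q * (norm (y 0))\<^sup>2)"
      by (simp only: complex_norm_square[symmetric] of_real_mult)
    moreover have "Im (of_real r * X) = r * Im X" for r X by simp
    ultimately have kd: "kdet (klein (y 0)) (klein (y 1)) (klein (y j))
      = q * q * (norm (y 0))\<^sup>2 * Im (cnj (\<eta> - 1) * (\<eta> ^ j - 1))"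
      unfolding kdet_def by (simp only:)
    have "k * (s 0 * kdet (v 0) (v 1) (v j))
      = k' * (q * q * (norm (y 0))\<^sup>2) * (s 0 * Im (cnj (\<eta> - 1) * (\<eta> ^ j - 1)))"
      using k(2) k'(2) oo kd by (simp add: mult_ac)
    moreover have "0 \<le> k * (s 0 * kdet (v 0) (v 1) (v j))" using k(1) s(2)[of 0 j] by simp
    moreover have "0 < k' * (q * q * (norm (y 0))\<^sup>2)" using k'(1) q y0 by simp
    ultimately show ?thesis by (metis zero_le_mult_iff not_le)
  qed
  consider "s 0 = 1" | "s 0 = -1" using s(1)[of 0] by linarith
  then show thesis
  proof cases
    case 1
    then have "\<eta> = cis (2 * pi / real n)" using primitive_root_convex[OF n(1) root inj] conv by simp
    then show thesis using that[of "\<lambda>z. z" c] c unfolding z_def v_def by simp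
  next
    case 2
    \<comment> \<open>A clockwise polygon becomes counterclockwise under conjugation.\<close>
    have "cnj \<eta> = cis (2 * pi / real n)"
    proof (rule primitive_root_convex[OF n(1)])
      show "cnj \<eta> ^ n = 1" using root by (metis complex_cnj_one complex_cnj_power)
      show "inj_on (\<lambda>i. cnj \<eta> ^ i) {..<n}"
        using inj unfolding inj_on_def complex_cnj_power[symmetric] complex_cnj_cancel_iff .
      show "0 \<le> Im (cnj (cnj \<eta> - 1) * (cnj \<eta> ^ j - 1))" for j
      proof -
        have "cnj (cnj \<eta> - 1) * (cnj \<eta> ^ j - 1) = cnj (cnj (\<eta> - 1) * (\<eta> ^ j - 1))" by simp
        then show ?thesis using conv[of j] 2 by (simp only: cnj.simps)
      qed
    qed
    then have "mob (cnj c) (cnj (z (Suc i))) = cis (2 * pi / real n) * mob (cnj c) (cnj (z i))" for i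
      unfolding mob_cnj c(3) by (metis complex_cnj_mult)
    then show thesis using that[of cnj "cnj c"] c(1) unfolding z_def v_def by simp
  qed
qed

subsection \<open>Congruence\<close>

text \<open>In the projective model an automorphism is fractional linear over the reals: numerator
  and denominator are real affine functions of \<open>klein z\<close>.\<close>

lemma klein_daut:
  assumes "norm \<beta> < norm \<alpha>" "norm z < 1"
  defines "D \<equiv> (norm \<alpha>)\<^sup>2 + (norm \<beta>)\<^sup>2 + 2 * Re (\<alpha> * cnj \<beta> * klein z)"
  shows "D > 0" "klein (daut \<alpha> \<beta> z) = (\<alpha>\<^sup>2 * klein z + 2 * \<alpha> * \<beta> + \<beta>\<^sup>2 * cnj (klein z)) / of_real D"
proof -
  define w where "w = cnj \<beta> * z + cnj \<alpha>"
  define f where "f = \<alpha> * z + \<beta>"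
  define Z where "Z = 1 + (norm z)\<^sup>2"
  have Z: "Z > 0" unfolding Z_def by (simp add: add_pos_nonneg)
  have w: "w \<noteq> 0" unfolding w_def using daut_denom_nz[OF assms(1,2)] .
  have kz: "klein z = 2 * z / of_real Z" unfolding klein_def Z_def ..
  have DZ: "D * Z = (norm w)\<^sup>2 + (norm f)\<^sup>2"
  proof -
    have e: "Re (\<alpha> * cnj \<beta> * klein z) * Z = Re (\<alpha> * cnj \<beta> * (2 * z))"
      unfolding kz using Z by (simp add: Re_divide_of_real Im_divide_of_real field_simps)
    have "D * Z = ((norm \<alpha>)\<^sup>2 + (norm \<beta>)\<^sup>2) * Z + 2 * (Re (\<alpha> * cnj \<beta> * klein z) * Z)"
      unfolding D_def by (simp only: distrib_right mult.assoc)
    also have "\<dots> = ((norm \<alpha>)\<^sup>2 + (norm \<beta>)\<^sup>2) * Z + 2 * Re (\<alpha> * cnj \<beta> * (2 * z))"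
      unfolding e ..
    also have "\<dots> = (norm w)\<^sup>2 + (norm f)\<^sup>2"
      unfolding Z_def w_def f_def cmod_power2 by (simp add: algebra_simps power2_eq_square)
    finally show ?thesis .
  qed
  have "D * Z > 0" unfolding DZ using w by (simp add: add_pos_nonneg)
  then show D: "D > 0" using Z by (simp add: zero_less_mult_iff)
  have "klein (daut \<alpha> \<beta> z) = 2 * (f / w) / of_real (1 + (norm f)\<^sup>2 / (norm w)\<^sup>2)"
    unfolding klein_def daut_def w_def f_def norm_divide power_divide ..
  also have "1 + (norm f)\<^sup>2 / (norm w)\<^sup>2 = D * Z / (norm w)\<^sup>2"
    unfolding DZ using w by (simp add: add_divide_distrib)
  also have "2 * (f / w) / of_real (D * Z / (norm w)\<^sup>2) = 2 * f * cnj w / of_real (D * Z)"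
  proof -
    have "complex_of_real ((norm w)\<^sup>2) = w * cnj w" by (rule complex_norm_square)
    then show ?thesis using w D Z unfolding of_real_divide by (simp add: field_simps)
  qed
  also have "2 * f * cnj w = \<alpha>\<^sup>2 * (2 * z) + 2 * \<alpha> * \<beta> * of_real Z + \<beta>\<^sup>2 * cnj (2 * z)"
  proof -
    have "complex_of_real Z = 1 + z * cnj z" unfolding Z_def of_real_add of_real_1 complex_norm_square ..
    then show ?thesis unfolding f_def w_def by (simp add: algebra_simps power2_eq_square)
  qed
  also have "(\<alpha>\<^sup>2 * (2 * z) + 2 * \<alpha> * \<beta> * of_real Z + \<beta>\<^sup>2 * cnj (2 * z)) / of_real (D * Z)
     = (\<alpha>\<^sup>2 * klein z + 2 * \<alpha> * \<beta> + \<beta>\<^sup>2 * cnj (klein z)) / of_real D"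
    unfolding kz using Z D by (simp add: field_simps)
  finally show "klein (daut \<alpha> \<beta> z) = (\<alpha>\<^sup>2 * klein z + 2 * \<alpha> * \<beta> + \<beta>\<^sup>2 * cnj (klein z)) / of_real D" .
qed

text \<open>Preservation of chords is bundled with the isometry, so that images of boundaries follow
  from images of vertices.\<close>

definition chord_isometry :: "(complex \<Rightarrow> complex) \<Rightarrow> bool" where
  "chord_isometry f \<longleftrightarrow> hisometry f \<and>
     (\<forall>p\<in>hplane. \<forall>q\<in>hplane. f ` closed_segment p q = closed_segment (f p) (f q))"

text \<open>One inclusion for \<open>f\<close> and one for its inverse \<open>g\<close> together
  give equality of segments.\<close>

lemma chord_isometryI:
  assumes inv: "\<And>p. p \<in> hplane \<Longrightarrow> f p \<in> hplane \<and> g (f p) = p"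
    "\<And>p. p \<in> hplane \<Longrightarrow> g p \<in> hplane \<and> f (g p) = p"
    and dist: "\<And>p q. p \<in> hplane \<Longrightarrow> q \<in> hplane \<Longrightarrow> hdist (f p) (f q) = hdist p q"
    and seg: "\<And>p q. p \<in> hplane \<Longrightarrow> q \<in> hplane \<Longrightarrow> f ` closed_segment p q \<subseteq> closed_segment (f p) (f q)"
       "\<And>p q. p \<in> hplane \<Longrightarrow> q \<in> hplane \<Longrightarrow> g ` closed_segment p q \<subseteq> closed_segment (g p) (g q)"
  shows "chord_isometry f"
  unfolding chord_isometry_def hisometry_def
proof (intro conjI ballI)
  show "bij_betw f hplane hplane" by (rule bij_betwI[where g = g]) (use inv in auto)
  show "hdist (f p) (f q) = hdist p q" if "p \<in> hplane" "q \<in> hplane" for p q by (rule dist[OF that])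
  fix p q assume pq: "p \<in> hplane" "q \<in> hplane"
  show "f ` closed_segment p q = closed_segment (f p) (f q)"
  proof
    show "closed_segment (f p) (f q) \<subseteq> f ` closed_segment p q"
    proof
      fix x assume x: "x \<in> closed_segment (f p) (f q)"
      have "closed_segment (f p) (f q) \<subseteq> hplane"
        using inv pq unfolding hplane_def by (intro closed_segment_subset) auto
      then have xh: "x \<in> hplane" using x by blast
      have "g x \<in> g ` closed_segment (f p) (f q)" using x by blast
      also have "\<dots> \<subseteq> closed_segment (g (f p)) (g (f q))" using seg(2) inv pq by blast
      finally have "g x \<in> closed_segment p q" using inv pq by simp
      then show "x \<in> f ` closed_segment p q" using inv(2)[OF xh] by (metis imageI)
    qed
  qed (rule seg(1)[OF pq])
qed

lemma chord_isometry_compose: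
  assumes "chord_isometry f" "chord_isometry g" shows "chord_isometry (g \<circ> f)"
proof -
  have f: "f p \<in> hplane" if "p \<in> hplane" for p
    using assms(1) that unfolding chord_isometry_def hisometry_def by (auto simp: bij_betw_def)
  show ?thesis unfolding chord_isometry_def hisometry_def
  proof (intro conjI ballI)
    show "bij_betw (g \<circ> f) hplane hplane"
      using assms unfolding chord_isometry_def hisometry_def by (blast intro: bij_betw_trans)
    fix p q assume pq: "p \<in> hplane" "q \<in> hplane"
    show "hdist ((g \<circ> f) p) ((g \<circ> f) q) = hdist p q"
      using assms f pq unfolding chord_isometry_def hisometry_def by simp
    show "(g \<circ> f) ` closed_segment p q = closed_segment ((g \<circ> f) p) ((g \<circ> f) q)"
      using assms f pq unfolding chord_isometry_def image_comp[symmetric] by simp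
  qed
qed

lemma chord_isometry_inverse:
  assumes "chord_isometry f" obtains g where "chord_isometry g" "\<And>p. p \<in> hplane \<Longrightarrow> g (f p) = p"
proof -
  define g where "g = inv_into hplane f"
  have f: "bij_betw f hplane hplane" "\<And>p q. p \<in> hplane \<Longrightarrow> q \<in> hplane \<Longrightarrow> hdist (f p) (f q) = hdist p q"
    "\<And>p q. p \<in> hplane \<Longrightarrow> q \<in> hplane \<Longrightarrow> f ` closed_segment p q = closed_segment (f p) (f q)"
    using assms unfolding chord_isometry_def hisometry_def by auto
  have gf: "g (f p) = p" if "p \<in> hplane" for p
    unfolding g_def using f(1) that by (simp add: bij_betw_def inv_into_f_f)
  have fg: "f (g p) = p" "g p \<in> hplane" if "p \<in> hplane" for p
    unfolding g_def using f(1) that by (auto simp: bij_betw_def f_inv_into_f inv_into_into)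
  have sub: "closed_segment p q \<subseteq> hplane" if "p \<in> hplane" "q \<in> hplane" for p q
    using that unfolding hplane_def by (intro closed_segment_subset) auto
  have "chord_isometry g"
  proof (rule chord_isometryI[where g = f])
    show "g p \<in> hplane \<and> f (g p) = p" if "p \<in> hplane" for p using fg that by simp
    show "f p \<in> hplane \<and> g (f p) = p" if "p \<in> hplane" for p using gf f(1) that
      by (auto simp: bij_betw_def)
    show "hdist (g p) (g q) = hdist p q" if "p \<in> hplane" "q \<in> hplane" for p q
      using f(2)[of "g p" "g q"] fg that by simp
    show "f ` closed_segment p q \<subseteq> closed_segment (f p) (f q)" if "p \<in> hplane" "q \<in> hplane" for p q
      using f(3) that by simp
    show "g ` closed_segment p q \<subseteq> closed_segment (g p) (g q)" if pq: "p \<in> hplane" "q \<in> hplane" for p q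
    proof
      fix x assume "x \<in> g ` closed_segment p q"
      then obtain y where y: "y \<in> closed_segment p q" "x = g y" by blast
      then have "y \<in> f ` closed_segment (g p) (g q)" using f(3)[of "g p" "g q"] fg pq by simp
      then obtain u where u: "u \<in> closed_segment (g p) (g q)" "y = f u" by blast
      then have "u \<in> hplane" using sub[of "g p" "g q"] fg pq by blast
      then show "x \<in> closed_segment (g p) (g q)" using u y gf by simp
    qed
  qed
  then show thesis using that gf by blast
qed

lemma chord_isometry_cnj: "chord_isometry cnj"
proof (rule chord_isometryI[where g = cnj])
  have i: "cnj p \<bullet> cnj q = p \<bullet> q" for p q by (simp add: inner_complex_def)
  show "hdist (cnj p) (cnj q) = hdist p q" for p q by (simp add: hdist_def i)
  have "cnj ` closed_segment p q \<subseteq> closed_segment (cnj p) (cnj q)" for p q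
    unfolding closed_segment_def by (auto simp: scaleR_conv_of_real)
  then show "cnj ` closed_segment p q \<subseteq> closed_segment (cnj p) (cnj q)"
    "cnj ` closed_segment p q \<subseteq> closed_segment (cnj p) (cnj q)" for p q
    by blast+
qed (auto simp: hplane_def)

lemma klein_daut_segment:
  assumes ab: "norm \<beta> < norm \<alpha>" and p: "norm p < 1" and q: "norm q < 1"
  shows "(\<lambda>p. klein (daut \<alpha> \<beta> (kinv p))) ` closed_segment p q
    \<subseteq> closed_segment (klein (daut \<alpha> \<beta> (kinv p))) (klein (daut \<alpha> \<beta> (kinv q)))"
proof
  define D where "D x = (norm \<alpha>)\<^sup>2 + (norm \<beta>)\<^sup>2 + 2 * Re (\<alpha> * cnj \<beta> * x)" for x
  define N where "N x = \<alpha>\<^sup>2 * x + 2 * \<alpha> * \<beta> + \<beta>\<^sup>2 * cnj x" for x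
  have D: "D x > 0" and k: "klein (daut \<alpha> \<beta> (kinv x)) = N x / of_real (D x)" if "norm x < 1" for x
    using klein_daut[OF ab norm_kinv[OF that]] unfolding klein_kinv[OF that] D_def N_def by auto
  fix y assume "y \<in> (\<lambda>p. klein (daut \<alpha> \<beta> (kinv p))) ` closed_segment p q"
  then obtain x where x: "x \<in> closed_segment p q" "y = klein (daut \<alpha> \<beta> (kinv x))" by blast
  then obtain u where u: "0 \<le> u" "u \<le> 1" "x = (1 - u) *\<^sub>R p + u *\<^sub>R q" unfolding closed_segment_def
    by blast
  have nx: "norm x < 1"
    using closed_segment_subset[of p "ball 0 1" q] p q x(1) by auto
  have Dx: "D x = (1 - u) * D p + u * D q" unfolding D_def u(3) by (simp add: algebra_simps)
  have Nx: "N x = of_real (1 - u) * N p + of_real u * N q"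
    unfolding N_def u(3) scaleR_conv_of_real by (simp add: algebra_simps)
  \<comment> \<open>A projective map sends convex combinations to convex combinations whose weights
    are rescaled by the denominators.\<close>
  define s where "s = u * D q / D x"
  have Dp: "D p > 0" "D q > 0" "D x > 0" using D p q nx by auto
  have s1: "1 - s = (1 - u) * D p / D x"
  proof -
    have "(1 - u) * D p / D x + s = 1" unfolding s_def add_divide_distrib[symmetric] Dx[symmetric]
      using Dp(3) by simp
    then show ?thesis by simp
  qed
  have "0 \<le> 1 - s" unfolding s1 using u Dp by simp
  moreover have "0 \<le> s" unfolding s_def using u Dp by simp
  moreover have "y = (1 - s) *\<^sub>R (N p / of_real (D p)) + s *\<^sub>R (N q / of_real (D q))"
    unfolding x(2) k[OF nx] s1 unfolding s_def scaleR_conv_of_real Nx using Dp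
      by (simp add: add_divide_distrib)
  ultimately show "y \<in> closed_segment (klein (daut \<alpha> \<beta> (kinv p))) (klein (daut \<alpha> \<beta> (kinv q)))"
    unfolding k[OF p] k[OF q] closed_segment_def by auto
qed

lemma chord_isometry_daut:
  assumes ab: "norm \<beta> < norm \<alpha>" shows "chord_isometry (\<lambda>p. klein (daut \<alpha> \<beta> (kinv p)))"
proof (rule chord_isometryI[where g = "\<lambda>p. klein (daut (cnj \<alpha>) (- \<beta>) (kinv p))"])
  have ab': "norm (- \<beta>) < norm (cnj \<alpha>)" using ab by simp
  have inv: "klein (daut (cnj \<alpha>) (- \<beta>) (kinv (klein (daut \<alpha> \<beta> (kinv p))))) = p" if "norm p < 1" for p
    using that by (simp add: kinv_klein norm_daut[OF ab] norm_kinv daut_inverse[OF ab] klein_kinv)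
  have inv': "klein (daut \<alpha> \<beta> (kinv (klein (daut (cnj \<alpha>) (- \<beta>) (kinv p))))) = p" if "norm p < 1" for p
    using that daut_inverse[OF ab'] by (simp add: kinv_klein norm_daut[OF ab'] norm_kinv klein_kinv)
  show "klein (daut \<alpha> \<beta> (kinv p)) \<in> hplane
    \<and> klein (daut (cnj \<alpha>) (- \<beta>) (kinv (klein (daut \<alpha> \<beta> (kinv p))))) = p"
    if "p \<in> hplane" for p
    using that inv unfolding hplane_def by (simp add: norm_klein norm_daut[OF ab] norm_kinv)
  show "klein (daut (cnj \<alpha>) (- \<beta>) (kinv p)) \<in> hplane
    \<and> klein (daut \<alpha> \<beta> (kinv (klein (daut (cnj \<alpha>) (- \<beta>) (kinv p))))) = p"
    if "p \<in> hplane" for p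
    using that inv' norm_daut[OF ab'] unfolding hplane_def by (simp add: norm_klein norm_kinv)
  show "hdist (klein (daut \<alpha> \<beta> (kinv p))) (klein (daut \<alpha> \<beta> (kinv q))) = hdist p q"
    if "p \<in> hplane" "q \<in> hplane" for p q
    using that unfolding hplane_def
    by (simp add: hdist_klein norm_daut[OF ab] norm_kinv pdist_daut[OF ab] hdist_eq_pdist)
qed (use klein_daut_segment ab in \<open>auto simp: hplane_def\<close>)

text \<open>A normal form: the images of the vertices depend only on \<open>\<eta>\<close> and the
  circumradius, so two orbits with the same data can be compared through it.\<close>

lemma rotation_chord_isometry:
  assumes b: "b = (\<lambda>z. z) \<or> b = cnj" and c: "norm c < 1" and v: "\<And>i. norm (v i) < 1"
    and rot: "\<And>i. mob c (b (kinv (v (Suc i)))) = \<eta> * mob c (b (kinv (v i)))"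
  obtains f where "chord_isometry f"
    "\<And>i. f (v i) = klein (\<eta> ^ i * of_real (norm (mob c (b (kinv (v 0))))))"
proof -
  define y where "y i = mob c (b (kinv (v i)))" for i
  have yi: "y i = \<eta> ^ i * y 0" for i unfolding y_def by (induction i) (simp_all add: rot)
  have nb: "norm (b z) = norm z" for z using b by auto
  have ny: "norm (y i) < 1" for i unfolding y_def by (rule norm_mob[OF c]) (simp add: nb norm_kinv v)
  have bi: "chord_isometry b"
  proof -
    have "chord_isometry (\<lambda>z. z)" unfolding chord_isometry_def hisometry_def by (simp add: bij_betw_def)
    then show ?thesis using b chord_isometry_cnj by auto
  qed
  have kb: "kinv (b z) = b (kinv z)" for z using b by (auto simp: kinv_def)
  have nc: "norm (- c) < norm (1::complex)" using c by simp
  \<comment> \<open>A rotation that puts the first vertex on the positive real axis. It acts as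
    multiplication by \<open>k * k\<close>, whence the square root; the value 1 serves a vertex at
    the centre.\<close>
  define k where "k = (if y 0 = 0 then 1 else csqrt (cnj (sgn (y 0))))"
  have k: "norm k = 1" unfolding k_def by (auto simp: norm_sgn)
  have k2: "k * k * y 0 = of_real (norm (y 0))"
  proof (cases "y 0 = 0")
    case False
    then have "k * k = cnj (sgn (y 0))" unfolding k_def using power2_csqrt[of "cnj (sgn (y 0))"]
      by (simp only: power2_eq_square if_False)
    moreover have "cnj (sgn (y 0)) * y 0 = of_real (norm (y 0))"
      using False complex_norm_square[of "y 0"] by (simp add: sgn_eq field_simps power2_eq_square)
    ultimately show ?thesis by simp
  qed simp
  have kk: "k * cnj k = 1" using complex_norm_square[of k] k by simp
  have n0: "norm (0::complex) < norm k" using k by simp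
  have dk: "daut k 0 x = k * k * x" for x
  proof -
    have "cnj k \<noteq> 0" using k by auto
    have "daut k 0 x = k * x / cnj k" by (simp add: daut_def)
    also have "\<dots> = k * x * (k * cnj k) / cnj k" by (simp add: kk)
    also have "\<dots> = k * k * x" using \<open>cnj k \<noteq> 0\<close> by simp
    finally show ?thesis .
  qed
  define f1 where "f1 = (\<lambda>p. klein (daut 1 (- c) (kinv p)))"
  define f2 where "f2 = (\<lambda>p. klein (daut k 0 (kinv p)))"
  have "chord_isometry (f2 \<circ> (f1 \<circ> b))"
    unfolding f1_def f2_def by (intro chord_isometry_compose bi chord_isometry_daut nc n0)
  moreover have "(f2 \<circ> (f1 \<circ> b)) (v i) = klein (\<eta> ^ i * of_real (norm (mob c (b (kinv (v 0))))))" for i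
  proof -
    have "(f2 \<circ> (f1 \<circ> b)) (v i) = klein (daut k 0 (y i))"
      unfolding f1_def f2_def o_def kb mob_daut[symmetric] y_def[symmetric] using ny[of i]
        by (simp add: kinv_klein)
    also have "daut k 0 (y i) = \<eta> ^ i * (k * k * y 0)" unfolding dk yi[of i] by (simp add: mult_ac)
    finally show ?thesis unfolding k2 unfolding y_def .
  qed
  ultimately show thesis by (rule that)
qed

lemma congruent_polygonsI:
  assumes f: "chord_isometry f" and P: "ngon n P" and Q: "ngon n Q"
    and v: "\<And>i. f (vertex P i) = vertex Q i"
  shows "congruent_polygons P Q"
  unfolding congruent_polygons_def
proof (intro exI[of _ f] conjI)
  show "hisometry f" using f by (simp add: chord_isometry_def)
  have len: "length P = n" "length Q = n" using P Q by (auto simp: ngon_def)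
  have hv: "vertex P i \<in> hplane" for i using norm_vertex[OF P] by (simp add: hplane_def)
  have "f ` side P i = side Q i" for i
    unfolding side_def v[symmetric] using f hv unfolding chord_isometry_def by blast
  then show "f ` boundary P = boundary Q" unfolding boundary_def len image_UN by simp
  have set: "set R = vertex R ` {..<length R}" for R
    by (auto simp: set_conv_nth vertex_def image_def)
  show "f ` set P = set Q" unfolding set len image_image v ..
qed

lemma cyc_area_cnj: assumes "ctuple n z" shows "cyc_area n (\<lambda>i. cnj (z i)) = - cyc_area n z"
proof -
  have "tri_area (cnj x) (cnj y) = - tri_area x y" if "norm x < 1" "norm y < 1" for x y
  proof -
    have "1 - cnj (cnj x) * cnj y = cnj (1 - cnj x * y)" by simp
    then show ?thesis unfolding tri_area_def using Arg_cnj_pos[OF Re_one_minus_cnj_pos[OF that]]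
      by (simp only:)
  qed
  then show ?thesis unfolding cyc_area_def using ctuple_norm[OF assms] by (simp add: sum_negf)
qed

lemma cyc_perim_cnj: "cyc_perim n (\<lambda>i. cnj (z i)) = cyc_perim n z"
  unfolding cyc_perim_def pdist_def coshd_def complex_cnj_diff[symmetric] complex_mod_cnj ..

section \<open>Comparison with the regular polygon\<close>

theorem proposition3p7:
  fixes n :: nat and Q\<^sub>n Q :: "complex list"
  assumes "n \<ge> 3"
    and "regular_ngon n Q\<^sub>n"
    and "ngon n Q"
    and "polygon_area Q = polygon_area Q\<^sub>n"
    and "\<not> congruent_polygons Q\<^sub>n Q"
  shows "perimeter Q\<^sub>n < perimeter Q"
proof (rule ccontr)
  assume "\<not> perimeter Q\<^sub>n < perimeter Q"
  then have le: "perimeter Q \<le> perimeter Q\<^sub>n" by simp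
  have Qn: "ngon n Q\<^sub>n" using assms(2) by (simp add: regular_ngon_def)
  have n0: "n > 0" using assms(1) by simp
  have ct: "ctuple n (\<lambda>i. b (kinv (vertex P i)))"
    and area: "\<bar>cyc_area n (\<lambda>i. b (kinv (vertex P i)))\<bar> = polygon_area P"
    and perim: "cyc_perim n (\<lambda>i. b (kinv (vertex P i))) = perimeter P"
    if P: "ngon n P" and b: "b = (\<lambda>z. z) \<or> b = cnj" for P b
  proof -
    have "vertex P (i + n) = vertex P i" for i using vertex_add_length[of P i] P by (simp add: ngon_def)
    then have c: "ctuple n (\<lambda>i. kinv (vertex P i))" unfolding ctuple_def
      using norm_kinv norm_vertex[OF P] by simp
    then show "ctuple n (\<lambda>i. b (kinv (vertex P i)))" using b by (auto simp: ctuple_def)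
    show "\<bar>cyc_area n (\<lambda>i. b (kinv (vertex P i)))\<bar> = polygon_area P"
      unfolding polygon_area_eq[OF P] using b cyc_area_cnj[OF c] by auto
    show "cyc_perim n (\<lambda>i. b (kinv (vertex P i))) = perimeter P"
      unfolding perimeter_eq[OF P] using b cyc_perim_cnj by auto
  qed
  have tuple_neq: "b (kinv (vertex P i)) \<noteq> b (kinv (vertex P (Suc i)))"
    if P: "ngon n P" and b: "b = (\<lambda>z. z) \<or> b = cnj" for P b i
  proof
    assume "b (kinv (vertex P i)) = b (kinv (vertex P (Suc i)))"
    then have "kinv (vertex P i) = kinv (vertex P (Suc i))" using b by auto
    then have "vertex P i = vertex P (Suc i)" using klein_kinv norm_vertex[OF P] by metis
    then show False using ngon_vertex_Suc_neq[OF P] by blast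
  qed
  obtain b c where b: "b = (\<lambda>z. z) \<or> b = cnj" and c: "norm c < 1"
    and rot: "\<And>i. mob c (b (kinv (vertex Q\<^sub>n (Suc i))))
      = cis (2 * pi / real n) * mob c (b (kinv (vertex Q\<^sub>n i)))"
    by (rule regular_ngon_rotation[OF assms(2)]) (rule that)
  define z where "z i = b (kinv (vertex Q\<^sub>n i))" for i
  note ctz = ct[OF Qn b, folded z_def]
  have h: "0 < pi / real n" "pi / real n < pi / 2"
    using assms(1) by (simp, intro divide_strict_left_mono) auto
  have h': "pi / real n < pi" using h(2) pi_gt_zero by linarith
  have rot': "mob c (z (Suc i)) = cis (2 * (pi / real n)) * mob c (z i)" for i using rot[of i]
    by (simp add: z_def)
  \<comment> \<open>A nonzero circumradius makes the half side positive, so \<open>C > 1\<close>,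
    and since \<open>cos (pi / n)\<close> is positive so is the area per side.\<close>
  have pos: "cyc_area n z > 0"
  proof -
    obtain C where C: "C \<ge> 1" "cyc_area n z = real n * side_area C (pi / real n)"
      "radius_relation C (pi / real n) (norm (mob c (z 0)))"
      by (rule rotation_tuple_values[OF ctz c h(1) h' rot']) (rule that)
    have "mob c (z 0) \<noteq> 0"
    proof
      assume "mob c (z 0) = 0"
      then have "mob c (z (Suc 0)) = mob c (z 0)" using rot'[of 0] by simp
      then have "z (Suc 0) = z 0" using mob_inj[OF c] ctuple_norm[OF ctz] by blast
      then show False using tuple_neq[OF Qn b, of 0] unfolding z_def by simp
    qed
    moreover have "sin (pi / real n) > 0" using h(1) h' by (rule sin_gt_zero)
    ultimately have "4 * (norm (mob c (z 0)))\<^sup>2 * (sin (pi / real n))\<^sup>2 > 0" by simp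
    then have "C \<noteq> 1" using C(3) by (auto simp: radius_relation_def)
    then have C1: "C > 1" using C(1) by simp
    have cp: "cos (pi / real n) > 0" using h by (intro cos_gt_zero) auto
    then have "cos (pi / real n) / C < cos (pi / real n)" using C1 by (simp add: divide_less_eq)
    moreover have "0 < cos (pi / real n) / C" using cp C1 by simp
    ultimately have "arcsin (cos (pi / real n) / C) < arcsin (cos (pi / real n))"
      by (intro arcsin_less_arcsin) auto
    then have "side_area C (pi / real n) > 0" using h h' by (simp add: side_area_eq)
    then show ?thesis unfolding C(2) using n0 by simp
  qed
  have absQ: "\<bar>cyc_area n (\<lambda>i. kinv (vertex Q i))\<bar> = cyc_area n z"
    using area[OF assms(3), of "\<lambda>z. z"] area[OF Qn b, folded z_def] pos assms(4) by simp
  have negQ: "cyc_area n (\<lambda>i. cnj (kinv (vertex Q i))) = - cyc_area n (\<lambda>i. kinv (vertex Q i))"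
    using cyc_area_cnj[OF ct[OF assms(3), of "\<lambda>z. z"]] by simp
  \<comment> \<open>\<open>polygon_area\<close> determines the signed area only up to sign; a
    reflection of \<open>Q\<close> makes it agree with that of \<open>z\<close>.\<close>
  obtain b' where b': "b' = (\<lambda>z. z) \<or> b' = cnj"
    and area': "cyc_area n (\<lambda>i. b' (kinv (vertex Q i))) = cyc_area n z"
  proof (cases "cyc_area n (\<lambda>i. kinv (vertex Q i)) \<ge> 0")
    case True
    then show ?thesis using that[of "\<lambda>z. z"] absQ by simp
  next
    case False
    then show ?thesis using that[of cnj] absQ negQ by simp
  qed
  define w where "w i = b' (kinv (vertex Q i))" for i
  note ctw = ct[OF assms(3) b', folded w_def]
  have ns: "w i \<noteq> w (Suc i)" for i unfolding w_def by (rule tuple_neq[OF assms(3) b'])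
  have "cyc_perim n w \<le> cyc_perim n z"
    using le perim[OF assms(3) b', folded w_def] perim[OF Qn b, folded z_def] by simp
  then obtain e where e: "norm e < 1" "\<And>i. mob e (w (Suc i)) = cis (2 * (pi / real n)) * mob e (w i)"
    "norm (mob e (w 0)) = norm (mob c (z 0))"
    using isoperimetric_tuple[OF assms(1) ctz c rot' pos ctw ns] area'[folded w_def] by metis
  define R where "R = norm (mob c (z 0))"
  obtain f where f: "chord_isometry f"
    "\<And>i. f (vertex Q\<^sub>n i) = klein (cis (2 * (pi / real n)) ^ i * of_real R)"
    by (rule rotation_chord_isometry[where v = "vertex Q\<^sub>n", OF b c norm_vertex[OF Qn] rot'[unfolded z_def]]) (rule that, unfold R_def z_def)
  obtain g where g: "chord_isometry g"
    "\<And>i. g (vertex Q i) = klein (cis (2 * (pi / real n)) ^ i * of_real R)"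
    by (rule rotation_chord_isometry[where v = "vertex Q", OF b' e(1) norm_vertex[OF assms(3)] e(2)[unfolded w_def]]) (rule that, unfold R_def e(3)[symmetric] w_def)
  \<comment> \<open>\<open>f\<close> and \<open>g\<close> bring both polygons to the same normal
    form, so \<open>f\<close> followed by the inverse of \<open>g\<close> matches their
    vertices.\<close>
  obtain g' where g': "chord_isometry g'" "\<And>p. p \<in> hplane \<Longrightarrow> g' (g p) = p"
    using chord_isometry_inverse[OF g(1)] by blast
  have "congruent_polygons Q\<^sub>n Q"
  proof (rule congruent_polygonsI[OF chord_isometry_compose[OF f(1) g'(1)] Qn assms(3)])
    show "(g' \<circ> f) (vertex Q\<^sub>n i) = vertex Q i" for i
      using g'(2)[of "vertex Q i"] norm_vertex[OF assms(3), of i] f(2)[of i] g(2)[of i]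
        by (simp add: hplane_def)
  qed
  then show False using assms(5) by blast
qed

end
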